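(* For every $M\in\mathbb N$ there exists $N_M\in\mathbb N$ such that, for every $n$ and every $g\in\mathcal S(\mathbb R^2)$, $$\big\|\mathcal G_n^{-1}\big(g|_{\Sigma^n_{\mathcal D}}\big)\big\|_{(M)}\le C_{M,n}\,\|g\|_{(N_M)},$$ where the constant $C_{M,n}$ (independent of $g$) has polynomial growth in $n$.
   Context: Representations. $K=U_2$. For an integer $n\ge0$, $V_n$ is the space of holomorphic homogeneous polynomials of degree $n$ on $\mathbb C^2$, with the representation $[\tau_n(k)p](z)=p(k^{-1}z)$ of $SU_2$ and the inner product making $e_n^j(z)=\binom nj^{1/2}z_1^jz_2^{n-j}$, $j=0,\dots,n$, an orthonormal basis ($\tau_n$ is then unitary). Elements of $\mathrm{End}(V_n)$ are written as matrices in this basis, with indices $0,\dots,n$; $E_{jj}$ is the matrix whose only nonzero entry is a $1$ in position $(j,j)$. A function $F:\mathbb C^2\to\mathrm{End}(V_n)$ is $K$-equivariant if $F(e^{i\theta}kz)=\tau_n(k)F(z)\tau_n(k)^{-1}$ for all $\theta\in\mathbb R$, $k\in SU_2$, $z\in\mathbb C^2$. $\mathcal S(\mathbb C^2,\mathrm{End}(V_n))^K$ is the Fréchet space of $K$-equivariant $\mathrm{End}(V_n)$-valued Schwartz functions on $\mathbb C^2$. Spherical transform. Let $\langle z,\zeta\rangle=\mathrm{Re}(z_1\bar\zeta_1+z_2\bar\zeta_2)$ and let $\sigma$ be the normalized surface measure on the unit sphere $S^3\subset\mathbb C^2$. For $\zeta\in S^3$ let $k_\zeta=\begin{bmatrix}\bar\zeta_2&\zeta_1\\-\bar\zeta_1&\zeta_2\end{bmatrix}\in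 SU_2$. For $\xi\ge0$, $j=0,\dots,n$, put $\Phi_{\xi,j}(z)=(n+1)\int_{S^3}e^{-i\sqrt\xi\langle z,\zeta\rangle}\tau_n(k_\zeta)E_{jj}\tau_n(k_\zeta)^*\,d\sigma(\zeta)$. Let $\Sigma^n_{\mathcal D}=\{(\xi,(-n+2j)\xi):\xi\ge0,\ j=0,\dots,n\}\subset\mathbb R^2$ and $$\mathcal G_nF\big(\xi,(-n+2j)\xi\big)=\frac1{n+1}\int_{\mathbb C^2}\mathrm{tr}\big(F(z)\Phi_{\xi,j}(-z)\big)\,dz .$$ $\mathcal G_n$ is a bijection of $\mathcal S(\mathbb C^2,\mathrm{End}(V_n))^K$ onto the space $\mathcal S(\Sigma^n_{\mathcal D})$ of restrictions to $\Sigma^n_{\mathcal D}$ of functions in $\mathcal S(\mathbb R^2)$. Norms. With $\Delta_z=-4\sum_{j=1,2}\partial_{z_j}\partial_{\bar z_j}$ acting entrywise, $\|F\|_{(M)}=\max_{0\le q\le M}\|(1+|\cdot|^2)^M\Delta_z^qF\|_2$, where $\|F\|_2^2=\int_{\mathbb C^2}\|F(z)\|_{HS}^2\,dz$ (Hilbert–Schmidt norm). On $\mathcal S(\mathbb R^2)$, $\|g\|_{(N)}=\max_{|\alpha|\le N}\sup_{\xi}(1+|\xi|^2)^N|\partial^\alpha g(\xi)|$. *)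

theory Defs
  imports
    "HOL-Library.Landau_Symbols"
    "Jordan_Normal_Form.Gauss_Jordan_Elimination"
    "Jordan_Normal_Form.Schur_Decomposition"
    "HOL-Analysis.Analysis"
begin

text \<open>
  Points of \<open>\<complex>\<^sup>2\<close> and elements of \<open>SU\<^sub>2\<close> use the fixed-dimension types of HOL-Analysis, so that
  \<open>lborel\<close> is Lebesgue measure on \<open>\<complex>\<^sup>2 = \<real>\<^sup>4\<close>, and \<open>z \<bullet> \<zeta>\<close> is the real part of the Hermitian product.
  Since \<open>n\<close> varies inside the statement, \<open>End(V\<^sub>n)\<close> uses the matrices of Jordan_Normal_Form with
  carrier \<open>carrier_mat (n + 1) (n + 1)\<close>.
\<close>

no_notation vec_index (infixl "$" 100)
no_notation scalar_prod (infix "\<bullet>" 70)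

type_synonym C2 = "complex ^ 2"

section \<open>Smooth and Schwartz functions\<close>

definition pderivative :: "'a::euclidean_space \<Rightarrow> ('a \<Rightarrow> complex) \<Rightarrow> 'a \<Rightarrow> complex" where
  "pderivative b f = (\<lambda>x. frechet_derivative f (at x) b)"

text \<open>Iterated partial derivative along a list of basis vectors, the last one being applied first.\<close>

definition iter_pderivative :: "'a::euclidean_space list \<Rightarrow> ('a \<Rightarrow> complex) \<Rightarrow> 'a \<Rightarrow> complex" where
  "iter_pderivative bs f = foldr pderivative bs f"

definition smooth :: "('a::euclidean_space \<Rightarrow> complex) \<Rightarrow> bool" where
  "smooth f \<longleftrightarrow> (\<forall>bs \<in> lists Basis. \<forall>x. iter_pderivative bs f differentiable (at x))"

definition schwartz :: "('a::euclidean_space \<Rightarrow> complex) \<Rightarrow> bool" where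
  "schwartz f \<longleftrightarrow> smooth f \<and>
     (\<forall>bs \<in> lists Basis. \<forall>N::nat.
        bounded (range (\<lambda>x. (1 + (norm x)\<^sup>2) ^ N *\<^sub>R iter_pderivative bs f x)))"

text \<open>\<open>\<partial>\<^sup>\<alpha>\<close> on \<open>\<real>\<^sup>2\<close>, for a multi-index \<open>\<alpha>\<close>.\<close>

definition multi_deriv :: "nat \<times> nat \<Rightarrow> (real \<times> real \<Rightarrow> complex) \<Rightarrow> real \<times> real \<Rightarrow> complex" where
  "multi_deriv \<alpha> g = (pderivative (1, 0) ^^ fst \<alpha>) ((pderivative (0, 1) ^^ snd \<alpha>) g)"

text \<open>The supremum is finite for Schwartz functions, to which the norm is applied.\<close>

definition schwartz_norm :: "nat \<Rightarrow> (real \<times> real \<Rightarrow> complex) \<Rightarrow> real" where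
  "schwartz_norm N g =
     (MAX \<alpha>\<in>{\<alpha>. fst \<alpha> + snd \<alpha> \<le> N}. SUP x. (1 + (norm x)\<^sup>2) ^ N * cmod (multi_deriv \<alpha> g x))"

section \<open>The Laplacian on \<open>\<complex>\<^sup>2\<close>\<close>

definition wirtinger :: "2 \<Rightarrow> (C2 \<Rightarrow> complex) \<Rightarrow> C2 \<Rightarrow> complex" where
  "wirtinger j f =
     (\<lambda>z. (pderivative (axis j 1) f z - \<i> * pderivative (axis j \<i>) f z) / 2)"

definition wirtinger_bar :: "2 \<Rightarrow> (C2 \<Rightarrow> complex) \<Rightarrow> C2 \<Rightarrow> complex" where
  "wirtinger_bar j f =
     (\<lambda>z. (pderivative (axis j 1) f z + \<i> * pderivative (axis j \<i>) f z) / 2)"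

definition laplacian :: "(C2 \<Rightarrow> complex) \<Rightarrow> C2 \<Rightarrow> complex" where
  "laplacian f = (\<lambda>z. - 4 * (\<Sum>j\<in>UNIV. wirtinger j (wirtinger_bar j f) z))"

definition mat_laplacian :: "nat \<Rightarrow> (C2 \<Rightarrow> complex mat) \<Rightarrow> C2 \<Rightarrow> complex mat" where
  "mat_laplacian n F =
     (\<lambda>z. Matrix.mat (n + 1) (n + 1) (\<lambda>(i, l). laplacian (\<lambda>w. F w $$ (i, l)) z))"

section \<open>\<open>SU\<^sub>2\<close> and the representations \<open>\<tau>\<^sub>n\<close>\<close>

definition SU2 :: "(complex ^ 2 ^ 2) set" where
  "SU2 = {k. k ** (\<chi> i j. cnj (k $ j $ i)) = Finite_Cartesian_Product.mat 1 \<and>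
             (\<chi> i j. cnj (k $ j $ i)) ** k = Finite_Cartesian_Product.mat 1 \<and>
             Determinants.det k = 1}"

definition basis_poly :: "nat \<Rightarrow> nat \<Rightarrow> C2 \<Rightarrow> complex" where
  "basis_poly n j = (\<lambda>z. of_real (sqrt (real (n choose j))) * (z $ 1) ^ j * (z $ 2) ^ (n - j))"

definition V :: "nat \<Rightarrow> (C2 \<Rightarrow> complex) set" where
  "V n = {p. \<exists>c. p = (\<lambda>z. \<Sum>j\<le>n. c j * basis_poly n j z)}"

text \<open>Coordinates of \<open>p \<in> V n\<close> in the basis \<open>basis_poly n 0, \<dots>, basis_poly n n\<close>.\<close>

definition coords :: "nat \<Rightarrow> (C2 \<Rightarrow> complex) \<Rightarrow> nat \<Rightarrow> complex" where
  "coords n p = (THE c. (\<forall>j>n. c j = 0) \<and> p = (\<lambda>z. \<Sum>j\<le>n. c j * basis_poly n j z))"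

definition op_matrix :: "nat \<Rightarrow> ((C2 \<Rightarrow> complex) \<Rightarrow> C2 \<Rightarrow> complex) \<Rightarrow> complex mat" where
  "op_matrix n A = Matrix.mat (n + 1) (n + 1) (\<lambda>(i, j). coords n (A (basis_poly n j)) i)"

definition tau_op :: "complex ^ 2 ^ 2 \<Rightarrow> (C2 \<Rightarrow> complex) \<Rightarrow> C2 \<Rightarrow> complex" where
  "tau_op k p = (\<lambda>z. p (matrix_inv k *v z))"

definition tau :: "nat \<Rightarrow> complex ^ 2 ^ 2 \<Rightarrow> complex mat" where
  "tau n k = op_matrix n (tau_op k)"

definition E_mat :: "nat \<Rightarrow> nat \<Rightarrow> complex mat" where
  "E_mat n j = Matrix.mat (n + 1) (n + 1) (\<lambda>(a, b). if a = j \<and> b = j then 1 else 0)"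

definition mat_trace :: "complex mat \<Rightarrow> complex" where
  "mat_trace A = (\<Sum>i<dim_row A. A $$ (i, i))"

definition hs_norm :: "complex mat \<Rightarrow> real" where
  "hs_norm A = sqrt (\<Sum>i<dim_row A. \<Sum>l<dim_col A. (cmod (A $$ (i, l)))\<^sup>2)"

section \<open>Equivariant Schwartz functions\<close>

definition equivariant :: "nat \<Rightarrow> (C2 \<Rightarrow> complex mat) \<Rightarrow> bool" where
  "equivariant n F \<longleftrightarrow>
     (\<forall>\<theta>::real. \<forall>k\<in>SU2. \<forall>z.
        F (exp (\<i> * of_real \<theta>) *s (k *v z)) = tau n k * F z * the (mat_inverse (tau n k)))"

definition schwartz_K :: "nat \<Rightarrow> (C2 \<Rightarrow> complex mat) set" where
  "schwartz_K n =
     {F. (\<forall>z. F z \<in> carrier_mat (n + 1) (n + 1)) \<and>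
         (\<forall>i\<le>n. \<forall>l\<le>n. schwartz (\<lambda>z. F z $$ (i, l))) \<and>
         equivariant n F}"

definition L2_norm_mat :: "(C2 \<Rightarrow> complex mat) \<Rightarrow> real" where
  "L2_norm_mat F = sqrt (\<integral>z. (hs_norm (F z))\<^sup>2 \<partial>lborel)"

definition weighted_norm :: "nat \<Rightarrow> nat \<Rightarrow> (C2 \<Rightarrow> complex mat) \<Rightarrow> real" where
  "weighted_norm n M F =
     (MAX q\<in>{..M}. L2_norm_mat
        (\<lambda>z. of_real ((1 + (norm z)\<^sup>2) ^ M) \<cdot>\<^sub>m (mat_laplacian n ^^ q) F z))"

section \<open>The spherical transform\<close>

text \<open>
  Normalized surface measure on \<open>S\<^sup>3\<close>, as the cone measure: the image of the normalized Lebesgue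
  measure of the unit ball under \<open>z \<mapsto> z / |z|\<close>.  It is a measure on \<open>\<complex>\<^sup>2\<close> concentrated on the sphere
  (\<open>sgn 0 = 0\<close> only affects a null set).
\<close>

definition sphere_measure :: "C2 measure" where
  "sphere_measure = distr (uniform_measure lborel (ball 0 1)) borel sgn"

definition k_mat :: "C2 \<Rightarrow> complex ^ 2 ^ 2" where
  "k_mat \<zeta> = vector [vector [cnj (\<zeta> $ 2), \<zeta> $ 1], vector [- cnj (\<zeta> $ 1), \<zeta> $ 2]]"

definition spherical_fun :: "nat \<Rightarrow> real \<Rightarrow> nat \<Rightarrow> C2 \<Rightarrow> complex mat" where
  "spherical_fun n \<xi> j z =
     Matrix.mat (n + 1) (n + 1) (\<lambda>(a, b).
       of_nat (n + 1) *
       (\<integral>\<zeta>. exp (- \<i> * of_real (sqrt \<xi> * (z \<bullet> \<zeta>))) *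
             (tau n (k_mat \<zeta>) * E_mat n j * mat_adjoint (tau n (k_mat \<zeta>))) $$ (a, b)
        \<partial>sphere_measure))"

definition Sigma_D :: "nat \<Rightarrow> (real \<times> real) set" where
  "Sigma_D n = {(\<xi>, (- real n + 2 * real j) * \<xi>) | \<xi> j. 0 \<le> \<xi> \<and> j \<le> n}"

text \<open>
  Functions on \<open>Sigma_D n\<close> are taken extensional, as in \<open>restrict\<close>.  A point of \<open>Sigma_D n\<close>
  determines \<open>j\<close> except at the origin, where every \<open>j \<le> n\<close> is admissible and the choice is
  immaterial, because \<open>\<Phi>\<^sub>0\<^sub>,\<^sub>j\<close> is the identity for every \<open>j\<close> by Schur's lemma.
\<close>

definition spherical_transform :: "nat \<Rightarrow> (C2 \<Rightarrow> complex mat) \<Rightarrow> real \<times> real \<Rightarrow> complex" where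
  "spherical_transform n F =
     (\<lambda>(\<xi>, \<eta>)\<in>Sigma_D n.
        let j = (SOME j. j \<le> n \<and> \<eta> = (- real n + 2 * real j) * \<xi>)
        in (\<integral>z. mat_trace (F z * spherical_fun n \<xi> j (- z)) \<partial>lborel) / of_nat (n + 1))"

definition inverse_spherical_transform ::
  "nat \<Rightarrow> (real \<times> real \<Rightarrow> complex) \<Rightarrow> C2 \<Rightarrow> complex mat" where
  "inverse_spherical_transform n = inv_into (schwartz_K n) (spherical_transform n)"

section \<open>The definite descriptions and inverses above are well defined\<close>

lemma coords_unique:
  assumes "\<And>j. j > n \<Longrightarrow> c j = 0" "\<And>j. j > n \<Longrightarrow> d j = 0"
    and eq: "(\<lambda>z. \<Sum>j\<le>n. c j * basis_poly n j z) = (\<lambda>z. \<Sum>j\<le>n. d j * basis_poly n j z)"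
  shows "c = d"
proof
  fix j
  define s where "s i = complex_of_real (sqrt (real (n choose i)))" for i
  have "(\<Sum>i\<le>n. (c i * s i) * x ^ i) = (\<Sum>i\<le>n. (d i * s i) * x ^ i)" for x :: complex
    using fun_cong[OF eq, of "vector [x, 1]"]
    by (simp add: basis_poly_def s_def mult.assoc)
  then have "\<forall>x. (\<Sum>i\<le>n. (c i * s i) * x ^ i) = (\<Sum>i\<le>n. (d i * s i) * x ^ i)" by blast
  then have *: "\<forall>i\<le>n. c i * s i = d i * s i"
    by (subst (asm) polyfun_eq_coeffs)
  have "s i \<noteq> 0" if "i \<le> n" for i using that by (simp add: s_def)
  with * assms(1,2) show "c j = d j"
    by (cases "j \<le> n") auto
qed

lemma V_coords:
  assumes "p \<in> V n"
  shows "\<forall>j>n. coords n p j = 0" "p = (\<lambda>z. \<Sum>j\<le>n. coords n p j * basis_poly n j z)"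
proof -
  from assms obtain c where c: "p = (\<lambda>z. \<Sum>j\<le>n. c j * basis_poly n j z)"
    unfolding V_def by blast
  let ?P = "\<lambda>c. (\<forall>j>n. c j = 0) \<and> p = (\<lambda>z. \<Sum>j\<le>n. c j * basis_poly n j z)"
  have ex: "?P (\<lambda>j. if j \<le> n then c j else 0)" by (simp add: c)
  have uniq: "d = d'" if d: "?P d" and d': "?P d'" for d d'
  proof (rule coords_unique[of n])
    show "(\<lambda>z. \<Sum>j\<le>n. d j * basis_poly n j z) = (\<lambda>z. \<Sum>j\<le>n. d' j * basis_poly n j z)"
      by (rule trans[OF sym[OF conjunct2[OF d]] conjunct2[OF d']])
  qed (use conjunct1[OF d] conjunct1[OF d'] in \<open>simp_all\<close>)
  have "\<exists>!c. ?P c"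
    by (rule ex1I[where P = ?P, OF ex], erule uniq, rule ex)
  then have P: "?P (coords n p)"
    unfolding coords_def by (rule theI')
  show "\<forall>j>n. coords n p j = 0" "p = (\<lambda>z. \<Sum>j\<le>n. coords n p j * basis_poly n j z)"
    by (rule conjunct1[OF P], rule conjunct2[OF P])
qed

lemma monom_in_V:
  assumes "j + l = n"
  shows "(\<lambda>z. (z $ 1) ^ j * (z $ 2) ^ l) \<in> V n"
proof -
  define c where "c i = (if i = j then inverse (complex_of_real (sqrt (real (n choose j)))) else 0)" for i
  have "(\<Sum>i\<le>n. c i * basis_poly n i z) = c j * basis_poly n j z" for z
    by (rule sum.remove[of _ j, THEN trans]) (use assms in \<open>auto simp: c_def\<close>)
  moreover have "n - j = l" "n choose j \<noteq> 0" using assms by auto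
  ultimately have "(\<lambda>z. (z $ 1) ^ j * (z $ 2) ^ l) = (\<lambda>z. \<Sum>i\<le>n. c i * basis_poly n i z)"
    by (auto simp: c_def basis_poly_def)
  then show ?thesis unfolding V_def by blast
qed

lemma V_add: "p \<in> V n \<Longrightarrow> q \<in> V n \<Longrightarrow> (\<lambda>z. p z + q z) \<in> V n"
  unfolding V_def
  by clarsimp (rule_tac x="\<lambda>j. c j + ca j" in exI, simp add: sum.distrib ring_distribs)

lemma V_scale: "p \<in> V n \<Longrightarrow> (\<lambda>z. a * p z) \<in> V n"
  unfolding V_def
  by clarsimp (rule_tac x="\<lambda>j. a * c j" in exI, simp add: sum_distrib_left mult.assoc)

lemma V_sum: "(\<And>i. i \<in> I \<Longrightarrow> p i \<in> V n) \<Longrightarrow> (\<lambda>z. \<Sum>i\<in>I. p i z) \<in> V n"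
proof (induction I rule: infinite_finite_induct)
  case (insert x F)
  then show ?case using V_add[of "p x" n "\<lambda>z. \<Sum>i\<in>F. p i z"] by simp
qed (auto simp: V_def intro!: exI[of _ "\<lambda>_. 0"])

lemma V_linear_times:
  assumes "p \<in> V n"
  shows "(\<lambda>z. (a * z $ 1 + b * z $ 2) * p z) \<in> V (Suc n)"
proof -
  from assms obtain c where c: "p = (\<lambda>z. \<Sum>j\<le>n. c j * basis_poly n j z)"
    unfolding V_def by blast
  define s where "s i = complex_of_real (sqrt (real (n choose i)))" for i
  have "(\<lambda>z. (a * z $ 1 + b * z $ 2) * p z) =
    (\<lambda>z. \<Sum>j\<le>n. (c j * s j * a) * ((z $ 1) ^ (Suc j) * (z $ 2) ^ (n - j)) +
               (c j * s j * b) * ((z $ 1) ^ j * (z $ 2) ^ (Suc (n - j))))"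
    by (simp add: c basis_poly_def s_def sum_distrib_left algebra_simps)
  also have "\<dots> \<in> V (Suc n)"
    by (intro V_sum V_add V_scale monom_in_V) auto
  finally show ?thesis .
qed

lemma V_linear_powers:
  "(\<lambda>z. (a * z $ 1 + b * z $ 2) ^ j * (c * z $ 1 + d * z $ 2) ^ l) \<in> V (j + l)"
proof (induction j)
  case 0
  show ?case
  proof (induction l)
    case 0
    show ?case using monom_in_V[of 0 0 0] by simp
  next
    case (Suc l)
    then show ?case using V_linear_times[OF Suc.IH, of c d] by (simp add: mult.assoc)
  qed
next
  case (Suc j)
  then show ?case using V_linear_times[OF Suc.IH, of a b] by (simp add: mult.assoc)
qed

lemma tau_op_V:
  assumes "p \<in> V n"
  shows "tau_op k p \<in> V n"
proof -
  from assms obtain c where c: "p = (\<lambda>z. \<Sum>j\<le>n. c j * basis_poly n j z)"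
    unfolding V_def by blast
  define m where "m = matrix_inv k"
  define s where "s i = complex_of_real (sqrt (real (n choose i)))" for i
  have "tau_op k p = (\<lambda>z. \<Sum>j\<le>n. (c j * s j) *
      ((m $ 1 $ 1 * z $ 1 + m $ 1 $ 2 * z $ 2) ^ j * (m $ 2 $ 1 * z $ 1 + m $ 2 $ 2 * z $ 2) ^ (n - j)))"
    by (simp add: c tau_op_def basis_poly_def s_def m_def matrix_vector_mult_def sum_2 mult.assoc)
  also have "\<dots> \<in> V n"
  proof (intro V_sum V_scale)
    fix j assume "j \<in> {..n}"
    then have "j + (n - j) = n" by simp
    with V_linear_powers[of "m $ 1 $ 1" "m $ 1 $ 2" j "m $ 2 $ 1" "m $ 2 $ 2" "n - j"]
    show "(\<lambda>z. (m $ 1 $ 1 * z $ 1 + m $ 1 $ 2 * z $ 2) ^ j *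
        (m $ 2 $ 1 * z $ 1 + m $ 2 $ 2 * z $ 2) ^ (n - j)) \<in> V n"
      by (simp only:)
  qed
  finally show ?thesis .
qed

lemma basis_poly_in_V: "j \<le> n \<Longrightarrow> basis_poly n j \<in> V n"
  using V_scale[OF monom_in_V[of j "n - j" n], of "of_real (sqrt (real (n choose j)))"]
  by (simp add: basis_poly_def mult.assoc)

lemma tau_basis_poly:
  assumes "j \<le> n"
  shows "tau_op k (basis_poly n j) = (\<lambda>z. \<Sum>i\<le>n. tau n k $$ (i, j) * basis_poly n i z)"
proof -
  have "tau n k $$ (i, j) = coords n (tau_op k (basis_poly n j)) i" if "i \<le> n" for i
    using that assms by (simp add: tau_def op_matrix_def)
  then have "(\<Sum>i\<le>n. tau n k $$ (i, j) * basis_poly n i z) =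
      (\<Sum>i\<le>n. coords n (tau_op k (basis_poly n j)) i * basis_poly n i z)" for z
    by simp
  then show ?thesis
    by (subst V_coords(2)[OF tau_op_V[OF basis_poly_in_V[OF assms]], of k]) (rule ext, rule sym)
qed

lemma SU2_inv:
  assumes "k \<in> SU2"
  shows "k ** matrix_inv k = Finite_Cartesian_Product.mat 1" "matrix_inv k ** k = Finite_Cartesian_Product.mat 1"
proof -
  have "\<exists>k'. k ** k' = Finite_Cartesian_Product.mat 1 \<and> k' ** k = Finite_Cartesian_Product.mat 1"
    using assms unfolding SU2_def by blast
  from someI_ex[OF this]
  show "k ** matrix_inv k = Finite_Cartesian_Product.mat 1" "matrix_inv k ** k = Finite_Cartesian_Product.mat 1"
    unfolding matrix_inv_def by blast+
qed

lemma k_mat_SU2: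
  assumes "norm \<zeta> = 1"
  shows "k_mat \<zeta> \<in> SU2"
proof -
  have "(cmod (\<zeta> $ 1))\<^sup>2 + (cmod (\<zeta> $ 2))\<^sup>2 = 1"
    using assms by (simp add: norm_vec_def L2_set_def sum_2)
  then have "\<zeta> $ 1 * cnj (\<zeta> $ 1) + \<zeta> $ 2 * cnj (\<zeta> $ 2) = 1"
    by (metis complex_norm_square of_real_1 of_real_add)
  then show ?thesis
    by (simp add: SU2_def k_mat_def vec_eq_iff forall_2 matrix_matrix_mult_def sum_2
        Finite_Cartesian_Product.mat_def det_2 algebra_simps)
qed

lemma k_mat_apply: "k_mat \<zeta> *v axis 2 1 = \<zeta>"
  by (simp add: k_mat_def vec_eq_iff forall_2 matrix_vector_mult_def sum_2 axis_def)

lemma tau_carrier: "tau n k \<in> carrier_mat (n + 1) (n + 1)"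
  by (simp add: tau_def op_matrix_def)

lemma tau_invertible:
  assumes "k \<in> SU2"
  shows "\<exists>B. mat_inverse (tau n k) = Some B"
proof (rule ccontr)
  assume "\<nexists>B. mat_inverse (tau n k) = Some B"
  then have none: "mat_inverse (tau n k) = None" by auto
  define l where "l = matrix_inv k"
  have kl: "k ** l = Finite_Cartesian_Product.mat 1" "l ** k = Finite_Cartesian_Product.mat 1"
    using SU2_inv[OF assms] by (auto simp: l_def)
  have "\<exists>k'. l ** k' = Finite_Cartesian_Product.mat 1 \<and> k' ** l = Finite_Cartesian_Product.mat 1"
    using kl by blast
  from someI_ex[OF this] have l: "l ** matrix_inv l = Finite_Cartesian_Product.mat 1"
    unfolding matrix_inv_def by blast
  then have il: "matrix_inv l = k"
    by (metis kl(1) matrix_mul_assoc matrix_mul_lid matrix_mul_rid)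
  have prod: "tau n a * tau n b = 1\<^sub>m (n + 1)"
    if ab: "matrix_inv b ** matrix_inv a = Finite_Cartesian_Product.mat 1" for a b
  proof (rule eq_matI)
    fix i j assume ij: "i < dim_row (1\<^sub>m (n+1) :: complex mat)" "j < dim_col (1\<^sub>m (n+1) :: complex mat)"
    then have j: "j \<le> n" and i: "i \<le> n" by auto
    define P where "P m = (if m \<le> n then (\<Sum>r\<le>n. tau n a $$ (m, r) * tau n b $$ (r, j)) else 0)" for m
    have "basis_poly n j z = (\<Sum>m\<le>n. P m * basis_poly n m z)" for z
    proof -
      have "basis_poly n j z = tau_op a (tau_op b (basis_poly n j)) z"
        using ab by (simp add: tau_op_def matrix_vector_mul_assoc)
      also have "\<dots> = (\<Sum>r\<le>n. tau n b $$ (r, j) * tau_op a (basis_poly n r) z)"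
        unfolding tau_basis_poly[OF j, of b] by (simp add: tau_op_def)
      also have "\<dots> = (\<Sum>r\<le>n. \<Sum>m\<le>n. tau n b $$ (r, j) * (tau n a $$ (m, r) * basis_poly n m z))"
        by (intro sum.cong refl) (simp add: tau_basis_poly sum_distrib_left)
      also have "\<dots> = (\<Sum>m\<le>n. P m * basis_poly n m z)"
        by (subst sum.swap) (simp add: P_def sum_distrib_left sum_distrib_right algebra_simps)
      finally show ?thesis .
    qed
    moreover have "basis_poly n j z = (\<Sum>m\<le>n. (if m = j then 1 else 0) * basis_poly n m z)" for z
      using j by (simp add: if_distrib[of "\<lambda>x. x * _"] cong: if_cong)
    ultimately have "P = (\<lambda>m. if m = j then 1 else 0)"
      using j by (intro coords_unique[of n]) (auto simp: P_def)
    then have "P i = (if i = j then 1 else 0)" by simp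
    moreover have "(tau n a * tau n b) $$ (i, j) = (\<Sum>r\<le>n. tau n a $$ (i, r) * tau n b $$ (r, j))"
      using i j tau_carrier[of n a] tau_carrier[of n b]
      by (auto simp: scalar_prod_def atLeast0LessThan lessThan_Suc_atMost)
    ultimately show "(tau n a * tau n b) $$ (i, j) = 1\<^sub>m (n + 1) $$ (i, j)"
      using i j by (simp add: P_def)
  qed (use tau_carrier in \<open>auto\<close>)
  have "tau n k * tau n l = 1\<^sub>m (n + 1)" "tau n l * tau n k = 1\<^sub>m (n + 1)"
    using kl by (intro prod; simp add: il l_def[symmetric])+
  then have "tau n k \<in> Units (ring_mat TYPE(complex) (n + 1) ())"
    using tau_carrier[of n k] tau_carrier[of n l] by (auto simp: Units_def ring_mat_simps)
  with mat_inverse(1)[OF tau_carrier none, of "()"] show False by blast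
qed

lemma sphere_measure_total:
  "emeasure sphere_measure (space sphere_measure) = 1" "emeasure sphere_measure (sphere 0 1) = 1"
proof -
  have [measurable]: "sgn \<in> borel_measurable (uniform_measure lborel (ball (0::C2) 1))"
    by simp
  have "unit_ball_vol (4::real) \<noteq> 0"
    using less_imp_neq[OF unit_ball_vol_pos[of 4]] by force
  then have b: "emeasure lborel (ball (0::C2) 1) \<noteq> 0"
    by (auto simp: emeasure_ball)
  have self: "emeasure lborel (ball (0::C2) 1) / emeasure lborel (ball (0::C2) 1) = 1"
    using b emeasure_lborel_ball_finite[of "0::C2" 1] by (intro ennreal_divide_self) auto
  show "emeasure sphere_measure (space sphere_measure) = 1"
    using self by (simp add: sphere_measure_def emeasure_distr)
  have "sgn -` sphere 0 1 = UNIV - {0::C2}"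
    by (auto simp: norm_sgn)
  moreover have "ball (0::C2) 1 \<inter> (UNIV - {0}) = ball 0 1 - {0}" by blast
  moreover have "emeasure lborel (ball (0::C2) 1 - {0}) = emeasure lborel (ball (0::C2) 1)"
    by (intro emeasure_Diff_null_set) (auto simp: null_sets_def)
  ultimately show "emeasure sphere_measure (sphere 0 1) = 1"
    using self by (simp add: sphere_measure_def emeasure_distr)
qed
end

theory Submission
  imports Defs "HOL-Probability.Characteristic_Functions" "HOL-Probability.Sinc_Integral"
begin

text \<open>
  The inverse transform of \<open>g\<close> is the Euclidean inverse Fourier transform of the matrix function
  \<open>H(\<zeta>) = \<tau>\<^sub>n(k\<^sub>\<zeta>) diag(g(|\<zeta>|\<^sup>2, (2j - n)|\<zeta>|\<^sup>2)) \<tau>\<^sub>n(k\<^sub>\<zeta>)\<^sup>*\<close>, because equivariance forces the Fourier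
  transform at \<open>r e\<^sub>2\<close> to be diagonal.  Everything then reduces to showing that \<open>H\<close> is a Schwartz
  function with bounds polynomial in \<open>n\<close>, the difficulty being smoothness at the origin.

  Against the reproducing kernel of \<open>V\<^sub>n\<close>, \<open>H\<close> becomes the scalar
  \<open>K\<^sup>n\<^sub>g = \<Sum>\<^sub>j (n choose j) g(\<xi>, (2j - n)\<xi>) \<alpha>\<^sup>j \<beta>\<^sup>n\<^sup>-\<^sup>j\<close> with \<open>\<xi> = |\<zeta>|\<^sup>2\<close>, \<open>\<alpha> + \<beta> = \<langle>z, w\<rangle>\<close> and \<open>(\<alpha> - \<beta>)\<xi>\<close>
  polynomial in \<open>\<zeta>\<close>.  Since \<open>|\<alpha>| + |\<beta>| \<le> |z||w|\<close>, \<open>K\<^sup>n\<^sub>g\<close> is bounded by \<open>sup |g|\<close>.  Differentiating, the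
  finite differences of \<open>g\<close> with step \<open>2\<xi>\<close> absorb the singular factor \<open>1/\<xi>\<close>: each first derivative of
  \<open>K\<^sup>n\<^sub>g\<close> is a combination, with polynomial coefficients, of \<open>K\<^sup>n\<^sub>h\<close> and \<open>n K\<^sup>n\<^sup>-\<^sup>1\<^sub>h\<close>, where \<open>h\<close> arises from \<open>g\<close>
  by derivatives and averages over segments.  Hence derivatives of all orders are controlled, with one
  factor \<open>n\<close> for each.
\<close>

section \<open>Schwartz functions\<close>

text \<open>Uniformity in \<open>n\<close> dictates the form of the argument: the order
  \<open>N\<close> may not depend on \<open>n\<close>, and the constant only polynomially.
  Derivatives of the kernel are therefore not estimated for a given \<open>n\<close>, but generated
  by the grammars \<open>opr\<close>, \<open>poly3\<close> and \<open>tame\<close>, whose terms are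
  families in \<open>n\<close> and \<open>g\<close>; every induction fixes order, constant and
  degree before \<open>n\<close> and \<open>g\<close> appear.

  The second obstacle is that \<open>k_mat\<close> along the directions of \<zeta> has no continuous
  extension to the origin. The kernel sees \<zeta> only through \<open>alpha\<close>, and
  \<open>tau\<close> acts on kernels by substitution, so unitarity, equivariance and smoothness are
  obtained without computing an entry of \<open>tau\<close>. The price is the way back from kernel
  values to matrix entries. Sampling each entry on the torus where its monomial is largest costs one
  factor n + 1, because the largest of n + 1 binomial weights with sum 1 is at least 1 / (n + 1); a
  single torus for all entries would cost an exponential factor in this argument.\<close>

lemma has_derivative_pderivative:
  fixes f :: "'a::euclidean_space \<Rightarrow> complex"
  assumes "f differentiable (at x)"
  shows "(f has_derivative (\<lambda>h. \<Sum>b\<in>Basis. (h \<bullet> b) *\<^sub>R pderivative b f x)) (at x)"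
proof -
  have D: "(f has_derivative frechet_derivative f (at x)) (at x)"
    using assms by (simp add: frechet_derivative_works)
  then have lin: "linear (frechet_derivative f (at x))"
    by (rule has_derivative_linear)
  have "frechet_derivative f (at x) h = (\<Sum>b\<in>Basis. (h \<bullet> b) *\<^sub>R pderivative b f x)" for h
  proof -
    have "frechet_derivative f (at x) h = frechet_derivative f (at x) (\<Sum>b\<in>Basis. (h \<bullet> b) *\<^sub>R b)"
      by (simp add: euclidean_representation)
    also have "\<dots> = (\<Sum>b\<in>Basis. (h \<bullet> b) *\<^sub>R frechet_derivative f (at x) b)"
      by (simp add: linear_sum[OF lin] linear_scale[OF lin])
    finally show ?thesis by (simp add: pderivative_def)
  qed
  then show ?thesis using D by (metis (no_types, lifting) ext)
qed

text \<open>Uniqueness of the total derivative: exhibiting it in coordinates fixes all partials at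
  once. Concrete partial derivatives below are computed this way.\<close>

lemma pderivative_eqI:
  fixes f :: "'a::euclidean_space \<Rightarrow> complex"
  assumes "(f has_derivative (\<lambda>h. \<Sum>b\<in>Basis. (h \<bullet> b) *\<^sub>R f' b)) (at x)" "b \<in> Basis"
  shows "pderivative b f x = f' b"
proof -
  have "frechet_derivative f (at x) = (\<lambda>h. \<Sum>b\<in>Basis. (h \<bullet> b) *\<^sub>R f' b)"
    using frechet_derivative_at[OF assms(1)] by simp
  then have "pderivative b f x = (\<Sum>c\<in>Basis. (b \<bullet> c) *\<^sub>R f' c)"
    by (simp add: pderivative_def)
  also have "\<dots> = (\<Sum>c\<in>Basis. if b = c then f' c else 0)"
    using assms(2) by (intro sum.cong) (auto simp: inner_Basis)
  also have "\<dots> = f' b" using assms(2) by simp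
  finally show ?thesis .
qed

lemma iter_pderivative_simps [simp]:
  "iter_pderivative [] f = f"
  "iter_pderivative (b # bs) f = pderivative b (iter_pderivative bs f)"
  "iter_pderivative (bs @ cs) f = iter_pderivative bs (iter_pderivative cs f)"
  by (simp_all add: iter_pderivative_def)

lemma schwartz_iter_pderivative:
  assumes "schwartz f" "cs \<in> lists Basis"
  shows "schwartz (iter_pderivative cs f)"
proof -
  have "bs @ cs \<in> lists Basis" if "bs \<in> lists Basis" for bs
    using that assms by auto
  then show ?thesis
    using assms unfolding schwartz_def smooth_def
    by (metis iter_pderivative_simps(3))
qed

lemma schwartz_pderivative: "schwartz f \<Longrightarrow> b \<in> Basis \<Longrightarrow> schwartz (pderivative b f)"
  using schwartz_iter_pderivative[of f "[b]"] by simp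

lemma schwartz_has_derivative:
  assumes "schwartz f"
  shows "(f has_derivative (\<lambda>h. \<Sum>b\<in>Basis. (h \<bullet> b) *\<^sub>R pderivative b f x)) (at x)"
proof (rule has_derivative_pderivative)
  have "iter_pderivative [] f differentiable (at x)"
    using assms unfolding schwartz_def smooth_def by blast
  then show "f differentiable (at x)" by simp
qed

lemma schwartz_continuous: "schwartz f \<Longrightarrow> continuous_on UNIV f"
  by (meson continuous_at_imp_continuous_on has_derivative_continuous schwartz_has_derivative)

lemma schwartz_measurable [measurable_dest]: "schwartz f \<Longrightarrow> f \<in> borel_measurable borel"
  by (simp add: borel_measurable_continuous_onI schwartz_continuous)

lemma schwartz_decay:
  assumes "schwartz f"
  obtains c where "\<And>x. (1 + (norm x)\<^sup>2) ^ N * cmod (f x) \<le> c"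
proof -
  have "bounded (range (\<lambda>x. (1 + (norm x)\<^sup>2) ^ N *\<^sub>R iter_pderivative [] f x))"
    using assms unfolding schwartz_def by blast
  then obtain c where "\<And>x. norm ((1 + (norm x)\<^sup>2) ^ N *\<^sub>R f x) \<le> c"
    by (auto simp: bounded_iff)
  then show ?thesis
    by (intro that[of c]) (simp add: abs_of_nonneg)
qed

text \<open>Membership in \<open>X\<close> propagates along the list of directions, and decay is
  available for every member. The rule replaces Leibniz formulas for iterated derivatives: one only
  has to guess a class \<open>X\<close> large enough to contain the first partials of its
  members.\<close>

lemma schwartz_coinduct [consumes 1, case_names decay step]:
  fixes f :: "'a::euclidean_space \<Rightarrow> complex"
  assumes f: "X f"
    and decay: "\<And>f N. X f \<Longrightarrow> \<exists>c. \<forall>x. (1 + (norm x)\<^sup>2) ^ N * cmod (f x) \<le> c"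
    and step: "\<And>f. X f \<Longrightarrow> \<exists>f'. (\<forall>b\<in>Basis. X (f' b)) \<and>
      (\<forall>x. (f has_derivative (\<lambda>h. \<Sum>b\<in>Basis. (h \<bullet> b) *\<^sub>R f' b x)) (at x))"
  shows "schwartz f"
proof -
  have X: "X (iter_pderivative bs f)" if "bs \<in> lists Basis" for bs
    using that
  proof (induction bs)
    case (Cons b bs)
    then have X: "X (iter_pderivative bs f)" and b: "b \<in> Basis" by auto
    from step[OF X] obtain f' where f': "\<forall>b\<in>Basis. X (f' b)"
      "\<And>x. (iter_pderivative bs f has_derivative (\<lambda>h. \<Sum>b\<in>Basis. (h \<bullet> b) *\<^sub>R f' b x)) (at x)" by blast
    have "pderivative b (iter_pderivative bs f) = f' b"
      by (rule ext, rule pderivative_eqI[OF f'(2) b])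
    then show ?case using f'(1) b by simp
  qed (use f in simp)
  show ?thesis
    unfolding schwartz_def smooth_def
  proof (intro conjI ballI allI)
    fix bs :: "'a list" and x assume "bs \<in> lists Basis"
    from step[OF X[OF this]] show "iter_pderivative bs f differentiable at x"
      unfolding differentiable_def by blast
  next
    fix bs :: "'a list" and N assume "bs \<in> lists Basis"
    from decay[OF X[OF this], of N] show
      "bounded (range (\<lambda>x. (1 + (norm x)\<^sup>2) ^ N *\<^sub>R iter_pderivative bs f x))"
      by (auto simp: bounded_iff abs_of_nonneg)
  qed
qed

section \<open>Closure of Schwartz functions under linear operations and polynomial factors\<close>

lemma schwartz_add:
  assumes "schwartz f" "schwartz g"
  shows "schwartz (\<lambda>x. f x + g x)"
proof -
  define X where "X h \<longleftrightarrow> (\<exists>f g. schwartz f \<and> schwartz g \<and> h = (\<lambda>x. f x + g x))"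
    for h :: "'a \<Rightarrow> complex"
  have "X (\<lambda>x. f x + g x)" using assms unfolding X_def by blast
  then show ?thesis
  proof (coinduct rule: schwartz_coinduct[where X = X])
    case (decay h N)
    then obtain f g where fg: "schwartz f" "schwartz g" "h = (\<lambda>x. f x + g x)" unfolding X_def by blast
    obtain c d where c: "\<And>x. (1 + (norm x)\<^sup>2) ^ N * cmod (f x) \<le> c"
        and d: "\<And>x. (1 + (norm x)\<^sup>2) ^ N * cmod (g x) \<le> d"
      using schwartz_decay[OF fg(1), of N] schwartz_decay[OF fg(2), of N] by metis
    have "(1 + (norm x)\<^sup>2) ^ N * cmod (h x) \<le> c + d" for x
    proof -
      have "(1 + (norm x)\<^sup>2) ^ N * cmod (h x) \<le> (1 + (norm x)\<^sup>2) ^ N * (cmod (f x) + cmod (g x))"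
        unfolding fg by (intro mult_left_mono norm_triangle_ineq) simp
      also have "\<dots> \<le> c + d" using c[of x] d[of x] by (simp add: algebra_simps)
      finally show ?thesis .
    qed
    then show ?case by blast
  next
    case (step h)
    then obtain f g where fg: "schwartz f" "schwartz g" "h = (\<lambda>x. f x + g x)" unfolding X_def by blast
    have "(h has_derivative (\<lambda>v. \<Sum>b\<in>Basis. (v \<bullet> b) *\<^sub>R (pderivative b f x + pderivative b g x))) (at x)" for x
      unfolding fg scaleR_add_right sum.distrib
      by (intro has_derivative_add schwartz_has_derivative fg)
    moreover have "X (\<lambda>x. pderivative b f x + pderivative b g x)" if "b \<in> Basis" for b
      using fg that schwartz_pderivative unfolding X_def by blast
    ultimately show ?case
      by (intro exI[of _ "\<lambda>b x. pderivative b f x + pderivative b g x"]) blast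
  qed
qed

lemma schwartz_cmult:
  assumes "schwartz f"
  shows "schwartz (\<lambda>x. a * f x)"
proof -
  define X where "X h \<longleftrightarrow> (\<exists>f. schwartz f \<and> h = (\<lambda>x. a * f x))" for h :: "'a \<Rightarrow> complex"
  have "X (\<lambda>x. a * f x)" using assms unfolding X_def by blast
  then show ?thesis
  proof (coinduct rule: schwartz_coinduct[where X = X])
    case (decay h N)
    then obtain f where f: "schwartz f" "h = (\<lambda>x. a * f x)" unfolding X_def by blast
    obtain c where c: "\<And>x. (1 + (norm x)\<^sup>2) ^ N * cmod (f x) \<le> c"
      using schwartz_decay[OF f(1), of N] by metis
    have "(1 + (norm x)\<^sup>2) ^ N * cmod (h x) \<le> cmod a * c" for x
      using mult_left_mono[OF c[of x], of "cmod a"] unfolding f by (simp add: norm_mult mult_ac)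
    then show ?case by blast
  next
    case (step h)
    then obtain f where f: "schwartz f" "h = (\<lambda>x. a * f x)" unfolding X_def by blast
    have "(h has_derivative (\<lambda>v. a * (\<Sum>b\<in>Basis. (v \<bullet> b) *\<^sub>R pderivative b f x))) (at x)" for x
      unfolding f by (intro has_derivative_mult_right schwartz_has_derivative f)
    then have "(h has_derivative (\<lambda>v. \<Sum>b\<in>Basis. (v \<bullet> b) *\<^sub>R (a * pderivative b f x))) (at x)" for x
      by (simp add: sum_distrib_left)
    moreover have "X (\<lambda>x. a * pderivative b f x)" if "b \<in> Basis" for b
      using f that schwartz_pderivative unfolding X_def by blast
    ultimately show ?case
      by (intro exI[of _ "\<lambda>b x. a * pderivative b f x"]) blast
  qed
qed

lemma schwartz_zero: "schwartz (\<lambda>_. 0)"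
proof -
  define X where "X h \<longleftrightarrow> h = (\<lambda>_. 0)" for h :: "'a \<Rightarrow> complex"
  have "X (\<lambda>_. 0)" by (simp add: X_def)
  then show ?thesis
  proof (coinduct rule: schwartz_coinduct[where X = X])
    case (step h)
    then show ?case by (intro exI[of _ "\<lambda>_ _. 0"]) (simp add: X_def)
  qed (auto simp: X_def)
qed

lemma schwartz_sum: "(\<And>i. i \<in> I \<Longrightarrow> schwartz (f i)) \<Longrightarrow> schwartz (\<lambda>x. \<Sum>i\<in>I. f i x)"
  by (induction I rule: infinite_finite_induct) (auto intro: schwartz_add schwartz_zero)

lemma schwartz_uminus: "schwartz f \<Longrightarrow> schwartz (\<lambda>x. - f x)"
  using schwartz_cmult[of f "-1"] by simp

lemma schwartz_diff: "schwartz f \<Longrightarrow> schwartz g \<Longrightarrow> schwartz (\<lambda>x. f x - g x)"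
  using schwartz_add[OF _ schwartz_uminus, of f g] by simp

lemma has_derivative_inner_mult:
  fixes f :: "'a::euclidean_space \<Rightarrow> complex"
  assumes "(f has_derivative (\<lambda>h. \<Sum>b\<in>Basis. (h \<bullet> b) *\<^sub>R f' b)) (at x)"
  shows "((\<lambda>x. of_real (x \<bullet> c) * f x) has_derivative
     (\<lambda>h. \<Sum>b\<in>Basis. (h \<bullet> b) *\<^sub>R (of_real (b \<bullet> c) * f x + of_real (x \<bullet> c) * f' b))) (at x)"
proof -
  have "((\<lambda>x. (x \<bullet> c) *\<^sub>R f x) has_derivative
      (\<lambda>h. (x \<bullet> c) *\<^sub>R (\<Sum>b\<in>Basis. (h \<bullet> b) *\<^sub>R f' b) + (h \<bullet> c) *\<^sub>R f x)) (at x)"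
    by (intro has_derivative_scaleR has_derivative_inner_left has_derivative_ident assms)
  moreover have "(x \<bullet> c) *\<^sub>R (\<Sum>b\<in>Basis. (h \<bullet> b) *\<^sub>R f' b) + (h \<bullet> c) *\<^sub>R f x =
     (\<Sum>b\<in>Basis. (h \<bullet> b) *\<^sub>R (of_real (b \<bullet> c) * f x + of_real (x \<bullet> c) * f' b))" for h
  proof -
    have "h \<bullet> c = (\<Sum>b\<in>Basis. (h \<bullet> b) * (b \<bullet> c))"
      by (subst euclidean_inner) (simp add: inner_commute)
    then show ?thesis
      by (simp add: scaleR_sum_right scaleR_sum_left sum.distrib algebra_simps scaleR_conv_of_real sum_distrib_left sum_distrib_right)
  qed
  ultimately show ?thesis by (simp add: scaleR_conv_of_real)
qed

lemma schwartz_inner_mult: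
  assumes "schwartz f"
  shows "schwartz (\<lambda>x. of_real (x \<bullet> c) * f x)"
proof -
  \<comment> \<open>The product rule leaves the term \<open>of_real (b \<bullet> c) * f x\<close>,
    so products alone are not closed under differentiation; the summand \<open>g\<close> absorbs
    it.\<close>
  define X where "X h \<longleftrightarrow> (\<exists>f g. schwartz f \<and> schwartz g \<and> h = (\<lambda>x. g x + of_real (x \<bullet> c) * f x))"
    for h :: "'a \<Rightarrow> complex"
  have "X (\<lambda>x. of_real (x \<bullet> c) * f x)"
    using assms schwartz_zero unfolding X_def by force
  then show ?thesis
  proof (coinduct rule: schwartz_coinduct[where X = X])
    case (decay h N)
    then obtain f g where fg: "schwartz f" "schwartz g" "h = (\<lambda>x. g x + of_real (x \<bullet> c) * f x)"
      unfolding X_def by blast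
    \<comment> \<open>One spare power of the weight pays for the linear factor, since
      \<open>norm x \<le> 1 + (norm x)\<^sup>2\<close>.\<close>
    obtain C D where C: "\<And>x. (1 + (norm x)\<^sup>2) ^ (Suc N) * cmod (f x) \<le> C"
        and D: "\<And>x. (1 + (norm x)\<^sup>2) ^ N * cmod (g x) \<le> D"
      using schwartz_decay[OF fg(1), of "Suc N"] schwartz_decay[OF fg(2), of N] by metis
    have "(1 + (norm x)\<^sup>2) ^ N * cmod (h x) \<le> D + norm c * C" for x
    proof -
      have n: "norm x \<le> 1 + (norm x)\<^sup>2"
      proof -
        have "0 \<le> (norm x - 1)\<^sup>2" by simp
        then have "norm x * 2 \<le> 1 + (norm x)\<^sup>2" by (simp add: power2_eq_square algebra_simps)
        then show ?thesis using norm_ge_zero[of x] by linarith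
      qed
      have "\<bar>x \<bullet> c\<bar> \<le> (1 + (norm x)\<^sup>2) * norm c"
        by (rule order_trans[OF Cauchy_Schwarz_ineq2]) (intro mult_right_mono n norm_ge_zero)
      then have "cmod (h x) \<le> cmod (g x) + ((1 + (norm x)\<^sup>2) * norm c) * cmod (f x)"
        unfolding fg by (intro order_trans[OF norm_triangle_ineq]) (simp add: norm_mult mult_right_mono)
      then have "(1 + (norm x)\<^sup>2) ^ N * cmod (h x) \<le>
        (1 + (norm x)\<^sup>2) ^ N * (cmod (g x) + ((1 + (norm x)\<^sup>2) * norm c) * cmod (f x))"
        by (intro mult_left_mono) auto
      also have "\<dots> = (1 + (norm x)\<^sup>2) ^ N * cmod (g x) + norm c * ((1 + (norm x)\<^sup>2) ^ (Suc N) * cmod (f x))"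
        by (simp add: algebra_simps)
      also have "\<dots> \<le> D + norm c * C"
        by (intro add_mono mult_left_mono C D norm_ge_zero)
      finally show ?thesis .
    qed
    then show ?case by blast
  next
    case (step h)
    then obtain f g where fg: "schwartz f" "schwartz g" "h = (\<lambda>x. g x + of_real (x \<bullet> c) * f x)"
      unfolding X_def by blast
    define f' where "f' b x = (pderivative b g x + of_real (b \<bullet> c) * f x) + of_real (x \<bullet> c) * pderivative b f x" for b x
    have "(h has_derivative (\<lambda>v. (\<Sum>b\<in>Basis. (v \<bullet> b) *\<^sub>R pderivative b g x) +
       (\<Sum>b\<in>Basis. (v \<bullet> b) *\<^sub>R (of_real (b \<bullet> c) * f x + of_real (x \<bullet> c) * pderivative b f x)))) (at x)" for x
      unfolding fg by (intro has_derivative_add has_derivative_inner_mult schwartz_has_derivative fg)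
    then have "(h has_derivative (\<lambda>v. (\<Sum>b\<in>Basis. (v \<bullet> b) *\<^sub>R f' b x))) (at x)" for x
      by (simp add: f'_def sum.distrib[symmetric] scaleR_add_right[symmetric] add.assoc)
    moreover have "X (f' b)" if "b \<in> Basis" for b
      unfolding X_def f'_def using fg that
      by (intro exI[of _ "pderivative b f"]
          exI[of _ "\<lambda>x. pderivative b g x + of_real (b \<bullet> c) * f x"] conjI refl
          schwartz_add schwartz_cmult schwartz_pderivative)
    ultimately show ?case by blast
  qed
qed

lemma schwartz_norm_sq_mult:
  assumes "schwartz f"
  shows "schwartz (\<lambda>x. of_real ((norm x)\<^sup>2) * f x)"
proof -
  have "(\<lambda>x. of_real ((norm x)\<^sup>2) * f x) = (\<lambda>x. \<Sum>b\<in>Basis. of_real (x \<bullet> b) * (of_real (x \<bullet> b) * f x))"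
    unfolding power2_norm_eq_inner
    by (subst euclidean_inner) (simp add: sum_distrib_right mult.assoc)
  then show ?thesis by (simp add: schwartz_sum schwartz_inner_mult assms)
qed

section \<open>Integration on Euclidean space\<close>

text \<open>\<open>lborel\<close> is the image of the product of one-dimensional measures under the
  coordinate map, so product integrands reduce to the line. Needed for the polynomial weights and
  for Gaussians.\<close>

lemma lborel_product_integral:
  fixes f :: "'a::euclidean_space \<Rightarrow> real \<Rightarrow> 'b::{real_normed_field,banach,second_countable_topology}"
  assumes "\<And>b. b \<in> Basis \<Longrightarrow> integrable lborel (f b)"
  shows "integrable lborel (\<lambda>x. \<Prod>b\<in>Basis. f b (x \<bullet> b))"
    "(\<integral>x. (\<Prod>b\<in>Basis. f b (x \<bullet> b)) \<partial>lborel) = (\<Prod>b\<in>Basis. \<integral>t. f b t \<partial>lborel)"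
proof -
  interpret product_sigma_finite "\<lambda>b::'a. lborel :: real measure"
    by standard
  have [measurable]: "f b \<in> borel_measurable borel" if "b \<in> Basis" for b
    using borel_measurable_integrable[OF assms[OF that]] by simp
  have m: "(\<lambda>x::'a. \<Prod>b\<in>Basis. f b (x \<bullet> b)) \<in> borel_measurable borel"
    by (rule borel_measurable_prod) (measurable)
  have T: "(\<lambda>y. \<Sum>b\<in>Basis. y b *\<^sub>R b) \<in> measurable (\<Pi>\<^sub>M b\<in>(Basis::'a set). lborel) borel"
    by measurable
  have eq: "(\<Prod>b\<in>Basis. f b ((\<Sum>c\<in>Basis. y c *\<^sub>R c) \<bullet> b)) = (\<Prod>b\<in>(Basis::'a set). f b (y b))" for y
    by (intro prod.cong refl) (simp add: inner_sum_left inner_Basis if_distrib[of "\<lambda>x. _ * x"] cong: if_cong)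
  show "integrable lborel (\<lambda>x. \<Prod>b\<in>Basis. f b (x \<bullet> b))"
    unfolding lborel_eq[where 'a='a]
    by (subst integrable_distr_eq[OF T m]) (simp only: eq, intro product_integrable_prod assms, auto)
  show "(\<integral>x. (\<Prod>b\<in>Basis. f b (x \<bullet> b)) \<partial>lborel) = (\<Prod>b\<in>Basis. \<integral>t. f b t \<partial>lborel)"
    unfolding lborel_eq[where 'a='a]
    by (subst integral_distr[OF T m], simp only: eq, subst product_integral_prod)
       (auto intro!: assms simp flip: lborel_eq)
qed

text \<open>The power \<open>DIM('a)\<close> of the weight dominates the product of the factors
  \<open>1 + (x \<bullet> b)\<^sup>2\<close>, whose inverses are integrable on the line. The
  exponent is about twice the sharp one, which is harmless because decay of every order is
  available.\<close>

lemma integrable_weight: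
  assumes "DIM('a) \<le> N"
  shows "integrable lborel (\<lambda>x::'a::euclidean_space. inverse ((1 + (norm x)\<^sup>2) ^ N))"
proof (rule Bochner_Integration.integrable_bound)
  have "integrable lborel (\<lambda>x::real. inverse (1 + x\<^sup>2))"
    using integrable_inverse_1_plus_square by (simp add: set_integrable_def)
  then show "integrable lborel (\<lambda>x::'a. \<Prod>b\<in>Basis. inverse (1 + (x \<bullet> b)\<^sup>2))"
    by (rule lborel_product_integral(1))
  show "(\<lambda>x::'a. inverse ((1 + (norm x)\<^sup>2) ^ N)) \<in> borel_measurable lborel"
    by measurable
  show "AE x::'a in lborel. norm (inverse ((1 + (norm x)\<^sup>2) ^ N)) \<le> norm (\<Prod>b\<in>Basis. inverse (1 + (x \<bullet> b)\<^sup>2))"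
  proof (rule AE_I2)
    fix x :: 'a
    have pos: "0 < 1 + (norm x)\<^sup>2" by (simp add: add_pos_nonneg)
    have "inverse ((1 + (norm x)\<^sup>2) ^ N) \<le> inverse ((1 + (norm x)\<^sup>2) ^ DIM('a))"
      using assms pos by (intro le_imp_inverse_le power_increasing) auto
    also have "\<dots> = (\<Prod>b\<in>(Basis::'a set). inverse (1 + (norm x)\<^sup>2))"
      by (simp add: power_inverse)
    also have "\<dots> \<le> (\<Prod>b\<in>Basis. inverse (1 + (x \<bullet> b)\<^sup>2))"
    proof (intro prod_mono conjI le_imp_inverse_le)
      fix b :: 'a assume "b \<in> Basis"
      have "\<bar>x \<bullet> b\<bar> \<le> norm x" using Basis_le_norm[OF \<open>b \<in> Basis\<close>] .
      then have "(x \<bullet> b)\<^sup>2 \<le> (norm x)\<^sup>2" by (metis abs_le_square_iff abs_norm_cancel)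
      then show "1 + (x \<bullet> b)\<^sup>2 \<le> 1 + (norm x)\<^sup>2" by simp
      show "0 \<le> inverse (1 + (norm x)\<^sup>2)" by simp
      show "0 < 1 + (x \<bullet> b)\<^sup>2" by (simp add: add_pos_nonneg)
    qed
    finally have "inverse ((1 + (norm x)\<^sup>2) ^ N) \<le> (\<Prod>b\<in>Basis. inverse (1 + (x \<bullet> b)\<^sup>2))" .
    moreover have "0 \<le> inverse ((1 + (norm x)\<^sup>2) ^ N)" by simp
    ultimately show "norm (inverse ((1 + (norm x)\<^sup>2) ^ N)) \<le> norm (\<Prod>b\<in>Basis. inverse (1 + (x \<bullet> b)\<^sup>2))"
      by simp
  qed
qed

lemma le_weight_iff:
  fixes x :: "'a::euclidean_space"
  shows "(1 + (norm x)\<^sup>2) ^ N * a \<le> c \<longleftrightarrow> a \<le> c * inverse ((1 + (norm x)\<^sup>2) ^ N)"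
proof -
  have "0 < (1 + (norm x)\<^sup>2) ^ N" by (simp add: add_pos_nonneg)
  then show ?thesis by (simp add: field_simps)
qed

lemma schwartz_integrable:
  fixes f :: "'a::euclidean_space \<Rightarrow> complex"
  assumes "schwartz f"
  shows "integrable lborel f"
proof -
  obtain c where c: "\<And>x. (1 + (norm x)\<^sup>2) ^ DIM('a) * cmod (f x) \<le> c"
    using schwartz_decay[OF assms, of "DIM('a)"] by metis
  have "integrable lborel (\<lambda>x::'a. c * inverse ((1 + (norm x)\<^sup>2) ^ DIM('a)))"
    by (intro integrable_mult_right integrable_weight) simp
  then show ?thesis
  proof (rule Bochner_Integration.integrable_bound)
    show "f \<in> borel_measurable lborel" using schwartz_measurable[OF assms] by simp
    show "AE x in lborel. norm (f x) \<le> norm (c * inverse ((1 + (norm x)\<^sup>2) ^ DIM('a)))"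
      using c unfolding le_weight_iff by (intro AE_I2) (smt (verit) real_norm_def)
  qed
qed

text \<open>Dominated convergence for difference quotients along sequences. The derivative is
  bounded on a ball around \<open>x0\<close> because the mean value inequality uses it between
  \<open>x0\<close> and nearby points; the linear part costs as much again, whence the dominating
  function \<open>2 * (real DIM('a) * G t)\<close>.\<close>

lemma has_derivative_lebesgue_integral:
  fixes f :: "'a::euclidean_space \<Rightarrow> 't \<Rightarrow> complex"
  assumes int: "\<And>x. integrable M (f x)"
    and deriv: "\<And>x t. t \<in> space M \<Longrightarrow>
      ((\<lambda>x. f x t) has_derivative (\<lambda>h. \<Sum>b\<in>Basis. (h \<bullet> b) *\<^sub>R f' b x t)) (at x)"
    and meas: "\<And>b. b \<in> Basis \<Longrightarrow> f' b x0 \<in> borel_measurable M"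
    and bound: "\<And>b x t. b \<in> Basis \<Longrightarrow> x \<in> ball x0 1 \<Longrightarrow> t \<in> space M \<Longrightarrow> cmod (f' b x t) \<le> G t"
    and G: "integrable M G"
  shows "((\<lambda>x. \<integral>t. f x t \<partial>M) has_derivative (\<lambda>h. \<Sum>b\<in>Basis. (h \<bullet> b) *\<^sub>R (\<integral>t. f' b x0 t \<partial>M))) (at x0)"
proof -
  define L where "L t h = (\<Sum>b\<in>Basis. (h \<bullet> b) *\<^sub>R f' b x0 t)" for t h
  have f'_int: "integrable M (f' b x0)" if "b \<in> Basis" for b
    by (rule Bochner_Integration.integrable_bound[OF G meas[OF that]])
      (use bound[OF that, of x0] in \<open>intro AE_I2, force\<close>)
  have L_int: "integrable M (\<lambda>t. L t h)" for h
    unfolding L_def by (intro Bochner_Integration.integrable_sum integrable_scaleR_right f'_int)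
  have Lint: "(\<integral>t. L t h \<partial>M) = (\<Sum>b\<in>Basis. (h \<bullet> b) *\<^sub>R (\<integral>t. f' b x0 t \<partial>M))" for h
    unfolding L_def by (subst Bochner_Integration.integral_sum) (simp_all add: f'_int)
  have on: "norm (\<Sum>b\<in>Basis. (h \<bullet> b) *\<^sub>R f' b x t) \<le> real DIM('a) * G t * norm h"
    if "x \<in> ball x0 1" "t \<in> space M" for x t and h :: 'a
  proof -
    have "norm (\<Sum>b\<in>Basis. (h \<bullet> b) *\<^sub>R f' b x t) \<le> (\<Sum>b\<in>(Basis::'a set). norm h * G t)"
    proof (rule sum_norm_le)
      fix b :: 'a assume b: "b \<in> Basis"
      show "norm ((h \<bullet> b) *\<^sub>R f' b x t) \<le> norm h * G t"
        unfolding norm_scaleR using Basis_le_norm[OF b, of h] bound[OF b that]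
        by (intro mult_mono) auto
    qed
    then show ?thesis by (simp add: mult_ac)
  qed
  have lip: "norm (f x t - f x0 t) \<le> real DIM('a) * G t * norm (x - x0)"
    if "x \<in> ball x0 1" "t \<in> space M" for x t
  proof (rule differentiable_bound)
    show "convex (ball x0 1)" by simp
    show "((\<lambda>x. f x t) has_derivative (\<lambda>h. \<Sum>b\<in>Basis. (h \<bullet> b) *\<^sub>R f' b y t)) (at y within ball x0 1)" for y
      using deriv[OF that(2)] by (rule has_derivative_at_withinI)
    show "onorm (\<lambda>h. \<Sum>b\<in>Basis. (h \<bullet> b) *\<^sub>R f' b y t) \<le> real DIM('a) * G t" if "y \<in> ball x0 1" for y
      by (rule onorm_le) (rule on[OF that \<open>t \<in> space M\<close>])
  qed (use that in auto)
  show ?thesis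
    unfolding has_derivative_iff_norm
  proof
    show "bounded_linear (\<lambda>h. \<Sum>b\<in>Basis. (h \<bullet> b) *\<^sub>R (\<integral>t. f' b x0 t \<partial>M))"
      by (intro bounded_linear_sum bounded_linear_scaleR_const bounded_linear_inner_left)
    let ?q = "\<lambda>y t. (f y t - f x0 t - L t (y - x0)) /\<^sub>R norm (y - x0)"
    have q_int: "integrable M (?q y)" for y
      by (intro integrable_scaleR_right Bochner_Integration.integrable_diff int L_int)
    have "((\<lambda>y. \<integral>t. ?q y t \<partial>M) \<longlongrightarrow> 0) (at x0)"
      unfolding tendsto_at_iff_sequentially comp_def
    proof (intro allI impI)
      fix X assume X: "\<forall>i. X i \<in> UNIV - {x0}" "X \<longlonglongrightarrow> x0"
      from X(2) have "\<forall>\<^sub>F i in sequentially. X i \<in> ball x0 1"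
        by (rule topological_tendstoD) auto
      then obtain N where N: "\<And>i. N \<le> i \<Longrightarrow> X i \<in> ball x0 1"
        by (auto simp: eventually_sequentially)
      \<comment> \<open>The shifted sequence lies in the unit ball from its first term on, where the
        bound by \<open>G\<close> holds; \<open>LIMSEQ_offset\<close> undoes the shift.\<close>
      define Y where "Y i = X (i + N)" for i
      have Y: "Y i \<in> ball x0 1" "Y i \<noteq> x0" for i using N X(1) by (auto simp: Y_def)
      have Ylim: "Y \<longlonglongrightarrow> x0" unfolding Y_def using X(2) by (rule LIMSEQ_ignore_initial_segment)
      have "(\<lambda>i. \<integral>t. ?q (Y i) t \<partial>M) \<longlonglongrightarrow> (\<integral>t. 0 \<partial>M)"
      proof (rule integral_dominated_convergence)
        show "integrable M (\<lambda>t. 2 * (real DIM('a) * G t))"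
          by (intro integrable_mult_right G)
        show "?q (Y i) \<in> borel_measurable M" for i
          using q_int by (rule borel_measurable_integrable)
        show "AE t in M. (\<lambda>i. ?q (Y i) t) \<longlonglongrightarrow> 0"
        proof (rule AE_I2)
          fix t assume t: "t \<in> space M"
          have "((\<lambda>y. norm (f y t - f x0 t - L t (y - x0)) / norm (y - x0)) \<longlongrightarrow> 0) (at x0)"
            using deriv[OF t, of x0] unfolding has_derivative_iff_norm L_def by blast
          then have "(\<lambda>i. norm (f (Y i) t - f x0 t - L t (Y i - x0)) / norm (Y i - x0)) \<longlonglongrightarrow> 0"
            unfolding tendsto_at_iff_sequentially comp_def using Y Ylim by blast
          then have "(\<lambda>i. norm (?q (Y i) t)) \<longlonglongrightarrow> 0"
            by (simp add: divide_inverse mult.commute)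
          then show "(\<lambda>i. ?q (Y i) t) \<longlonglongrightarrow> 0" by (rule tendsto_norm_zero_cancel)
        qed
        show "AE t in M. norm (?q (Y i) t) \<le> 2 * (real DIM('a) * G t)" for i
        proof (rule AE_I2)
          fix t assume t: "t \<in> space M"
          have "norm (f (Y i) t - f x0 t - L t (Y i - x0)) \<le>
             real DIM('a) * G t * norm (Y i - x0) + real DIM('a) * G t * norm (Y i - x0)"
            using lip[OF Y(1) t] on[OF _ t, of x0 "Y i - x0"] norm_triangle_ineq4[of "f (Y i) t - f x0 t"]
            unfolding L_def by (smt (verit) centre_in_ball zero_less_one)
          moreover have "0 < norm (Y i - x0)" using Y(2) by simp
          ultimately have "norm (f (Y i) t - f x0 t - L t (Y i - x0)) / norm (Y i - x0) \<le> 2 * (real DIM('a) * G t)"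
            by (simp add: pos_divide_le_eq mult_ac)
          then show "norm (?q (Y i) t) \<le> 2 * (real DIM('a) * G t)"
            by (simp add: divide_inverse mult.commute)
        qed
      qed simp
      then have "(\<lambda>i. \<integral>t. ?q (X (i + N)) t \<partial>M) \<longlonglongrightarrow> 0" by (simp add: Y_def)
      then show "(\<lambda>i. \<integral>t. ?q (X i) t \<partial>M) \<longlonglongrightarrow> 0" by (rule LIMSEQ_offset)
    qed
    then have "((\<lambda>y. norm (\<integral>t. ?q y t \<partial>M)) \<longlongrightarrow> 0) (at x0)"
      by (rule tendsto_norm_zero)
    moreover have "norm (\<integral>t. ?q y t \<partial>M) = norm ((\<integral>t. f y t \<partial>M) - (\<integral>t. f x0 t \<partial>M) -
        (\<Sum>b\<in>Basis. ((y - x0) \<bullet> b) *\<^sub>R (\<integral>t. f' b x0 t \<partial>M))) / norm (y - x0)" for y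
      using int L_int by (simp add: Lint divide_inverse mult.commute)
    ultimately show "((\<lambda>y. norm ((\<integral>t. f y t \<partial>M) - (\<integral>t. f x0 t \<partial>M) -
        (\<Sum>b\<in>Basis. ((y - x0) \<bullet> b) *\<^sub>R (\<integral>t. f' b x0 t \<partial>M))) / norm (y - x0)) \<longlongrightarrow> 0) (at x0)"
      by simp
  qed
qed

section \<open>Translations, dilations, and integrals of derivatives\<close>

lemma lborel_integral_translate:
  fixes f :: "'a::euclidean_space \<Rightarrow> 'b::{banach, second_countable_topology}"
  assumes [measurable]: "f \<in> borel_measurable borel"
  shows "(\<integral>x. f (c + x) \<partial>lborel) = (\<integral>x. f x \<partial>lborel)"
  by (subst (2) lborel_distr_plus[of c, symmetric]) (simp add: integral_distr)

lemma lborel_integral_scale: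
  fixes f :: "'a::euclidean_space \<Rightarrow> 'b::{banach, second_countable_topology}"
  assumes [measurable]: "f \<in> borel_measurable borel" and "r \<noteq> 0"
  shows "(\<integral>x. f x \<partial>lborel) = \<bar>r\<bar> ^ DIM('a) *\<^sub>R (\<integral>x. f (c + r *\<^sub>R x) \<partial>lborel)"
  by (subst lborel_affine[OF assms(2), of c])
     (simp add: integral_density integral_distr)

lemma lborel_integral_uminus:
  fixes f :: "'a::euclidean_space \<Rightarrow> 'b::{banach, second_countable_topology}"
  assumes "f \<in> borel_measurable borel"
  shows "(\<integral>x. f (- x) \<partial>lborel) = (\<integral>x. f x \<partial>lborel)"
  using lborel_integral_scale[OF assms, of "-1" 0] by simp

text \<open>By translation invariance the integral of \<open>f (x + t)\<close> over \<open>t\<close>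
  is constant in \<open>x\<close>; differentiating it under the integral sign at
  \<open>x = 0\<close> gives the claim.\<close>

lemma integral_pderivative_eq_0:
  fixes f :: "'a::euclidean_space \<Rightarrow> complex"
  assumes f: "schwartz f" and b: "b \<in> Basis"
  shows "(\<integral>x. pderivative b f x \<partial>lborel) = 0"
proof -
  let ?d = "DIM('a)"
  have "\<exists>C. \<forall>b\<in>Basis. \<forall>x. (1 + (norm x)\<^sup>2) ^ ?d * cmod (pderivative b f x) \<le> C"
  proof -
    have "\<exists>c. \<forall>x. (1 + (norm x)\<^sup>2) ^ ?d * cmod (pderivative b f x) \<le> c" if "b \<in> Basis" for b
      using schwartz_decay[OF schwartz_pderivative[OF f that], of ?d] by metis
    then obtain c where c: "\<And>b x. b \<in> Basis \<Longrightarrow> (1 + (norm x)\<^sup>2) ^ ?d * cmod (pderivative b f x) \<le> c b"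
      by metis
    have "(1 + (norm x)\<^sup>2) ^ ?d * cmod (pderivative b f x) \<le> (\<Sum>b\<in>Basis. \<bar>c b\<bar>)" if "b \<in> Basis" for b x
      using c[OF that, of x] member_le_sum[OF that, of "\<lambda>b. \<bar>c b\<bar>"] by simp
    then show ?thesis by blast
  qed
  then obtain C where C: "\<And>b x. b \<in> Basis \<Longrightarrow> (1 + (norm x)\<^sup>2) ^ ?d * cmod (pderivative b f x) \<le> C"
    by blast
  \<comment> \<open>For \<open>x\<close> in the unit ball,
    \<open>1 + (norm t)\<^sup>2 \<le> 3 * (1 + (norm (x + t))\<^sup>2)\<close>, so decay survives
    small translations at the cost of \<open>3 ^ ?d\<close>.\<close>
  define G where "G t = C * (3 ^ ?d * inverse ((1 + (norm t)\<^sup>2) ^ ?d))" for t :: 'a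
  have fi: "integrable lborel (\<lambda>t. f (x + t))" for x
  proof -
    have "integrable (distr lborel borel ((+) x)) f"
      using schwartz_integrable[OF f] by (simp add: lborel_distr_plus)
    then show ?thesis by (subst (asm) integrable_distr_eq) (use schwartz_measurable[OF f] in auto)
  qed
  have "((\<lambda>x. \<integral>t. f (x + t) \<partial>lborel) has_derivative
      (\<lambda>h. \<Sum>b\<in>Basis. (h \<bullet> b) *\<^sub>R (\<integral>t. pderivative b f (0 + t) \<partial>lborel))) (at 0)"
  proof (rule has_derivative_lebesgue_integral[where f' = "\<lambda>b x t. pderivative b f (x + t)" and G = G])
    show "integrable lborel (\<lambda>t. f (x + t))" for x by (rule fi)
    show "((\<lambda>x. f (x + t)) has_derivative (\<lambda>h. \<Sum>b\<in>Basis. (h \<bullet> b) *\<^sub>R pderivative b f (x + t))) (at x)" for x t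
      by (rule has_derivative_compose[where f = "\<lambda>x. x + t" and f' = "\<lambda>h. h", OF _ schwartz_has_derivative[OF f]])
        (auto intro!: derivative_eq_intros)
    show "(\<lambda>t. pderivative b f (0 + t)) \<in> borel_measurable lborel" if "b \<in> Basis" for b
      using schwartz_measurable[OF schwartz_pderivative[OF f that]] by simp
    show "integrable lborel G"
      unfolding G_def by (intro integrable_mult_right integrable_weight) simp
    show "cmod (pderivative b f (x + t)) \<le> G t" if b: "b \<in> Basis" and x: "x \<in> ball 0 1" for b x t
    proof -
      have "norm t \<le> norm (x + t) + 1"
        using x norm_triangle_ineq4[of "x + t" x] by simp
      then have "(norm t)\<^sup>2 \<le> (norm (x + t) + 1)\<^sup>2" by (intro power_mono) auto
      also have "\<dots> \<le> 2 + 2 * (norm (x + t))\<^sup>2"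
        using zero_le_power2[of "norm (x + t) - 1"] by (simp add: power2_sum power2_diff)
      also have "\<dots> \<le> 2 + 3 * (norm (x + t))\<^sup>2" by simp
      finally have "1 + (norm t)\<^sup>2 \<le> 3 * (1 + (norm (x + t))\<^sup>2)" by simp
      then have "(1 + (norm t)\<^sup>2) ^ ?d \<le> (3 * (1 + (norm (x + t))\<^sup>2)) ^ ?d"
        by (intro power_mono) auto
      then have "(1 + (norm t)\<^sup>2) ^ ?d * cmod (pderivative b f (x + t)) \<le>
        3 ^ ?d * ((1 + (norm (x + t))\<^sup>2) ^ ?d * cmod (pderivative b f (x + t)))"
        unfolding power_mult_distrib mult.assoc[symmetric] by (rule mult_right_mono) simp
      also have "\<dots> \<le> 3 ^ ?d * C" using C[OF b] by simp
      finally show ?thesis unfolding le_weight_iff G_def by (simp add: mult_ac)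
    qed
  qed
  moreover have "(\<lambda>x. \<integral>t. f (x + t) \<partial>lborel) = (\<lambda>x. \<integral>t. f t \<partial>lborel)"
    using lborel_integral_translate schwartz_measurable[OF f] by blast
  ultimately have D: "((\<lambda>x. \<integral>t. f t \<partial>lborel) has_derivative
      (\<lambda>h. \<Sum>b\<in>Basis. (h \<bullet> b) *\<^sub>R (\<integral>t. pderivative b f t \<partial>lborel))) (at (0::'a))"
    by simp
  have "((\<lambda>x. \<integral>t. f t \<partial>lborel) has_derivative (\<lambda>h. \<Sum>b\<in>Basis. (h \<bullet> b) *\<^sub>R 0)) (at (0::'a))"
    by simp
  from pderivative_eqI[OF D b] pderivative_eqI[OF this b] show ?thesis by simp
qed

section \<open>The Fourier transform\<close>

definition fourier :: "('a::euclidean_space \<Rightarrow> complex) \<Rightarrow> 'a \<Rightarrow> complex" where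
  "fourier f y = (\<integral>x. cis (- (x \<bullet> y)) * f x \<partial>lborel)"

definition inv_fourier :: "('a::euclidean_space \<Rightarrow> complex) \<Rightarrow> 'a \<Rightarrow> complex" where
  "inv_fourier f x = of_real (inverse ((2 * pi) ^ DIM('a))) * fourier f (- x)"

lemma cis_measurable [measurable]: "cis \<in> borel_measurable borel"
  by (intro borel_measurable_continuous_onI continuous_intros)

lemma integrable_cis_mult:
  fixes f :: "'a::euclidean_space \<Rightarrow> complex"
  assumes "integrable lborel f"
  shows "integrable lborel (\<lambda>x. cis (x \<bullet> y) * f x)" "integrable lborel (\<lambda>x. cis (- (x \<bullet> y)) * f x)"
proof -
  have [measurable]: "f \<in> borel_measurable borel" using assms by auto
  show "integrable lborel (\<lambda>x. cis (x \<bullet> y) * f x)"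
    by (rule Bochner_Integration.integrable_bound[OF assms]) (auto simp: norm_mult)
  show "integrable lborel (\<lambda>x. cis (- (x \<bullet> y)) * f x)"
    by (rule Bochner_Integration.integrable_bound[OF assms]) (auto simp: norm_mult)
qed

lemma fourier_add:
  "integrable lborel f \<Longrightarrow> integrable lborel g \<Longrightarrow> fourier (\<lambda>x. f x + g x) y = fourier f y + fourier g y"
  by (simp add: fourier_def ring_distribs integrable_cis_mult)

lemma fourier_cmult: "fourier (\<lambda>x. a * f x) y = a * fourier f y"
proof -
  have "fourier (\<lambda>x. a * f x) y = (\<integral>x. a * (cis (- (x \<bullet> y)) * f x) \<partial>lborel)"
    unfolding fourier_def by (intro Bochner_Integration.integral_cong refl) simp
  then show ?thesis by (simp add: fourier_def)
qed

lemma fourier_sum: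
  "(\<And>i. i \<in> I \<Longrightarrow> integrable lborel (f i)) \<Longrightarrow> fourier (\<lambda>x. \<Sum>i\<in>I. f i x) y = (\<Sum>i\<in>I. fourier (f i) y)"
  by (simp add: fourier_def sum_distrib_left integrable_cis_mult)

lemma fourier_diff:
  "integrable lborel f \<Longrightarrow> integrable lborel g \<Longrightarrow> fourier (\<lambda>x. f x - g x) y = fourier f y - fourier g y"
  by (simp add: fourier_def ring_distribs integrable_cis_mult)

lemma norm_fourier_le: "cmod (fourier f y) \<le> (\<integral>x. cmod (f x) \<partial>lborel)"
  unfolding fourier_def by (rule order_trans[OF integral_norm_bound]) (simp add: norm_mult)

lemma has_derivative_cis_inner:
  fixes y :: "'a::euclidean_space"
  shows "((\<lambda>x. cis (- (x \<bullet> y))) has_derivative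
     (\<lambda>h. \<Sum>b\<in>Basis. (h \<bullet> b) *\<^sub>R (- \<i> * of_real (y \<bullet> b) * cis (- (x \<bullet> y))))) (at x)"
proof -
  have "((\<lambda>x. exp (\<i> * of_real (- (x \<bullet> y)))) has_derivative
      (\<lambda>h. exp (\<i> * of_real (- (x \<bullet> y))) * (\<i> * of_real (- (h \<bullet> y))))) (at x)"
  proof -
    have 1: "((\<lambda>x. \<i> * complex_of_real (- (x \<bullet> y))) has_derivative
        (\<lambda>h. \<i> * of_real (- (h \<bullet> y)))) (at x)"
      by (intro has_derivative_mult_right has_derivative_of_real has_derivative_minus
          has_derivative_inner_left has_derivative_ident)
    have 2: "(exp has_derivative (*) (exp z)) (at z)" for z :: complex
      using DERIV_exp unfolding has_field_derivative_def .
    show ?thesis by (rule has_derivative_compose[OF 1 2])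
  qed
  moreover have "exp (\<i> * of_real (- (x \<bullet> y))) * (\<i> * of_real (- (h \<bullet> y))) =
      (\<Sum>b\<in>Basis. (h \<bullet> b) *\<^sub>R (- \<i> * of_real (y \<bullet> b) * exp (\<i> * of_real (- (x \<bullet> y)))))" for h
    by (subst (2) euclidean_inner)
       (simp add: sum_distrib_left scaleR_conv_of_real mult_ac sum_negf)
  ultimately show ?thesis by (simp only: cis_conv_exp)
qed

lemma schwartz_cis_mult:
  fixes f :: "'a::euclidean_space \<Rightarrow> complex"
  assumes "schwartz f"
  shows "schwartz (\<lambda>x. cis (- (x \<bullet> y)) * f x)"
    and pderivative_cis_mult: "b \<in> Basis \<Longrightarrow> pderivative b (\<lambda>x. cis (- (x \<bullet> y)) * f x) =
      (\<lambda>x. cis (- (x \<bullet> y)) * (pderivative b f x - \<i> * of_real (y \<bullet> b) * f x))"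
proof -
  define X where "X h \<longleftrightarrow> (\<exists>f. schwartz f \<and> h = (\<lambda>x. cis (- (x \<bullet> y)) * f x))" for h :: "'a \<Rightarrow> complex"
  have D: "((\<lambda>x. cis (- (x \<bullet> y)) * f x) has_derivative
     (\<lambda>v. \<Sum>b\<in>Basis. (v \<bullet> b) *\<^sub>R (cis (- (x \<bullet> y)) * (pderivative b f x - \<i> * of_real (y \<bullet> b) * f x)))) (at x)"
    if "schwartz f" for f x
  proof (rule has_derivative_eq_rhs)
    show "((\<lambda>x. cis (- (x \<bullet> y)) * f x) has_derivative
      (\<lambda>v. cis (- (x \<bullet> y)) * (\<Sum>b\<in>Basis. (v \<bullet> b) *\<^sub>R pderivative b f x) +
         (\<Sum>b\<in>Basis. (v \<bullet> b) *\<^sub>R (- \<i> * of_real (y \<bullet> b) * cis (- (x \<bullet> y)))) * f x)) (at x)"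
      by (intro has_derivative_mult has_derivative_cis_inner schwartz_has_derivative that)
    show "(\<lambda>v. cis (- (x \<bullet> y)) * (\<Sum>b\<in>Basis. (v \<bullet> b) *\<^sub>R pderivative b f x) +
         (\<Sum>b\<in>Basis. (v \<bullet> b) *\<^sub>R (- \<i> * of_real (y \<bullet> b) * cis (- (x \<bullet> y)))) * f x) =
      (\<lambda>v. \<Sum>b\<in>Basis. (v \<bullet> b) *\<^sub>R (cis (- (x \<bullet> y)) * (pderivative b f x - \<i> * of_real (y \<bullet> b) * f x)))"
      by (rule ext) (simp add: sum_distrib_left sum_distrib_right sum.distrib[symmetric] algebra_simps scaleR_conv_of_real)
  qed
  have "X (\<lambda>x. cis (- (x \<bullet> y)) * f x)" using assms unfolding X_def by blast
  then show "schwartz (\<lambda>x. cis (- (x \<bullet> y)) * f x)"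
  proof (coinduct rule: schwartz_coinduct[where X = X])
    case (decay h N)
    then obtain f where f: "schwartz f" "h = (\<lambda>x. cis (- (x \<bullet> y)) * f x)" unfolding X_def by blast
    obtain c where "\<And>x. (1 + (norm x)\<^sup>2) ^ N * cmod (f x) \<le> c"
      using schwartz_decay[OF f(1), of N] by metis
    then show ?case unfolding f by (auto simp: norm_mult)
  next
    case (step h)
    then obtain f where f: "schwartz f" "h = (\<lambda>x. cis (- (x \<bullet> y)) * f x)" unfolding X_def by blast
    have "X (\<lambda>x. cis (- (x \<bullet> y)) * (pderivative b f x - \<i> * of_real (y \<bullet> b) * f x))" if "b \<in> Basis" for b
      unfolding X_def using f that
      by (intro exI[of _ "\<lambda>x. pderivative b f x - \<i> * of_real (y \<bullet> b) * f x"] conjI refl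
          schwartz_diff schwartz_cmult schwartz_pderivative)
    then show ?case
      using D[OF f(1)] unfolding f(2)
      by (intro exI[of _ "\<lambda>b x. cis (- (x \<bullet> y)) * (pderivative b f x - \<i> * of_real (y \<bullet> b) * f x)"]) blast
  qed
  show "pderivative b (\<lambda>x. cis (- (x \<bullet> y)) * f x) =
      (\<lambda>x. cis (- (x \<bullet> y)) * (pderivative b f x - \<i> * of_real (y \<bullet> b) * f x))" if "b \<in> Basis"
    using pderivative_eqI[OF D[OF assms] that] by blast
qed

text \<open>The derivative of \<open>cis (- (x \<bullet> y)) * f x\<close> has integral 0, and the
  product rule splits this integral into the two sides.\<close>

lemma fourier_pderivative:
  assumes f: "schwartz f" and b: "b \<in> Basis"
  shows "fourier (pderivative b f) y = \<i> * of_real (y \<bullet> b) * fourier f y"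
proof -
  have "0 = (\<integral>x. cis (- (x \<bullet> y)) * (pderivative b f x - \<i> * of_real (y \<bullet> b) * f x) \<partial>lborel)"
    using integral_pderivative_eq_0[OF schwartz_cis_mult(1)[OF f] b, of y]
    unfolding pderivative_cis_mult[OF f b] by simp
  also have "\<dots> = fourier (\<lambda>x. pderivative b f x - \<i> * of_real (y \<bullet> b) * f x) y"
    by (simp add: fourier_def)
  also have "\<dots> = fourier (pderivative b f) y - \<i> * of_real (y \<bullet> b) * fourier f y"
    using f b by (subst fourier_diff)
      (auto simp: fourier_cmult schwartz_integrable schwartz_pderivative)
  finally show ?thesis by simp
qed

lemma fourier_has_derivative:
  fixes f :: "'a::euclidean_space \<Rightarrow> complex"
  assumes f: "schwartz f"
  shows "(fourier f has_derivative
    (\<lambda>h. \<Sum>b\<in>Basis. (h \<bullet> b) *\<^sub>R fourier (\<lambda>x. - \<i> * (of_real (x \<bullet> b) * f x)) y)) (at y)"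
proof -
  have s: "schwartz (\<lambda>x. of_real (x \<bullet> b) * f x)" for b by (rule schwartz_inner_mult[OF f])
  have "((\<lambda>y. \<integral>x. cis (- (x \<bullet> y)) * f x \<partial>lborel) has_derivative
    (\<lambda>h. \<Sum>b\<in>Basis. (h \<bullet> b) *\<^sub>R (\<integral>x. cis (- (x \<bullet> y)) * (- \<i> * (of_real (x \<bullet> b) * f x)) \<partial>lborel))) (at y)"
  proof (rule has_derivative_lebesgue_integral[where G = "\<lambda>x. \<Sum>b\<in>Basis. cmod (of_real (x \<bullet> b) * f x)"])
    show "integrable lborel (\<lambda>x. cis (- (x \<bullet> y)) * f x)" for y
      by (intro integrable_cis_mult schwartz_integrable f)
    show "((\<lambda>y. cis (- (x \<bullet> y)) * f x) has_derivative
       (\<lambda>h. \<Sum>b\<in>Basis. (h \<bullet> b) *\<^sub>R (cis (- (x \<bullet> y)) * (- \<i> * (of_real (x \<bullet> b) * f x))))) (at y)" for x y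
      unfolding inner_commute[of x]
      by (rule has_derivative_eq_rhs[OF has_derivative_mult_left[OF has_derivative_cis_inner]])
        (simp add: fun_eq_iff sum_distrib_left scaleR_conv_of_real inner_commute mult_ac)
    show "(\<lambda>x. cis (- (x \<bullet> y)) * (- \<i> * (of_real (x \<bullet> b) * f x))) \<in> borel_measurable lborel" for b
      using schwartz_measurable[OF f] by measurable
    show "cmod (cis (- (x \<bullet> y)) * (- \<i> * (of_real (x \<bullet> b) * f x))) \<le> (\<Sum>b\<in>Basis. cmod (of_real (x \<bullet> b) * f x))"
      if "b \<in> Basis" for b x y
      using member_le_sum[OF that, of "\<lambda>b. cmod (of_real (x \<bullet> b) * f x)"]
      by (simp add: norm_mult)
    show "integrable lborel (\<lambda>x. \<Sum>b\<in>Basis. cmod (of_real (x \<bullet> b) * f x))"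
      using s by (intro Bochner_Integration.integrable_sum integrable_norm schwartz_integrable)
  qed
  then show ?thesis by (simp add: fourier_def[abs_def])
qed

definition one_minus_laplacian :: "('a::euclidean_space \<Rightarrow> complex) \<Rightarrow> 'a \<Rightarrow> complex" where
  "one_minus_laplacian f = (\<lambda>x. f x - (\<Sum>b\<in>Basis. pderivative b (pderivative b f) x))"

lemma schwartz_one_minus_laplacian: "schwartz f \<Longrightarrow> schwartz (one_minus_laplacian f)"
  unfolding one_minus_laplacian_def by (intro schwartz_diff schwartz_sum schwartz_pderivative)

lemma schwartz_one_minus_laplacian_funpow: "schwartz f \<Longrightarrow> schwartz ((one_minus_laplacian ^^ N) f)"
  by (induction N) (auto intro: schwartz_one_minus_laplacian)

lemma fourier_one_minus_laplacian:
  assumes "schwartz f"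
  shows "fourier (one_minus_laplacian f) y = of_real (1 + (norm y)\<^sup>2) * fourier f y"
proof -
  have "fourier (one_minus_laplacian f) y =
      fourier f y - (\<Sum>b\<in>Basis. fourier (pderivative b (pderivative b f)) y)"
    unfolding one_minus_laplacian_def
    using assms by (subst fourier_diff, auto intro!: schwartz_sum
        schwartz_integrable schwartz_pderivative fourier_sum)
  also have "\<dots> = fourier f y + (\<Sum>b\<in>Basis. of_real ((y \<bullet> b) * (y \<bullet> b))) * fourier f y"
    using assms by (simp add: fourier_pderivative schwartz_pderivative sum_distrib_left sum_negf algebra_simps)
  also have "(\<Sum>b\<in>Basis. complex_of_real ((y \<bullet> b) * (y \<bullet> b))) = of_real ((norm y)\<^sup>2)"
    unfolding power2_norm_eq_inner by (subst (3) euclidean_inner) simp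
  finally show ?thesis by (simp add: algebra_simps)
qed

lemma fourier_one_minus_laplacian_funpow:
  assumes "schwartz f"
  shows "fourier ((one_minus_laplacian ^^ N) f) y = of_real ((1 + (norm y)\<^sup>2) ^ N) * fourier f y"
  by (induction N)
    (simp_all add: fourier_one_minus_laplacian schwartz_one_minus_laplacian_funpow assms)

text \<open>The transform exchanges decay and smoothness: decay comes from iterating
  \<open>one_minus_laplacian\<close>, derivatives from multiplication by coordinates, and both keep
  the argument of the transform Schwartz.\<close>

lemma schwartz_fourier:
  fixes f :: "'a::euclidean_space \<Rightarrow> complex"
  assumes "schwartz f"
  shows "schwartz (fourier f)"
proof -
  define X where "X h \<longleftrightarrow> (\<exists>f. schwartz f \<and> h = fourier f)" for h :: "'a \<Rightarrow> complex"
  have "X (fourier f)" using assms unfolding X_def by blast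
  then show ?thesis
  proof (coinduct rule: schwartz_coinduct[where X = X])
    case (decay h N)
    then obtain f where f: "schwartz f" "h = fourier f" unfolding X_def by blast
    have "(1 + (norm y)\<^sup>2) ^ N * cmod (h y) = cmod (fourier ((one_minus_laplacian ^^ N) f) y)" for y
      by (simp add: f fourier_one_minus_laplacian_funpow norm_mult norm_power del: of_real_power of_real_add)
    then show ?case using norm_fourier_le by metis
  next
    case (step h)
    then obtain f where f: "schwartz f" "h = fourier f" unfolding X_def by blast
    have "X (fourier (\<lambda>x. - \<i> * (of_real (x \<bullet> b) * f x)))" for b
      unfolding X_def using schwartz_cmult[OF schwartz_inner_mult[OF f(1), of b], of "- \<i>"] by blast
    then show ?case
      using fourier_has_derivative[OF f(1)] unfolding f(2)
      by (intro exI[of _ "\<lambda>b. fourier (\<lambda>x. - \<i> * (of_real (x \<bullet> b) * f x))"]) blast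
  qed
qed

section \<open>The inverse transform\<close>

lemma schwartz_reflect:
  fixes f :: "'a::euclidean_space \<Rightarrow> complex"
  assumes "schwartz f"
  shows "schwartz (\<lambda>x. f (- x))"
proof -
  define X where "X h \<longleftrightarrow> (\<exists>f. schwartz f \<and> h = (\<lambda>x. f (- x)))" for h :: "'a \<Rightarrow> complex"
  have "X (\<lambda>x. f (- x))" using assms unfolding X_def by blast
  then show ?thesis
  proof (coinduct rule: schwartz_coinduct[where X = X])
    case (decay h N)
    then obtain f where f: "schwartz f" "h = (\<lambda>x. f (- x))" unfolding X_def by blast
    obtain c where "\<And>x. (1 + (norm x)\<^sup>2) ^ N * cmod (f x) \<le> c"
      using schwartz_decay[OF f(1), of N] by metis
    then have "\<forall>x. (1 + (norm x)\<^sup>2) ^ N * cmod (h x) \<le> c" unfolding f(2) by (metis norm_minus_cancel)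
    then show ?case by blast
  next
    case (step h)
    then obtain f where f: "schwartz f" "h = (\<lambda>x. f (- x))" unfolding X_def by blast
    have "(h has_derivative (\<lambda>v. \<Sum>b\<in>Basis. ((- v) \<bullet> b) *\<^sub>R pderivative b f (- x))) (at x)" for x
      unfolding f(2) by (rule has_derivative_compose[OF _ schwartz_has_derivative[OF f(1)]])
        (auto intro!: derivative_eq_intros)
    moreover have "X (\<lambda>x. - pderivative b f (- x))" if "b \<in> Basis" for b
      unfolding X_def using schwartz_uminus[OF schwartz_pderivative[OF f(1) that]] by blast
    ultimately show ?case
      by (intro exI[of _ "\<lambda>b x. - pderivative b f (- x)"]) simp
  qed
qed

lemma schwartz_inv_fourier: "schwartz f \<Longrightarrow> schwartz (inv_fourier f)"
  unfolding inv_fourier_def[abs_def] by (intro schwartz_cmult schwartz_reflect schwartz_fourier)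

text \<open>The normalising factor is at most 1 because 2 pi > 1, and is dropped.\<close>

lemma norm_inv_fourier_le:
  fixes f :: "'a::euclidean_space \<Rightarrow> complex"
  shows "cmod (inv_fourier f x) \<le> (\<integral>x. cmod (f x) \<partial>lborel)"
proof -
  have "cmod (inv_fourier f x) = inverse ((2 * pi) ^ DIM('a)) * cmod (fourier f (- x))"
    by (simp add: inv_fourier_def norm_mult norm_inverse norm_power)
  also have "\<dots> \<le> 1 * cmod (fourier f (- x))"
    using pi_gt3 by (intro mult_right_mono inverse_le_1_iff[THEN iffD2] disjI2 one_le_power) auto
  finally show ?thesis using norm_fourier_le[of f "- x"] by simp
qed

lemma inv_fourier_one_minus_laplacian_funpow:
  assumes "schwartz f"
  shows "inv_fourier ((one_minus_laplacian ^^ N) f) x = of_real ((1 + (norm x)\<^sup>2) ^ N) * inv_fourier f x"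
  using fourier_one_minus_laplacian_funpow[OF assms, of N "- x"]
  by (simp add: inv_fourier_def)

lemma inv_fourier_has_derivative:
  fixes f :: "'a::euclidean_space \<Rightarrow> complex"
  assumes f: "schwartz f"
  shows "(inv_fourier f has_derivative
    (\<lambda>h. \<Sum>b\<in>Basis. (h \<bullet> b) *\<^sub>R inv_fourier (\<lambda>x. \<i> * (of_real (x \<bullet> b) * f x)) y)) (at y)"
proof -
  have D: "((\<lambda>y. fourier f (- y)) has_derivative
    (\<lambda>h. \<Sum>b\<in>Basis. ((- h) \<bullet> b) *\<^sub>R fourier (\<lambda>x. - \<i> * (of_real (x \<bullet> b) * f x)) (- y))) (at y)"
    by (rule has_derivative_compose[OF _ fourier_has_derivative[OF f]])
      (auto intro!: derivative_eq_intros)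
  show ?thesis
    unfolding inv_fourier_def[abs_def]
    by (rule has_derivative_eq_rhs[OF has_derivative_mult_right[OF D]])
      (simp add: fun_eq_iff sum_distrib_left fourier_cmult[of "- \<i>", simplified] fourier_cmult mult_ac
        del: mult_minus_left minus_mult_left[symmetric])
qed

lemma pderivative_inv_fourier:
  assumes f: "schwartz f" and b: "b \<in> Basis"
  shows "pderivative b (inv_fourier f) = inv_fourier (\<lambda>x. \<i> * (of_real (x \<bullet> b) * f x))"
  by (rule ext, rule pderivative_eqI[OF inv_fourier_has_derivative[OF f] b])

section \<open>Gaussians, Fourier inversion and rotations\<close>

text \<open>A probability density that is both a product, which makes its integrals computable, and
  radial, which makes it invariant under rotations. It serves as approximate identity for inversion
  and as auxiliary factor in the rotation argument.\<close>

definition gaussian :: "'a::euclidean_space \<Rightarrow> real" where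
  "gaussian x = (\<Prod>b\<in>Basis. std_normal_density (x \<bullet> b))"

lemma gaussian_eq:
  "gaussian (x::'a::euclidean_space) = inverse (sqrt (2 * pi) ^ DIM('a)) * exp (- (norm x)\<^sup>2 / 2)"
proof -
  have "(norm x)\<^sup>2 = (\<Sum>b\<in>Basis. (x \<bullet> b)\<^sup>2)"
    unfolding power2_norm_eq_inner by (subst euclidean_inner) (simp add: power2_eq_square)
  then have eq: "- (norm x)\<^sup>2 / 2 = (\<Sum>b\<in>Basis. - (x \<bullet> b)\<^sup>2 / 2)"
    by (simp add: sum_negf sum_divide_distrib)
  have "exp (- (norm x)\<^sup>2 / 2) = (\<Prod>b\<in>Basis. exp (- (x \<bullet> b)\<^sup>2 / 2))"
    unfolding eq by (rule exp_sum[OF finite_Basis])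
  then show ?thesis
    unfolding gaussian_def std_normal_density_def
    by (simp add: prod_dividef inverse_eq_divide)
qed

lemma gaussian_pos: "0 < gaussian x"
  by (simp add: gaussian_eq)

lemma gaussian_measurable [measurable]: "gaussian \<in> borel_measurable borel"
  unfolding gaussian_eq[abs_def] by measurable

lemma integrable_gaussian: "integrable lborel (gaussian :: 'a::euclidean_space \<Rightarrow> real)"
  unfolding gaussian_def[abs_def]
  by (rule lborel_product_integral(1)) simp

lemma integral_gaussian: "(\<integral>x. gaussian x \<partial>lborel) = 1"
  unfolding gaussian_def[abs_def]
  by (subst lborel_product_integral(2)) simp_all

text \<open>Coordinatewise this is the characteristic function of the standard normal
  distribution.\<close>

lemma integral_cis_gaussian:
  fixes y :: "'a::euclidean_space"
  shows "(\<integral>x. cis (x \<bullet> y) * of_real (gaussian x) \<partial>lborel) = of_real (exp (- (norm y)\<^sup>2 / 2))"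
proof -
  have one: "(\<integral>t. cis (s * t) * of_real (std_normal_density t) \<partial>lborel) = of_real (exp (- s\<^sup>2 / 2))" for s
  proof -
    have "char std_normal_distribution s = (\<integral>t. std_normal_density t *\<^sub>R iexp (s * t) \<partial>lborel)"
      unfolding char_def by (subst integral_density) auto
    then show ?thesis
      by (simp add: char_std_normal_distribution cis_conv_exp scaleR_conv_of_real mult_ac)
  qed
  have int: "integrable lborel (\<lambda>t. cis (s * t) * of_real (std_normal_density t))" for s
    by (rule Bochner_Integration.integrable_bound[OF integrable_normal_density[of 1 0]]) (auto simp: norm_mult)
  have "cis (x \<bullet> y) * of_real (gaussian x) =
      (\<Prod>b\<in>Basis. cis ((y \<bullet> b) * (x \<bullet> b)) * of_real (std_normal_density (x \<bullet> b)))" for x :: 'a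
  proof -
    have "cis (x \<bullet> y) = (\<Prod>b\<in>Basis. cis ((y \<bullet> b) * (x \<bullet> b)))"
      by (subst euclidean_inner) (simp add: cis_conv_exp exp_sum sum_distrib_left mult_ac)
    then show ?thesis by (simp add: gaussian_def prod.distrib)
  qed
  then have "(\<integral>x. cis (x \<bullet> y) * of_real (gaussian x) \<partial>lborel) =
      (\<Prod>b\<in>Basis. complex_of_real (exp (- (y \<bullet> b)\<^sup>2 / 2)))"
    by (simp only:, subst lborel_product_integral(2)) (simp_all add: int one)
  also have "\<dots> = of_real (exp (- (norm y)\<^sup>2 / 2))"
  proof -
    have "(norm y)\<^sup>2 = (\<Sum>b\<in>Basis. (y \<bullet> b)\<^sup>2)"
      unfolding power2_norm_eq_inner by (subst euclidean_inner) (simp add: power2_eq_square)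
    then have eq: "- (norm y)\<^sup>2 / 2 = (\<Sum>b\<in>Basis. - (y \<bullet> b)\<^sup>2 / 2)"
      by (simp add: sum_negf sum_divide_distrib)
    show ?thesis unfolding eq exp_sum[OF finite_Basis] by simp
  qed
  finally show ?thesis .
qed

lemma integrable_prod_lborel:
  fixes f g :: "'a::euclidean_space \<Rightarrow> complex"
  assumes f: "integrable lborel f" and g: "integrable lborel g"
  shows "integrable (lborel \<Otimes>\<^sub>M lborel) (\<lambda>(x, y). f x * g y)"
proof -
  have [measurable]: "f \<in> borel_measurable borel" "g \<in> borel_measurable borel" using f g by auto
  show ?thesis
  proof (rule lborel_pair.Fubini_integrable)
    show "integrable lborel (\<lambda>x. \<integral>y. norm (case (x, y) of (x, y) \<Rightarrow> f x * g y) \<partial>lborel)"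
      using f by (simp add: norm_mult)
    show "AE x in lborel. integrable lborel (\<lambda>y. case (x, y) of (x, y) \<Rightarrow> f x * g y)"
      using g by simp
  qed measurable
qed

text \<open>The inversion integral is regularised by a Gaussian of width 1 / \<open>e\<close>.
  Fubini turns it into the mean of \<open>f (x + e *\<^sub>R u)\<close> against
  \<open>gaussian u\<close>, and \<open>e\<close> tends to 0 on both sides by dominated convergence,
  with \<open>fourier f\<close> as majorant on one side and the bound \<open>B\<close> on the
  other.\<close>

theorem fourier_inversion:
  fixes f :: "'a::euclidean_space \<Rightarrow> complex"
  assumes cont: "continuous_on UNIV f" and bdd: "\<And>x. cmod (f x) \<le> B"
    and int: "integrable lborel f" and fint: "integrable lborel (fourier f)"
  shows "inv_fourier (fourier f) x = f x"
proof -
  let ?d = "DIM('a)"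
  have [measurable]: "f \<in> borel_measurable borel" "fourier f \<in> borel_measurable borel"
    using cont fint by (auto intro: borel_measurable_continuous_onI)
  define G where "G e y = cis (x \<bullet> y) * of_real (exp (- (norm (e *\<^sub>R y))\<^sup>2 / 2))" for e :: real and y :: 'a
  have Gm [measurable]: "G e \<in> borel_measurable borel" for e
    unfolding G_def[abs_def] by measurable
  have Geq: "G e y = of_real (sqrt (2 * pi) ^ ?d) * (cis (x \<bullet> y) * of_real (gaussian (e *\<^sub>R y)))" for e y
    by (simp add: G_def gaussian_eq)
  have gint: "integrable lborel (\<lambda>y::'a. gaussian (e *\<^sub>R y))" if "e \<noteq> 0" for e
  proof -
    have "integrable (density (distr lborel borel (\<lambda>x. 0 + e *\<^sub>R x)) (\<lambda>_. ennreal (\<bar>e\<bar> ^ ?d))) (gaussian :: 'a \<Rightarrow> real)"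
      using integrable_gaussian[where 'a = 'a] by (subst (asm) lborel_affine[OF that, of 0]) (simp add: ennreal_power)
    then have "integrable (distr lborel borel (\<lambda>x::'a. e *\<^sub>R x)) (\<lambda>x. \<bar>e\<bar> ^ ?d *\<^sub>R (gaussian x :: real))"
      by (subst (asm) integrable_density) auto
    then have "integrable (distr lborel borel (\<lambda>x::'a. e *\<^sub>R x)) (gaussian :: 'a \<Rightarrow> real)"
      using that by (simp add: integrable_mult_right_iff)
    then show ?thesis by (subst (asm) integrable_distr_eq) auto
  qed
  have Gint: "integrable lborel (G e)" if "e \<noteq> 0" for e
    unfolding Geq[abs_def]
    by (intro integrable_mult_right Bochner_Integration.integrable_bound[OF gint[OF that]])
       (auto simp: norm_mult gaussian_pos less_imp_le)
  have key: "(\<integral>y. G e y * fourier f y \<partial>lborel) =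
      of_real ((2 * pi) ^ ?d) * (\<integral>u. of_real (gaussian u) * f (x + e *\<^sub>R u) \<partial>lborel)" if e: "e > 0" for e
  proof -
    have "(\<integral>y. G e y * fourier f y \<partial>lborel) = (\<integral>y. (\<integral>t. G e y * (cis (- (t \<bullet> y)) * f t) \<partial>lborel) \<partial>lborel)"
      unfolding fourier_def by simp
    also have "\<dots> = (\<integral>t. (\<integral>y. G e y * (cis (- (t \<bullet> y)) * f t) \<partial>lborel) \<partial>lborel)"
    proof (rule lborel_pair.Fubini_integral)
      show "integrable (lborel \<Otimes>\<^sub>M lborel) (\<lambda>(t, y). G e y * (cis (- (t \<bullet> y)) * f t))"
        by (rule Bochner_Integration.integrable_bound[OF integrable_prod_lborel[OF int Gint[of e]]])
          (use e in \<open>auto simp: norm_mult split_beta mult.commute\<close>)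
    qed
    also have "\<dots> = (\<integral>t. f t * (of_real (inverse (e ^ ?d) * (2 * pi) ^ ?d) * of_real (gaussian ((1 / e) *\<^sub>R (t - x)))) \<partial>lborel)"
    proof (intro Bochner_Integration.integral_cong refl)
      fix t
      have "(\<integral>y. G e y * (cis (- (t \<bullet> y)) * f t) \<partial>lborel) =
          (\<integral>y. f t * of_real (sqrt (2 * pi) ^ ?d) * (cis (y \<bullet> (x - t)) * of_real (gaussian (e *\<^sub>R y))) \<partial>lborel)"
      proof (intro Bochner_Integration.integral_cong refl)
        fix y
        have "cis (y \<bullet> (x - t)) = cis (x \<bullet> y) * cis (- (t \<bullet> y))"
          by (simp add: cis_mult inner_diff_right inner_commute[of y])
        then show "G e y * (cis (- (t \<bullet> y)) * f t) =
            f t * of_real (sqrt (2 * pi) ^ ?d) * (cis (y \<bullet> (x - t)) * of_real (gaussian (e *\<^sub>R y)))"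
          by (simp only: Geq mult_ac)
      qed
      also have "\<dots> = f t * of_real (sqrt (2 * pi) ^ ?d) * (\<integral>y. cis (y \<bullet> (x - t)) * of_real (gaussian (e *\<^sub>R y)) \<partial>lborel)"
        by (rule integral_mult_right_zero)
      also have "(\<integral>y. cis (y \<bullet> (x - t)) * of_real (gaussian (e *\<^sub>R y)) \<partial>lborel) =
         \<bar>1 / e\<bar> ^ ?d *\<^sub>R (\<integral>u. cis ((0 + (1 / e) *\<^sub>R u) \<bullet> (x - t)) * of_real (gaussian (e *\<^sub>R (0 + (1 / e) *\<^sub>R u))) \<partial>lborel)"
        using e by (intro lborel_integral_scale) auto
      also have "\<dots> = of_real (inverse (e ^ ?d)) * (\<integral>u. cis (u \<bullet> ((1 / e) *\<^sub>R (x - t))) * of_real (gaussian u) \<partial>lborel)"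
        using e by (simp add: scaleR_conv_of_real power_one_over inverse_eq_divide)
      also have "\<dots> = of_real (inverse (e ^ ?d)) * of_real (exp (- (norm ((1 / e) *\<^sub>R (t - x)))\<^sup>2 / 2))"
        by (subst integral_cis_gaussian) (simp add: norm_minus_commute)
      also have "\<dots> = of_real (inverse (e ^ ?d)) * of_real (sqrt (2 * pi) ^ ?d * gaussian ((1 / e) *\<^sub>R (t - x)))"
        by (simp add: gaussian_eq)
      also have "f t * of_real (sqrt (2 * pi) ^ ?d) *
          (of_real (inverse (e ^ ?d)) * of_real (sqrt (2 * pi) ^ ?d * gaussian ((1 / e) *\<^sub>R (t - x)))) =
        f t * (of_real (inverse (e ^ ?d) * (sqrt (2 * pi) ^ ?d * sqrt (2 * pi) ^ ?d)) * of_real (gaussian ((1 / e) *\<^sub>R (t - x))))"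
        unfolding of_real_mult by (simp only: mult_ac)
      \<comment> \<open>One factor comes from the missing normalisation of \<open>G\<close>, the
        other from writing the transformed Gaussian again through \<open>gaussian\<close>.\<close>
      also have "sqrt (2 * pi) ^ ?d * sqrt (2 * pi) ^ ?d = (2 * pi) ^ ?d"
        unfolding power_mult_distrib[symmetric] by (subst real_sqrt_mult_self) simp
      finally show "(\<integral>y. G e y * (cis (- (t \<bullet> y)) * f t) \<partial>lborel) =
         f t * (of_real (inverse (e ^ ?d) * (2 * pi) ^ ?d) * of_real (gaussian ((1 / e) *\<^sub>R (t - x))))" .
    qed
    \<comment> \<open>The substitution \<open>t = x + e *\<^sub>R u\<close> centres the Gaussian,
      and its Jacobian cancels \<open>inverse (e ^ ?d)\<close>.\<close>
    also have "\<dots> = \<bar>e\<bar> ^ ?d *\<^sub>R (\<integral>u. f (x + e *\<^sub>R u) * (of_real (inverse (e ^ ?d) * (2 * pi) ^ ?d) *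
        of_real (gaussian ((1 / e) *\<^sub>R (x + e *\<^sub>R u - x)))) \<partial>lborel)"
      using e by (intro lborel_integral_scale) auto
    also have "\<dots> = of_real ((2 * pi) ^ ?d) * (\<integral>u. of_real (gaussian u) * f (x + e *\<^sub>R u) \<partial>lborel)"
    proof -
      have "(\<integral>u. f (x + e *\<^sub>R u) * (of_real (inverse (e ^ ?d) * (2 * pi) ^ ?d) *
        of_real (gaussian ((1 / e) *\<^sub>R (x + e *\<^sub>R u - x)))) \<partial>lborel) =
        (\<integral>u. of_real (inverse (e ^ ?d) * (2 * pi) ^ ?d) * (of_real (gaussian u) * f (x + e *\<^sub>R u)) \<partial>lborel)"
        using e by (intro Bochner_Integration.integral_cong refl) (simp add: mult_ac)
      also have "\<dots> = of_real (inverse (e ^ ?d) * (2 * pi) ^ ?d) * (\<integral>u. of_real (gaussian u) * f (x + e *\<^sub>R u) \<partial>lborel)"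
        by (rule integral_mult_right_zero)
      finally show ?thesis using e by (simp add: scaleR_conv_of_real)
    qed
    finally show ?thesis .
  qed
  define e where "e n = inverse (real (Suc n))" for n
  have e: "e n > 0" "e \<longlonglongrightarrow> 0" for n
    unfolding e_def using LIMSEQ_inverse_real_of_nat by auto
  have "(\<lambda>n. \<integral>y. G (e n) y * fourier f y \<partial>lborel) \<longlonglongrightarrow> (\<integral>y. cis (x \<bullet> y) * fourier f y \<partial>lborel)"
  proof (rule integral_dominated_convergence)
    show "integrable lborel (\<lambda>y. cmod (fourier f y))" using fint by (rule integrable_norm)
    show "AE y in lborel. (\<lambda>n. G (e n) y * fourier f y) \<longlonglongrightarrow> cis (x \<bullet> y) * fourier f y"
    proof (rule AE_I2)
      fix y
      have "(\<lambda>n. cis (x \<bullet> y) * complex_of_real (exp (- (norm (e n *\<^sub>R y))\<^sup>2 / 2)) * fourier f y) \<longlonglongrightarrow>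
         cis (x \<bullet> y) * complex_of_real (exp (- (norm (0 *\<^sub>R y))\<^sup>2 / 2)) * fourier f y"
        by (intro tendsto_intros e(2)) auto
      then show "(\<lambda>n. G (e n) y * fourier f y) \<longlonglongrightarrow> cis (x \<bullet> y) * fourier f y"
        by (simp add: G_def)
    qed
    show "AE y in lborel. norm (G (e n) y * fourier f y) \<le> cmod (fourier f y)" for n
      by (intro AE_I2) (auto simp: G_def norm_mult intro!: mult_left_le_one_le)
  qed measurable
  moreover have "(\<lambda>n. \<integral>u. of_real (gaussian u) * f (x + e n *\<^sub>R u) \<partial>lborel) \<longlonglongrightarrow> (\<integral>u. of_real (gaussian (u :: 'a)) * f x \<partial>lborel)"
  proof (rule integral_dominated_convergence)
    show "integrable lborel (\<lambda>u::'a. gaussian u * B)" by (intro integrable_mult_left integrable_gaussian)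
    show "AE u in lborel. (\<lambda>n. of_real (gaussian u) * f (x + e n *\<^sub>R u)) \<longlonglongrightarrow> of_real (gaussian u) * f x"
    proof (rule AE_I2)
      fix u :: 'a
      have "(\<lambda>n. x + e n *\<^sub>R u) \<longlonglongrightarrow> x + 0 *\<^sub>R u" by (intro tendsto_intros e(2))
      then have "(\<lambda>n. f (x + e n *\<^sub>R u)) \<longlonglongrightarrow> f x"
        using cont by (auto simp: continuous_on_eq_continuous_at intro: isCont_tendsto_compose)
      then show "(\<lambda>n. of_real (gaussian u) * f (x + e n *\<^sub>R u)) \<longlonglongrightarrow> of_real (gaussian u) * f x"
        by (intro tendsto_intros)
    qed
    show "AE u in lborel. norm (of_real (gaussian u) * f (x + e n *\<^sub>R u)) \<le> gaussian u * B" for n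
      using bdd by (intro AE_I2) (auto simp: norm_mult gaussian_pos less_imp_le intro!: mult_left_mono)
  qed measurable
  then have "(\<lambda>n. of_real ((2 * pi) ^ ?d) * (\<integral>u. of_real (gaussian u) * f (x + e n *\<^sub>R u) \<partial>lborel)) \<longlonglongrightarrow>
      of_real ((2 * pi) ^ ?d) * (\<integral>u. of_real (gaussian (u :: 'a)) * f x \<partial>lborel)"
    by (intro tendsto_intros)
  ultimately have "(\<integral>y. cis (x \<bullet> y) * fourier f y \<partial>lborel) = of_real ((2 * pi) ^ ?d) * (\<integral>u. of_real (gaussian (u :: 'a)) * f x \<partial>lborel)"
    unfolding key[OF e(1)] by (rule LIMSEQ_unique)
  also have "(\<integral>u. complex_of_real (gaussian u) * f x \<partial>(lborel :: 'a measure)) = f x"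
    by (simp add: integral_gaussian)
  finally show ?thesis
    by (simp add: inv_fourier_def fourier_def[of "fourier f"] inner_commute field_simps)
qed

section \<open>The two transforms are mutually inverse on Schwartz functions\<close>

lemma schwartz_bounded:
  assumes "schwartz f"
  obtains B where "\<And>x. cmod (f x) \<le> B"
  using schwartz_decay[OF assms, of 0] by auto

lemma inv_fourier_fourier: "schwartz f \<Longrightarrow> inv_fourier (fourier f) = f"
  using fourier_inversion schwartz_continuous schwartz_integrable schwartz_fourier schwartz_bounded
  by (metis ext)

lemma fourier_inv_fourier:
  fixes f :: "'a::euclidean_space \<Rightarrow> complex"
  assumes "schwartz f"
  shows "fourier (inv_fourier f) = f"
proof
  fix y
  let ?c = "complex_of_real (inverse ((2 * pi) ^ DIM('a)))"
  have "fourier (inv_fourier f) y = ?c * fourier (\<lambda>x. fourier f (- x)) y"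
    unfolding inv_fourier_def[abs_def] by (rule fourier_cmult)
  also have "fourier (\<lambda>x. fourier f (- x)) y = (\<integral>x. cis (- ((- x) \<bullet> y)) * fourier f (- (- x)) \<partial>lborel)"
    unfolding fourier_def[of "\<lambda>x. fourier f (- x)"]
    using schwartz_measurable[OF schwartz_fourier[OF assms]]
    by (intro lborel_integral_uminus[symmetric]) auto
  also have "?c * \<dots> = inv_fourier (fourier f) y"
    by (simp add: inv_fourier_def fourier_def[of "fourier f"])
  also have "\<dots> = f y" by (simp add: inv_fourier_fourier assms)
  finally show "fourier (inv_fourier f) y = f y" .
qed

lemma fourier_inject:
  assumes "schwartz f" "schwartz g" "fourier f = fourier g"
  shows "f = g"
  using assms inv_fourier_fourier by metis

text \<open>The Fourier transform, which is injective, turns both sides into multiplication by the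
  same product of coordinates.\<close>

lemma pderivative_commute:
  assumes "schwartz f" "b \<in> Basis" "c \<in> Basis"
  shows "pderivative b (pderivative c f) = pderivative c (pderivative b f)"
proof (rule fourier_inject)
  show "fourier (pderivative b (pderivative c f)) = fourier (pderivative c (pderivative b f))"
    using assms by (intro ext) (simp add: fourier_pderivative schwartz_pderivative)
qed (use assms in \<open>auto intro: schwartz_pderivative\<close>)

text \<open>Insert the factor \<open>1 = \<integral>gaussian\<close>; Fubini and translations then move the rotation from \<open>f\<close> onto
  the Gaussian, which is radial.\<close>

lemma nn_integral_lborel_orthogonal:
  fixes f :: "'a::euclidean_space \<Rightarrow> ennreal" and T :: "'a \<Rightarrow> 'a"
  assumes [measurable]: "f \<in> borel_measurable borel" and T: "orthogonal_transformation T"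
  shows "(\<integral>\<^sup>+x. f (T x) \<partial>lborel) = (\<integral>\<^sup>+x. f x \<partial>lborel)"
proof -
  let ?g = "\<lambda>x::'a. ennreal (gaussian x)"
  have [measurable]: "T \<in> borel_measurable borel"
    using T by (intro borel_measurable_continuous_onI linear_continuous_on)
      (simp add: linear_linear orthogonal_transformation_linear)
  have g: "(\<integral>\<^sup>+x. ?g x \<partial>lborel) = 1"
    by (subst nn_integral_eq_integral) (auto simp: integrable_gaussian integral_gaussian gaussian_pos less_imp_le)
  have tr: "(\<integral>\<^sup>+x. h (c + x) \<partial>lborel) = (\<integral>\<^sup>+x. h x \<partial>lborel)"
    if [measurable]: "h \<in> borel_measurable borel" for h :: "'a \<Rightarrow> ennreal" and c
    by (subst (2) lborel_distr_plus[of c, symmetric]) (simp add: nn_integral_distr)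
  have refl: "(\<integral>\<^sup>+x. h (- x) \<partial>lborel) = (\<integral>\<^sup>+x. h x \<partial>lborel)"
    if [measurable]: "h \<in> borel_measurable borel" for h :: "'a \<Rightarrow> ennreal"
    by (subst (2) lborel_affine[of "-1" 0]) (simp_all add: nn_integral_distr nn_integral_density)
  obtain S where S: "\<And>y. T (S y) = y"
    using orthogonal_transformation_surj[OF T] by (metis surjD)
  have lin: "T (x + y) = T x + T y" "T (- x) = - T x" for x y
    using orthogonal_transformation_linear[OF T] by (auto simp: linear_add linear_neg)
  have "(\<integral>\<^sup>+x. f (T x) \<partial>lborel) = (\<integral>\<^sup>+x. (\<integral>\<^sup>+y. f (T x) * ?g y \<partial>lborel) \<partial>lborel)"
    by (simp add: nn_integral_cmult g)
  also have "\<dots> = (\<integral>\<^sup>+x. (\<integral>\<^sup>+y. f (T x) * ?g (T x + y) \<partial>lborel) \<partial>lborel)"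
  proof (rule nn_integral_cong)
    fix x
    show "(\<integral>\<^sup>+y. f (T x) * ?g y \<partial>lborel) = (\<integral>\<^sup>+y. f (T x) * ?g (T x + y) \<partial>lborel)"
      using tr[of "\<lambda>y. f (T x) * ?g y" "T x"] by simp
  qed
  also have "\<dots> = (\<integral>\<^sup>+y. (\<integral>\<^sup>+x. f (T x) * ?g (T x + y) \<partial>lborel) \<partial>lborel)"
    by (rule lborel_pair.Fubini'[symmetric]) measurable
  also have "\<dots> = (\<integral>\<^sup>+y. (\<integral>\<^sup>+x. f (T x - y) * ?g (T x) \<partial>lborel) \<partial>lborel)"
  proof (rule nn_integral_cong)
    fix y
    have "(\<integral>\<^sup>+x. f (T x - y) * ?g (T x) \<partial>lborel) = (\<integral>\<^sup>+x. f (T (S y + x) - y) * ?g (T (S y + x)) \<partial>lborel)"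
      by (rule tr[symmetric]) measurable
    then show "(\<integral>\<^sup>+x. f (T x) * ?g (T x + y) \<partial>lborel) = (\<integral>\<^sup>+x. f (T x - y) * ?g (T x) \<partial>lborel)"
      by (simp add: lin S add.commute)
  qed
  also have "\<dots> = (\<integral>\<^sup>+x. (\<integral>\<^sup>+y. f (T x - y) * ?g (T x) \<partial>lborel) \<partial>lborel)"
    by (rule lborel_pair.Fubini') measurable
  also have "\<dots> = (\<integral>\<^sup>+x. (\<integral>\<^sup>+y. f y \<partial>lborel) * ?g x \<partial>lborel)"
  proof (rule nn_integral_cong)
    fix x
    have "(\<integral>\<^sup>+y. f (T x - y) \<partial>lborel) = (\<integral>\<^sup>+y. f (T x + y) \<partial>lborel)"
      using refl[of "\<lambda>y. f (T x + y)"] by simp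
    also have "\<dots> = (\<integral>\<^sup>+y. f y \<partial>lborel)" by (rule tr) measurable
    finally show "(\<integral>\<^sup>+y. f (T x - y) * ?g (T x) \<partial>lborel) = (\<integral>\<^sup>+y. f y \<partial>lborel) * ?g x"
      using orthogonal_transformation_norm[OF T, of x] by (simp add: nn_integral_multc gaussian_eq)
  qed
  also have "\<dots> = (\<integral>\<^sup>+x. f x \<partial>lborel)"
    by (simp add: nn_integral_cmult g)
  finally show ?thesis .
qed

lemma lborel_distr_orthogonal:
  fixes T :: "'a::euclidean_space \<Rightarrow> 'a"
  assumes T: "orthogonal_transformation T"
  shows "distr lborel borel T = lborel"
proof (rule measure_eqI)
  have Tm [measurable]: "T \<in> borel_measurable borel"
    using T by (intro borel_measurable_continuous_onI linear_continuous_on)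
      (simp add: linear_linear orthogonal_transformation_linear)
  fix A assume "A \<in> sets (distr lborel borel T)"
  then have [measurable]: "A \<in> sets borel" by simp
  have "emeasure (distr lborel borel T) A = (\<integral>\<^sup>+x. indicator A x \<partial>distr lborel borel T)" by simp
  also have "\<dots> = (\<integral>\<^sup>+x. indicator A (T x) \<partial>lborel)" by (subst nn_integral_distr) auto
  also have "\<dots> = (\<integral>\<^sup>+x. indicator A x \<partial>lborel)"
    by (rule nn_integral_lborel_orthogonal[OF _ T]) measurable
  finally show "emeasure (distr lborel borel T) A = emeasure lborel A" by simp
qed simp

lemma lborel_integral_orthogonal:
  fixes f :: "'a::euclidean_space \<Rightarrow> 'b::{banach, second_countable_topology}" and T :: "'a \<Rightarrow> 'a"
  assumes "f \<in> borel_measurable borel" and T: "orthogonal_transformation T"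
  shows "(\<integral>x. f (T x) \<partial>lborel) = (\<integral>x. f x \<partial>lborel)"
proof -
  have "T \<in> borel_measurable borel"
    using T by (intro borel_measurable_continuous_onI linear_continuous_on)
      (simp add: linear_linear orthogonal_transformation_linear)
  then have "(\<integral>x. f x \<partial>distr lborel borel T) = (\<integral>x. f (T x) \<partial>lborel)"
    using assms(1) by (intro integral_distr) auto
  then show ?thesis by (simp add: lborel_distr_orthogonal[OF T])
qed

lemma fourier_orthogonal:
  fixes f :: "'a::euclidean_space \<Rightarrow> complex" and T :: "'a \<Rightarrow> 'a"
  assumes f: "f \<in> borel_measurable borel" and T: "orthogonal_transformation T"
  shows "fourier f (T y) = fourier (\<lambda>x. f (T x)) y"
proof -
  have "fourier f (T y) = (\<integral>x. cis (- (T x \<bullet> T y)) * f (T x) \<partial>lborel)"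
    unfolding fourier_def by (rule lborel_integral_orthogonal[symmetric]) (use f T in auto)
  then show ?thesis
    using T by (simp add: fourier_def orthogonal_transformation_def)
qed

lemma inv_fourier_orthogonal:
  fixes f :: "'a::euclidean_space \<Rightarrow> complex" and T :: "'a \<Rightarrow> 'a"
  assumes f: "f \<in> borel_measurable borel" and T: "orthogonal_transformation T"
  shows "inv_fourier f (T y) = inv_fourier (\<lambda>x. f (T x)) y"
  using fourier_orthogonal[OF assms, of "- y"] linear_neg[OF orthogonal_transformation_linear[OF T], of y]
  by (simp add: inv_fourier_def)

section \<open>Averaging operators on Schwartz functions of two variables\<close>

lemma Basis_real2: "(Basis :: (real \<times> real) set) = {(1, 0), (0, 1)}"
  by (auto simp: Basis_prod_def)

abbreviation d1 :: "(real \<times> real \<Rightarrow> complex) \<Rightarrow> real \<times> real \<Rightarrow> complex" where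
  "d1 \<equiv> pderivative (1, 0)"

abbreviation d2 :: "(real \<times> real \<Rightarrow> complex) \<Rightarrow> real \<times> real \<Rightarrow> complex" where
  "d2 \<equiv> pderivative (0, 1)"

lemma schwartz_d1: "schwartz g \<Longrightarrow> schwartz (d1 g)" and schwartz_d2: "schwartz g \<Longrightarrow> schwartz (d2 g)"
  by (auto intro!: schwartz_pderivative simp: Basis_real2)

lemma schwartz_has_derivative2:
  fixes g :: "real \<times> real \<Rightarrow> complex"
  assumes "schwartz g"
  shows "(g has_derivative (\<lambda>h. fst h *\<^sub>R d1 g x + snd h *\<^sub>R d2 g x)) (at x)"
  using schwartz_has_derivative[OF assms, of x]
  by (simp add: Basis_real2 inner_prod_def)

text \<open>Moments of \<open>g\<close> along the segment from (\<xi>, \<eta> - \<xi>) to (\<xi>,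
  \<eta> + \<xi>); its length 2 \<xi> is the distance between consecutive rays of
  \<open>Sigma_D n\<close>. For \<open>k = 0\<close> this is the mean. Higher \<open>k\<close> are
  needed because differentiation in the first variable brings down a factor
  \<open>s\<close>.\<close>

definition avg :: "nat \<Rightarrow> (real \<times> real \<Rightarrow> complex) \<Rightarrow> real \<times> real \<Rightarrow> complex" where
  "avg k g x = (\<integral>s. of_real (s ^ k / 2) * g (fst x, snd x + s * fst x) \<partial>restrict_space lborel {-1..1})"

interpretation avg: finite_measure "restrict_space lborel {-1..1::real}"
  by (intro finite_measureI) (simp add: space_restrict_space emeasure_restrict_space)

lemma measure_avg: "measure (restrict_space lborel {-1..1::real}) {-1..1} = 2"
  by (subst measure_restrict_space) auto

lemma avg_measurable:
  fixes f :: "real \<Rightarrow> complex"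
  shows "continuous_on UNIV f \<Longrightarrow> f \<in> borel_measurable (restrict_space lborel {-1..1})"
  by (intro measurable_restrict_space1) (simp add: borel_measurable_continuous_onI)

lemma shear_has_derivative:
  "((\<lambda>x. (fst x, snd x + s * fst x)) has_derivative (\<lambda>h. (fst h, snd h + s * fst h))) (at (x :: real \<times> real))"
  by (auto intro!: derivative_eq_intros)

lemma avg_integrable:
  assumes g: "schwartz g"
  shows "integrable (restrict_space lborel {-1..1}) (\<lambda>s. of_real (s ^ k / 2) * g (fst x, snd x + s * fst x))"
proof -
  obtain B where B: "\<And>x. cmod (g x) \<le> B" using schwartz_bounded[OF g] by blast
  show ?thesis
  proof (rule avg.integrable_const_bound[where B = B])
    show "AE s in restrict_space lborel {-1..1}. cmod (of_real (s ^ k / 2) * g (fst x, snd x + s * fst x)) \<le> B"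
    proof (rule AE_I2)
      fix s assume "s \<in> space (restrict_space lborel {-1..1::real})"
      then have s: "\<bar>s\<bar> ^ k \<le> 1" by (auto simp: space_restrict_space intro!: power_le_one)
      have "\<bar>s\<bar> ^ k / 2 * cmod (g (fst x, snd x + s * fst x)) \<le> 1 * B"
        using s by (intro mult_mono B) auto
      then show "cmod (of_real (s ^ k / 2) * g (fst x, snd x + s * fst x)) \<le> B"
        by (simp add: norm_mult norm_divide norm_power power_abs)
    qed
    show "(\<lambda>s. of_real (s ^ k / 2) * g (fst x, snd x + s * fst x)) \<in> borel_measurable (restrict_space lborel {-1..1})"
      by (intro avg_measurable continuous_intros continuous_on_compose2[OF schwartz_continuous[OF g]]) auto
  qed
qed

lemma avg_has_derivative:
  fixes g :: "real \<times> real \<Rightarrow> complex"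
  assumes g: "schwartz g"
  shows "(avg k g has_derivative (\<lambda>h. \<Sum>b\<in>Basis. (h \<bullet> b) *\<^sub>R
     (if b = (1, 0) then avg k (d1 g) x + avg (Suc k) (d2 g) x else avg k (d2 g) x))) (at x)"
proof -
  let ?M = "restrict_space lborel {-1..1::real}"
  let ?f' = "\<lambda>b x s. of_real (s ^ k / 2) *
    (if b = (1, 0) then d1 g (fst x, snd x + s * fst x) + of_real s * d2 g (fst x, snd x + s * fst x)
      else d2 g (fst x, snd x + s * fst x))"
  obtain B1 B2 where B: "\<And>x. cmod (d1 g x) \<le> B1" "\<And>x. cmod (d2 g x) \<le> B2"
    using schwartz_bounded[OF schwartz_d1[OF g]] schwartz_bounded[OF schwartz_d2[OF g]] by metis
  note B0 = order_trans[OF norm_ge_zero B(1)] order_trans[OF norm_ge_zero B(2)]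
  have D: "((\<lambda>x. \<integral>s. of_real (s ^ k / 2) * g (fst x, snd x + s * fst x) \<partial>?M) has_derivative
      (\<lambda>h. \<Sum>b\<in>Basis. (h \<bullet> b) *\<^sub>R (\<integral>s. ?f' b x s \<partial>?M))) (at x)"
  proof (rule has_derivative_lebesgue_integral[where G = "\<lambda>_. B1 + B2"])
    show "integrable ?M (\<lambda>s. of_real (s ^ k / 2) * g (fst x, snd x + s * fst x))" for x
      by (rule avg_integrable[OF g])
    show "((\<lambda>x. of_real (s ^ k / 2) * g (fst x, snd x + s * fst x)) has_derivative
        (\<lambda>h. \<Sum>b\<in>Basis. (h \<bullet> b) *\<^sub>R ?f' b x s)) (at x)" for x s
      by (rule has_derivative_eq_rhs[OF has_derivative_mult_right[OF
            has_derivative_compose[OF shear_has_derivative schwartz_has_derivative2[OF g]]]])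
        (simp add: Basis_real2 inner_prod_def fun_eq_iff scaleR_conv_of_real algebra_simps)
    show "?f' b x \<in> borel_measurable ?M" for b
      by (cases "b = (1, 0)"; simp only: if_True if_False refl;
          intro avg_measurable continuous_intros continuous_on_compose2[OF schwartz_continuous[OF schwartz_d1[OF g]]]
           continuous_on_compose2[OF schwartz_continuous[OF schwartz_d2[OF g]]]) auto
    show "cmod (?f' b y s) \<le> B1 + B2" if "s \<in> space ?M" for b y s
    proof -
      from that have s: "\<bar>s\<bar> \<le> 1" by (auto simp: space_restrict_space)
      then have sk: "\<bar>s\<bar> ^ k \<le> 1" by (intro power_le_one) auto
      let ?y = "(fst y, snd y + s * fst y)"
      have "cmod (of_real s * d2 g ?y) \<le> 1 * B2"
        unfolding norm_mult using s B0 by (intro mult_mono B) auto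
      then have "cmod (if b = (1, 0) then d1 g ?y + of_real s * d2 g ?y else d2 g ?y) \<le> B1 + B2"
        using B(1)[of ?y] B(2)[of ?y] B0 norm_triangle_ineq[of "d1 g ?y" "of_real s * d2 g ?y"]
        by auto
      moreover have "cmod (of_real (s ^ k / 2)) \<le> 1"
        using sk by (simp add: norm_divide norm_power power_abs)
      ultimately have "cmod (?f' b y s) \<le> 1 * (B1 + B2)"
        unfolding norm_mult using B0 by (intro mult_mono) auto
      then show ?thesis by simp
    qed
  qed simp
  have I: "(\<integral>s. ?f' b x s \<partial>?M) =
      (if b = (1, 0) then avg k (d1 g) x + avg (Suc k) (d2 g) x else avg k (d2 g) x)" for b
  proof (cases "b = (1, 0)")
    case True
    have "(\<integral>s. ?f' b x s \<partial>?M) = (\<integral>s. of_real (s ^ k / 2) * d1 g (fst x, snd x + s * fst x) +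
        of_real (s ^ Suc k / 2) * d2 g (fst x, snd x + s * fst x) \<partial>?M)"
      using True by (intro Bochner_Integration.integral_cong refl) (simp add: algebra_simps)
    also have "\<dots> = avg k (d1 g) x + avg (Suc k) (d2 g) x"
      unfolding avg_def by (intro Bochner_Integration.integral_add avg_integrable schwartz_d1 schwartz_d2 g)
    finally show ?thesis using True by simp
  qed (simp add: avg_def)
  have "avg k g = (\<lambda>x. \<integral>s. of_real (s ^ k / 2) * g (fst x, snd x + s * fst x) \<partial>?M)"
    by (rule ext) (rule avg_def)
  then show ?thesis using D unfolding I by simp
qed

text \<open>A shear with parameter at most 1 shrinks lengths by no more than the factor
  \<open>sqrt 3\<close>, so the weights before and after the shear are comparable.\<close>

lemma avg_decay:
  assumes g: "schwartz g" and c: "\<And>x. (1 + (norm x)\<^sup>2) ^ N * cmod (g x) \<le> c"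
  shows "(1 + (norm x)\<^sup>2) ^ N * cmod (avg k g x) \<le> 3 ^ N * c"
proof -
  let ?w = "inverse ((1 + (norm x)\<^sup>2) ^ N)"
  have "cmod (avg k g x) \<le> (\<integral>s. 3 ^ N * c * ?w / 2 \<partial>restrict_space lborel {-1..1::real})"
    unfolding avg_def
  proof (rule Bochner_Integration.integral_norm_bound_integral[OF avg_integrable[OF g]])
    fix s assume "s \<in> space (restrict_space lborel {-1..1::real})"
    then have s: "\<bar>s\<bar> \<le> 1" by (auto simp: space_restrict_space)
    let ?y = "(fst x, snd x + s * fst x)"
    have "(snd x)\<^sup>2 = ((snd x + s * fst x) - s * fst x)\<^sup>2" by simp
    also have "\<dots> \<le> 2 * (snd x + s * fst x)\<^sup>2 + 2 * (s * fst x)\<^sup>2"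
    proof -
      have "(a - b)\<^sup>2 \<le> 2 * a\<^sup>2 + 2 * b\<^sup>2" for a b :: real
        using zero_le_power2[of "a + b"] by (simp add: power2_diff power2_sum)
      then show ?thesis .
    qed
    also have "(s * fst x)\<^sup>2 \<le> (fst x)\<^sup>2"
    proof -
      have "s\<^sup>2 \<le> 1" using s by (simp add: abs_square_le_1)
      then show ?thesis by (simp add: power_mult_distrib mult_left_le_one_le)
    qed
    finally have le: "(snd x)\<^sup>2 \<le> 2 * (snd x + s * fst x)\<^sup>2 + 2 * (fst x)\<^sup>2" by simp
    have "(norm ?y)\<^sup>2 = (fst x)\<^sup>2 + (snd x + s * fst x)\<^sup>2" "(norm x)\<^sup>2 = (fst x)\<^sup>2 + (snd x)\<^sup>2"
      by (simp add: norm_Pair, cases x, simp add: norm_Pair)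
    then have "(norm x)\<^sup>2 \<le> 3 * (norm ?y)\<^sup>2"
      using le zero_le_power2[of "snd x + s * fst x"] by linarith
    then have "(1 + (norm x)\<^sup>2) ^ N \<le> (3 * (1 + (norm ?y)\<^sup>2)) ^ N"
      by (intro power_mono) auto
    then have "(1 + (norm x)\<^sup>2) ^ N * cmod (g ?y) \<le> 3 ^ N * ((1 + (norm ?y)\<^sup>2) ^ N * cmod (g ?y))"
      unfolding power_mult_distrib mult.assoc[symmetric] by (rule mult_right_mono) simp
    also have "\<dots> \<le> 3 ^ N * c" using c[of ?y] by simp
    finally have "cmod (g ?y) \<le> 3 ^ N * c * ?w" unfolding le_weight_iff .
    moreover have "\<bar>s\<bar> ^ k \<le> 1" using s by (intro power_le_one) auto
    ultimately have "\<bar>s\<bar> ^ k * cmod (g ?y) \<le> 1 * (3 ^ N * c * ?w)" by (intro mult_mono) auto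
    then show "cmod (of_real (s ^ k / 2) * g ?y) \<le> 3 ^ N * c * ?w / 2"
      by (simp add: norm_mult norm_divide norm_power power_abs)
  qed simp
  also have "\<dots> = 3 ^ N * c * ?w"
    by (simp add: space_restrict_space measure_avg)
  finally show ?thesis unfolding le_weight_iff .
qed

lemma schwartz_avg:
  assumes "schwartz g"
  shows "schwartz (avg k g)"
proof -
  \<comment> \<open>Finite sums of averages with varying moments: the first partial of a single
    average already consists of two.\<close>
  define X where "X h \<longleftrightarrow> (\<exists>ps. (\<forall>(k, g)\<in>set ps. schwartz g) \<and> h = (\<lambda>x. \<Sum>(k, g)\<leftarrow>ps. avg k g x))"
    for h :: "real \<times> real \<Rightarrow> complex"
  have D: "X h \<Longrightarrow> (\<forall>N. \<exists>c. \<forall>x. (1 + (norm x)\<^sup>2) ^ N * cmod (h x) \<le> c) \<and>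
      (\<exists>f'. (\<forall>b\<in>Basis. X (f' b)) \<and>
      (\<forall>x. (h has_derivative (\<lambda>v. \<Sum>b\<in>Basis. (v \<bullet> b) *\<^sub>R f' b x)) (at x)))" for h
  proof -
    have "\<forall>(k, g)\<in>set ps. schwartz g \<Longrightarrow> h = (\<lambda>x. \<Sum>(k, g)\<leftarrow>ps. avg k g x) \<Longrightarrow> ?thesis" for ps
    proof (induction ps arbitrary: h)
      case Nil
      have "X (\<lambda>_. 0)" unfolding X_def by (intro exI[of _ "[]"]) simp
      with Nil show ?case by (intro conjI exI[of _ "\<lambda>_ _. 0"]) auto
    next
      case (Cons p ps)
      obtain k g where p: "p = (k, g)" by force
      define h0 where "h0 = (\<lambda>x. \<Sum>(k, g)\<leftarrow>ps. avg k g x)"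
      have g: "schwartz g" and h: "h = (\<lambda>x. avg k g x + h0 x)"
        using Cons.prems by (auto simp: p h0_def)
      have IH: "(\<forall>N. \<exists>c. \<forall>x. (1 + (norm x)\<^sup>2) ^ N * cmod (h0 x) \<le> c) \<and>
          (\<exists>f'. (\<forall>b\<in>Basis. X (f' b)) \<and>
          (\<forall>x. (h0 has_derivative (\<lambda>v. \<Sum>b\<in>Basis. (v \<bullet> b) *\<^sub>R f' b x)) (at x)))"
        using Cons by (simp add: h0_def)
      then obtain f' where f': "\<And>b. b \<in> Basis \<Longrightarrow> X (f' b)"
        "\<And>x. (h0 has_derivative (\<lambda>v. \<Sum>b\<in>Basis. (v \<bullet> b) *\<^sub>R f' b x)) (at x)" by blast
      show ?case
      proof
        show "\<forall>N. \<exists>c. \<forall>x. (1 + (norm x)\<^sup>2) ^ N * cmod (h x) \<le> c"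
        proof
          fix N
          from IH obtain c where c: "\<And>x. (1 + (norm x)\<^sup>2) ^ N * cmod (h0 x) \<le> c" by blast
          obtain d where d: "\<And>x. (1 + (norm x)\<^sup>2) ^ N * cmod (g x) \<le> d"
            using schwartz_decay[OF g, of N] by metis
          have "(1 + (norm x)\<^sup>2) ^ N * cmod (h x) \<le> 3 ^ N * d + c" for x
          proof -
            have "(1 + (norm x)\<^sup>2) ^ N * cmod (h x) \<le> (1 + (norm x)\<^sup>2) ^ N * (cmod (avg k g x) + cmod (h0 x))"
              unfolding h by (intro mult_left_mono norm_triangle_ineq) simp
            then show ?thesis
              using avg_decay[OF g d, of x k] c[of x] by (simp add: distrib_left)
          qed
          then show "\<exists>c. \<forall>x. (1 + (norm x)\<^sup>2) ^ N * cmod (h x) \<le> c" by blast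
        qed
        let ?a' = "\<lambda>b x. if b = (1, 0) then avg k (d1 g) x + avg (Suc k) (d2 g) x else avg k (d2 g) x"
        have "(h has_derivative (\<lambda>v. \<Sum>b\<in>Basis. (v \<bullet> b) *\<^sub>R (?a' b x + f' b x))) (at x)" for x
          unfolding h scaleR_add_right sum.distrib
          by (rule has_derivative_add[OF avg_has_derivative[OF g, unfolded scaleR_add_right] f'(2), unfolded scaleR_add_right])
        moreover have "X (\<lambda>x. ?a' b x + f' b x)" if "b \<in> Basis" for b
        proof -
          from f'(1)[OF that] obtain qs where qs: "\<forall>(k, g)\<in>set qs. schwartz g" "f' b = (\<lambda>x. \<Sum>(k, g)\<leftarrow>qs. avg k g x)"
            unfolding X_def by blast
          show ?thesis
          proof (cases "b = (1, 0)")
            case True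
            then show ?thesis unfolding X_def
              using qs schwartz_d1[OF g] schwartz_d2[OF g]
              by (intro exI[of _ "(k, d1 g) # (Suc k, d2 g) # qs"]) (auto simp: fun_eq_iff)
          next
            case False
            then show ?thesis unfolding X_def
              using qs schwartz_d2[OF g]
              by (intro exI[of _ "(k, d2 g) # qs"]) (auto simp: fun_eq_iff)
          qed
        qed
        ultimately show "\<exists>f'. (\<forall>b\<in>Basis. X (f' b)) \<and>
          (\<forall>x. (h has_derivative (\<lambda>v. \<Sum>b\<in>Basis. (v \<bullet> b) *\<^sub>R f' b x)) (at x))"
          by (intro exI[of _ "\<lambda>b x. ?a' b x + f' b x"]) blast
      qed
    qed
    then show "X h \<Longrightarrow> ?thesis" unfolding X_def by blast
  qed
  have "X (avg k g)" unfolding X_def using assms by (intro exI[of _ "[(k, g)]"]) simp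
  then show ?thesis by (coinduct rule: schwartz_coinduct[where X = X]) (use D in blast)+
qed

lemma pderivative_avg:
  assumes "schwartz g"
  shows "d1 (avg k g) = (\<lambda>x. avg k (d1 g) x + avg (Suc k) (d2 g) x)" "d2 (avg k g) = avg k (d2 g)"
  using pderivative_eqI[OF avg_has_derivative[OF assms], of "(1, 0)"]
    pderivative_eqI[OF avg_has_derivative[OF assms], of "(0, 1)"]
  by (auto simp: Basis_real2)

text \<open>Difference quotients of \<open>g\<close> in the second variable with step \<open>2\<xi>\<close> are averages of derivatives,
  so that no singularity at \<open>\<xi> = 0\<close> appears.\<close>

lemma avg_diff_quotient:
  assumes g: "schwartz g"
  shows "g (\<xi>, \<eta> + \<xi>) - g (\<xi>, \<eta> - \<xi>) = of_real (2 * \<xi>) * avg 0 (d2 g) (\<xi>, \<eta>)"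
proof -
  have D: "((\<lambda>s. g (\<xi>, \<eta> + s * \<xi>)) has_vector_derivative of_real \<xi> * d2 g (\<xi>, \<eta> + s * \<xi>)) (at s within {-1..1})" for s
  proof -
    have "((\<lambda>s. g (\<xi>, \<eta> + s * \<xi>)) has_derivative
        (\<lambda>h. fst (0::real, h * \<xi>) *\<^sub>R d1 g (\<xi>, \<eta> + s * \<xi>) + snd (0::real, h * \<xi>) *\<^sub>R d2 g (\<xi>, \<eta> + s * \<xi>))) (at s)"
      by (rule has_derivative_compose[OF _ schwartz_has_derivative2[OF g]]) (auto intro!: derivative_eq_intros)
    then show ?thesis
      by (auto simp: has_vector_derivative_def scaleR_conv_of_real mult_ac intro: has_derivative_at_withinI)
  qed
  have c: "continuous_on {-1..1} (\<lambda>s. of_real \<xi> * d2 g (\<xi>, \<eta> + s * \<xi>))"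
    by (intro continuous_intros continuous_on_compose2[OF schwartz_continuous[OF schwartz_d2[OF g]]]) auto
  have "(\<integral>s. indicator {-1..1} s *\<^sub>R (of_real \<xi> * d2 g (\<xi>, \<eta> + s * \<xi>)) \<partial>lborel) =
      g (\<xi>, \<eta> + 1 * \<xi>) - g (\<xi>, \<eta> + (-1) * \<xi>)"
    by (rule integral_FTC_Icc[OF _ D c]) simp
  also have "(\<integral>s. indicator {-1..1} s *\<^sub>R (of_real \<xi> * d2 g (\<xi>, \<eta> + s * \<xi>)) \<partial>lborel) =
      (\<integral>s. of_real \<xi> * d2 g (\<xi>, \<eta> + s * \<xi>) \<partial>restrict_space lborel {-1..1})"
    by (subst integral_restrict_space) auto
  also have "\<dots> = (\<integral>s. of_real (2 * \<xi>) * (of_real (s ^ 0 / 2) * d2 g (\<xi>, \<eta> + s * \<xi>)) \<partial>restrict_space lborel {-1..1})"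
    by (intro Bochner_Integration.integral_cong) auto
  also have "\<dots> = of_real (2 * \<xi>) * avg 0 (d2 g) (\<xi>, \<eta>)"
    unfolding avg_def fst_conv snd_conv by (rule integral_mult_right_zero)
  finally show ?thesis by simp
qed

text \<open>The fundamental theorem of calculus for
  \<open>s *\<^sub>R g (\<xi>, \<eta> + s * \<xi>)\<close>. Combined with the difference of the
  endpoint values it recovers each of them from averages centred at the midpoint.\<close>

lemma avg_sum_quotient:
  assumes g: "schwartz g"
  shows "g (\<xi>, \<eta> + \<xi>) + g (\<xi>, \<eta> - \<xi>) = 2 * avg 0 g (\<xi>, \<eta>) + of_real (2 * \<xi>) * avg 1 (d2 g) (\<xi>, \<eta>)"
proof -
  let ?M = "restrict_space lborel {-1..1::real}"
  let ?F = "\<lambda>s. g (\<xi>, \<eta> + s * \<xi>) + of_real (s * \<xi>) * d2 g (\<xi>, \<eta> + s * \<xi>)"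
  have D: "((\<lambda>s. of_real s * g (\<xi>, \<eta> + s * \<xi>)) has_vector_derivative ?F s) (at s within {-1..1})" for s
  proof -
    have "((\<lambda>s. g (\<xi>, \<eta> + s * \<xi>)) has_derivative
        (\<lambda>h. fst (0::real, h * \<xi>) *\<^sub>R d1 g (\<xi>, \<eta> + s * \<xi>) + snd (0::real, h * \<xi>) *\<^sub>R d2 g (\<xi>, \<eta> + s * \<xi>))) (at s)"
      by (rule has_derivative_compose[OF _ schwartz_has_derivative2[OF g]]) (auto intro!: derivative_eq_intros)
    then have "((\<lambda>s. s *\<^sub>R g (\<xi>, \<eta> + s * \<xi>)) has_derivative
        (\<lambda>h. s *\<^sub>R (fst (0::real, h * \<xi>) *\<^sub>R d1 g (\<xi>, \<eta> + s * \<xi>) + snd (0::real, h * \<xi>) *\<^sub>R d2 g (\<xi>, \<eta> + s * \<xi>))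
          + h *\<^sub>R g (\<xi>, \<eta> + s * \<xi>))) (at s)"
      by (intro has_derivative_scaleR has_derivative_ident)
    then show ?thesis
      by (auto simp: has_vector_derivative_def scaleR_conv_of_real algebra_simps intro: has_derivative_at_withinI)
  qed
  have c: "continuous_on {-1..1} ?F"
    by (intro continuous_intros continuous_on_compose2[OF schwartz_continuous[OF schwartz_d2[OF g]]]
        continuous_on_compose2[OF schwartz_continuous[OF g]]) auto
  have "(\<integral>s. indicator {-1..1} s *\<^sub>R ?F s \<partial>lborel) =
      of_real 1 * g (\<xi>, \<eta> + 1 * \<xi>) - of_real (-1) * g (\<xi>, \<eta> + (-1) * \<xi>)"
    by (rule integral_FTC_Icc[OF _ D c]) simp
  also have "(\<integral>s. indicator {-1..1} s *\<^sub>R ?F s \<partial>lborel) = (\<integral>s. ?F s \<partial>?M)"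
    by (subst integral_restrict_space) auto
  also have "\<dots> = (\<integral>s. 2 * (of_real (s ^ 0 / 2) * g (\<xi>, \<eta> + s * \<xi>)) +
      of_real (2 * \<xi>) * (of_real (s ^ 1 / 2) * d2 g (\<xi>, \<eta> + s * \<xi>)) \<partial>?M)"
    by (intro Bochner_Integration.integral_cong) auto
  also have "\<dots> = (\<integral>s. 2 * (of_real (s ^ 0 / 2) * g (\<xi>, \<eta> + s * \<xi>)) \<partial>?M) +
      (\<integral>s. of_real (2 * \<xi>) * (of_real (s ^ 1 / 2) * d2 g (\<xi>, \<eta> + s * \<xi>)) \<partial>?M)"
    using avg_integrable[OF g, of 0 "(\<xi>, \<eta>)"] avg_integrable[OF schwartz_d2[OF g], of 1 "(\<xi>, \<eta>)"]
    by (intro Bochner_Integration.integral_add integrable_mult_right) simp_all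
  also have "\<dots> = 2 * avg 0 g (\<xi>, \<eta>) + of_real (2 * \<xi>) * avg 1 (d2 g) (\<xi>, \<eta>)"
    unfolding avg_def fst_conv snd_conv by (simp only: integral_mult_right_zero)
  finally show ?thesis by simp
qed

definition seminorm_le :: "nat \<Rightarrow> (real \<times> real \<Rightarrow> complex) \<Rightarrow> real \<Rightarrow> bool" where
  "seminorm_le N g c \<longleftrightarrow> (\<forall>bs\<in>lists Basis. length bs \<le> N \<longrightarrow>
     (\<forall>x. (1 + (norm x)\<^sup>2) ^ N * cmod (iter_pderivative bs g x) \<le> c))"

lemma seminorm_le_mono: 
  assumes "seminorm_le N g c" "M \<le> N"
  shows "seminorm_le M g c"
  unfolding seminorm_le_def
proof (intro ballI impI allI)
  fix bs :: "(real \<times> real) list" and x :: "real \<times> real"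
  assume bs: "bs \<in> lists Basis" "length bs \<le> M"
  have "(1 + (norm x)\<^sup>2) ^ M * cmod (iter_pderivative bs g x) \<le> (1 + (norm x)\<^sup>2) ^ N * cmod (iter_pderivative bs g x)"
    using assms(2) by (intro mult_right_mono power_increasing) auto
  also have "\<dots> \<le> c" using assms bs unfolding seminorm_le_def by (meson le_trans)
  finally show "(1 + (norm x)\<^sup>2) ^ M * cmod (iter_pderivative bs g x) \<le> c" .
qed

lemma seminorm_le_0: "seminorm_le N g c \<Longrightarrow> (1 + (norm x)\<^sup>2) ^ N * cmod (g x) \<le> c"
  unfolding seminorm_le_def by (metis iter_pderivative_simps(1) list.size(3) lists.Nil zero_le)

lemma seminorm_le_nonneg: "seminorm_le N g c \<Longrightarrow> 0 \<le> c"
  using seminorm_le_0[of N g c 0] by (meson norm_ge_zero order_trans mult_nonneg_nonneg zero_le_power add_nonneg_nonneg zero_le_one zero_le_power2)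

lemma seminorm_le_pderivative:
  assumes "seminorm_le (Suc N) g c" "b \<in> Basis"
  shows "seminorm_le N (pderivative b g) c"
  unfolding seminorm_le_def
proof (intro ballI impI allI)
  fix bs :: "(real \<times> real) list" and x :: "real \<times> real"
  assume bs: "bs \<in> lists Basis" "length bs \<le> N"
  have "(1 + (norm x)\<^sup>2) ^ N * cmod (iter_pderivative bs (pderivative b g) x)
      \<le> (1 + (norm x)\<^sup>2) ^ Suc N * cmod (iter_pderivative (bs @ [b]) g x)"
    unfolding iter_pderivative_simps by (intro mult_right_mono power_increasing) auto
  also have "\<dots> \<le> c"
  proof -
    have "bs @ [b] \<in> lists Basis" "length (bs @ [b]) \<le> Suc N" using bs assms(2) by auto
    then show ?thesis using assms(1) unfolding seminorm_le_def by blast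
  qed
  finally show "(1 + (norm x)\<^sup>2) ^ N * cmod (iter_pderivative bs (pderivative b g) x) \<le> c" .
qed

text \<open>\<open>6 ^ N\<close> is \<open>2 ^ N\<close> for the at most two terms that each
  derivative produces, times \<open>3 ^ N\<close> for the loss of weight under shears.\<close>

lemma seminorm_le_avg:
  assumes g: "schwartz g" and c: "seminorm_le N g c"
  shows "seminorm_le N (avg k g) (6 ^ N * c)"
proof -
  have *: "(1 + (norm x)\<^sup>2) ^ N * cmod (iter_pderivative bs (avg k f) x) \<le> 2 ^ length bs * 3 ^ N * c"
    if "bs \<in> lists Basis" "schwartz f"
      "\<And>cs y. cs \<in> lists Basis \<Longrightarrow> length cs \<le> length bs \<Longrightarrow>
         (1 + (norm y)\<^sup>2) ^ N * cmod (iter_pderivative cs f y) \<le> c" for bs f k x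
    using that
  \<comment> \<open>The last direction of the list acts first and is the one that meets the average,
    changing both \<open>f\<close> and \<open>k\<close>.\<close>
  proof (induction bs arbitrary: f k rule: rev_induct)
    case Nil
    then show ?case using avg_decay[OF Nil(2), of N c x k] Nil(3)[of "[]"] by simp
  next
    case (snoc b bs)
    then have bs: "bs \<in> lists Basis" and b: "b = (1, 0) \<or> b = (0, 1)" by (auto simp: Basis_real2)
    have d: "(1 + (norm y)\<^sup>2) ^ N * cmod (iter_pderivative cs (pderivative b' f) y) \<le> c"
      if "cs \<in> lists Basis" "length cs \<le> length bs" "b' \<in> Basis" for cs y b'
      using snoc.prems(3)[of "cs @ [b']" y] that by simp
    have s: "schwartz (d1 f)" "schwartz (d2 f)" using snoc.prems schwartz_d1 schwartz_d2 by auto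
    have 1: "(1 + (norm x)\<^sup>2) ^ N * cmod (iter_pderivative bs (avg k (d1 f)) x) \<le> 2 ^ length bs * 3 ^ N * c" for k
      using d[of _ "(1, 0)"] by (intro snoc.IH bs s) (auto simp: Basis_real2)
    have 2: "(1 + (norm x)\<^sup>2) ^ N * cmod (iter_pderivative bs (avg k (d2 f)) x) \<le> 2 ^ length bs * 3 ^ N * c" for k
      using d[of _ "(0, 1)"] by (intro snoc.IH bs s) (auto simp: Basis_real2)
    have add: "iter_pderivative bs (\<lambda>x. f x + h x) = (\<lambda>x. iter_pderivative bs f x + iter_pderivative bs h x)"
      if "bs \<in> lists Basis" "schwartz f" "schwartz h" for bs f and h :: "real \<times> real \<Rightarrow> complex"
      using that
    proof (induction bs)
      case (Cons b bs)
      then have s: "schwartz (iter_pderivative bs f)" "schwartz (iter_pderivative bs h)" and b: "b \<in> Basis"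
        by (auto intro: schwartz_iter_pderivative)
      have "((\<lambda>x. iter_pderivative bs f x + iter_pderivative bs h x) has_derivative
        (\<lambda>v. \<Sum>b\<in>Basis. (v \<bullet> b) *\<^sub>R (pderivative b (iter_pderivative bs f) x + pderivative b (iter_pderivative bs h) x))) (at x)" for x
        unfolding scaleR_add_right sum.distrib by (intro has_derivative_add schwartz_has_derivative s)
      note D = this
      have IH: "iter_pderivative bs (\<lambda>x. f x + h x) = (\<lambda>x. iter_pderivative bs f x + iter_pderivative bs h x)"
        using Cons by auto
      show ?case
        unfolding iter_pderivative_simps IH by (rule ext) (rule pderivative_eqI[OF D b])
    qed simp
    from b show ?case
    proof
      assume b: "b = (1, 0)"
      have "iter_pderivative (bs @ [b]) (avg k f) x =
          iter_pderivative bs (avg k (d1 f)) x + iter_pderivative bs (avg (Suc k) (d2 f)) x"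
        by (simp add: b pderivative_avg snoc.prems add bs schwartz_avg s)
      then have "(1 + (norm x)\<^sup>2) ^ N * cmod (iter_pderivative (bs @ [b]) (avg k f) x) \<le>
         (1 + (norm x)\<^sup>2) ^ N * (cmod (iter_pderivative bs (avg k (d1 f)) x) + cmod (iter_pderivative bs (avg (Suc k) (d2 f)) x))"
        by (simp only:) (intro mult_left_mono norm_triangle_ineq, simp)
      also have "\<dots> \<le> 2 * (2 ^ length bs * 3 ^ N * c)"
        using 1[of k] 2[of "Suc k"] by (simp add: distrib_left)
      finally show ?thesis by (simp add: mult_ac)
    next
      assume b: "b = (0, 1)"
      have "0 \<le> 2 ^ length bs * 3 ^ N * c"
        by (rule order_trans[OF _ 2[of k]]) simp
      then show ?thesis
        using 2[of k] by (simp add: b pderivative_avg snoc.prems)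
    qed
  qed
  show ?thesis
    unfolding seminorm_le_def
  proof (intro ballI impI allI)
    fix bs :: "(real \<times> real) list" and x :: "real \<times> real"
    assume bs: "bs \<in> lists Basis" "length bs \<le> N"
    have "(1 + (norm x)\<^sup>2) ^ N * cmod (iter_pderivative bs (avg k g) x) \<le> 2 ^ length bs * 3 ^ N * c"
      using c bs unfolding seminorm_le_def by (intro * g bs(1)) (meson le_trans)
    also have "\<dots> \<le> 2 ^ N * 3 ^ N * c"
      using bs(2) seminorm_le_nonneg[OF c] by (intro mult_right_mono power_increasing) auto
    also have "\<dots> = 6 ^ N * c" by (simp flip: power_mult_distrib)
    finally show "(1 + (norm x)\<^sup>2) ^ N * cmod (iter_pderivative bs (avg k g) x) \<le> 6 ^ N * c" .
  qed
qed

text \<open>The operators that turn \<open>g\<close> into the functions replacing it when the kernel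
  is differentiated. Recording them as words in two generators gives seminorm bounds whose order and
  constant are the same for all \<open>g\<close>.\<close>

inductive opr :: "((real \<times> real \<Rightarrow> complex) \<Rightarrow> real \<times> real \<Rightarrow> complex) \<Rightarrow> bool" where
  opr_id: "opr (\<lambda>g. g)"
| opr_pderivative: "opr L \<Longrightarrow> b \<in> Basis \<Longrightarrow> opr (\<lambda>g. pderivative b (L g))"
| opr_avg: "opr L \<Longrightarrow> opr (\<lambda>g. avg k (L g))"

lemma opr_schwartz: "opr L \<Longrightarrow> schwartz g \<Longrightarrow> schwartz (L g)"
  by (induction rule: opr.induct) (auto intro: schwartz_pderivative schwartz_avg)

lemma opr_seminorm_le:
  "opr L \<Longrightarrow> \<exists>N' C. 0 \<le> C \<and> (\<forall>g c. schwartz g \<longrightarrow> seminorm_le N' g c \<longrightarrow> seminorm_le N (L g) (C * c))"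
proof (induction arbitrary: N rule: opr.induct)
  case opr_id
  show ?case by (intro exI[of _ N] exI[of _ 1]) simp
next
  case (opr_pderivative L b)
  then show ?case using seminorm_le_pderivative by metis
next
  case (opr_avg L k)
  from opr_avg.IH[of N] obtain N' C where C: "0 \<le> C"
    "\<And>g c. schwartz g \<Longrightarrow> seminorm_le N' g c \<Longrightarrow> seminorm_le N (L g) (C * c)" by blast
  have "seminorm_le N (avg k (L g)) ((6 ^ N * C) * c)" if "schwartz g" "seminorm_le N' g c" for g c
    using seminorm_le_avg[OF opr_schwartz[OF opr_avg.hyps that(1)] C(2)[OF that]] by (simp add: mult.assoc)
  then show ?case using C(1) by (intro exI[of _ N'] exI[of _ "6 ^ N * C"]) auto
qed

text \<open>Since partials commute, a word of directions can be sorted into the order of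
  \<open>multi_deriv\<close>, and only the two counts matter.\<close>

lemma multi_deriv_iter:
  assumes g: "schwartz g" and "bs \<in> lists Basis"
  shows "iter_pderivative bs g = multi_deriv (count_list bs (1, 0), count_list bs (0, 1)) g"
  using assms(2)
proof (induction bs)
  case Nil
  then show ?case by (simp add: multi_deriv_def)
next
  case (Cons b bs)
  have s2: "schwartz ((d2 ^^ m) g)" for m using g by (induction m) (auto intro: schwartz_d2)
  have s1: "schwartz ((d1 ^^ m) f)" if "schwartz f" for m f using that by (induction m) (auto intro: schwartz_d1)
  have comm: "d2 ((d1 ^^ m) f) = (d1 ^^ m) (d2 f)" if "schwartz f" for m f
    using that
  proof (induction m)
    case (Suc m)
    have "d2 ((d1 ^^ Suc m) f) = d1 (d2 ((d1 ^^ m) f))"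
      using pderivative_commute[OF s1[OF Suc.prems, of m], of "(0, 1)" "(1, 0)"] by (simp add: Basis_real2)
    then show ?case using Suc by simp
  qed simp
  from Cons have "b = (1, 0) \<or> b = (0, 1)" by (auto simp: Basis_real2)
  then show ?case
  proof
    assume "b = (0, 1)"
    then show ?thesis using Cons by (simp add: multi_deriv_def comm[OF s2])
  qed (use Cons in \<open>simp add: multi_deriv_def\<close>)
qed

lemma seminorm_le_schwartz_norm:
  assumes g: "schwartz g"
  shows "seminorm_le N g (schwartz_norm N g)"
  unfolding seminorm_le_def
proof (intro ballI impI allI)
  fix bs :: "(real \<times> real) list" and x :: "real \<times> real"
  assume bs: "bs \<in> lists Basis" "length bs \<le> N"
  let ?\<alpha> = "(count_list bs (1, 0), count_list bs (0, 1))"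
  let ?S = "\<lambda>\<alpha>. SUP x. (1 + (norm x)\<^sup>2) ^ N * cmod (multi_deriv \<alpha> g x)"
  have "length bs = count_list bs (1, 0) + count_list bs (0, 1)"
    using bs(1) by (induction bs) (auto simp: Basis_real2)
  then have mem: "?\<alpha> \<in> {\<alpha>. fst \<alpha> + snd \<alpha> \<le> N}" using bs(2) by simp
  have "finite {\<alpha>::nat \<times> nat. fst \<alpha> + snd \<alpha> \<le> N}"
    by (rule finite_subset[of _ "{..N} \<times> {..N}"]) auto
  then have fin: "finite (?S ` {\<alpha>. fst \<alpha> + snd \<alpha> \<le> N})" by simp
  have "schwartz (multi_deriv ?\<alpha> g)"
    using multi_deriv_iter[OF g bs(1)] schwartz_iter_pderivative[OF g bs(1)] by simp
  then obtain c where "\<And>x. (1 + (norm x)\<^sup>2) ^ N * cmod (multi_deriv ?\<alpha> g x) \<le> c"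
    using schwartz_decay[where N = N] by metis
  then have "bdd_above (range (\<lambda>x. (1 + (norm x)\<^sup>2) ^ N * cmod (multi_deriv ?\<alpha> g x)))"
    by (intro bdd_aboveI2)
  then have "(1 + (norm x)\<^sup>2) ^ N * cmod (multi_deriv ?\<alpha> g x) \<le> ?S ?\<alpha>"
    by (intro cSUP_upper) auto
  also have "\<dots> \<le> schwartz_norm N g"
    unfolding schwartz_norm_def by (rule Max_ge[OF fin]) (use mem in blast)
  finally show "(1 + (norm x)\<^sup>2) ^ N * cmod (iter_pderivative bs g x) \<le> schwartz_norm N g"
    by (simp only: multi_deriv_iter[OF g bs(1)])
qed

section \<open>The kernel of the matrix-valued functions\<close>

definition herm :: "C2 \<Rightarrow> C2 \<Rightarrow> complex" where
  "herm z w = z $ 1 * cnj (w $ 1) + z $ 2 * cnj (w $ 2)"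

text \<open>For \<open>norm \<zeta> = 1\<close> the vector \<open>(uc \<zeta> z, vc \<zeta> z)\<close> is \<open>k\<^sub>\<zeta>\<^sup>-\<^sup>1 z\<close>.\<close>

definition uc :: "C2 \<Rightarrow> C2 \<Rightarrow> complex" where
  "uc \<zeta> z = \<zeta> $ 2 * z $ 1 - \<zeta> $ 1 * z $ 2"

definition vc :: "C2 \<Rightarrow> C2 \<Rightarrow> complex" where
  "vc \<zeta> z = cnj (\<zeta> $ 1) * z $ 1 + cnj (\<zeta> $ 2) * z $ 2"

lemma norm_C2: "(norm (z :: C2))\<^sup>2 = (cmod (z $ 1))\<^sup>2 + (cmod (z $ 2))\<^sup>2"
  by (simp add: norm_vec_def L2_set_def sum_2)

lemma herm_self: "herm z z = of_real ((norm z)\<^sup>2)"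
  by (simp add: herm_def norm_C2 complex_norm_square[symmetric])

lemma of_real_norm_C2: "complex_of_real ((norm (z :: C2))\<^sup>2) = z $ 1 * cnj (z $ 1) + z $ 2 * cnj (z $ 2)"
  using herm_self[of z] by (simp add: herm_def)

text \<open>For fixed \<zeta> the map from \<open>z\<close> to the pair of
  \<open>uc \<zeta> z\<close> and \<open>vc \<zeta> z\<close> is \<open>norm \<zeta>\<close> times a
  unitary one.\<close>

lemma uc_vc: "uc \<zeta> z * cnj (uc \<zeta> w) + vc \<zeta> z * cnj (vc \<zeta> w) = of_real ((norm \<zeta>)\<^sup>2) * herm z w"
  unfolding of_real_norm_C2 by (simp add: uc_def vc_def herm_def algebra_simps)

lemma norm_uc_vc: "(cmod (uc \<zeta> z))\<^sup>2 + (cmod (vc \<zeta> z))\<^sup>2 = (norm \<zeta>)\<^sup>2 * (norm z)\<^sup>2"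
proof -
  have "complex_of_real ((cmod (uc \<zeta> z))\<^sup>2 + (cmod (vc \<zeta> z))\<^sup>2) = of_real ((norm \<zeta>)\<^sup>2 * (norm z)\<^sup>2)"
    using uc_vc[of \<zeta> z z] by (simp add: complex_norm_square herm_self del: of_real_power)
  then show ?thesis by (simp only: of_real_eq_iff)
qed

text \<open>At \<open>\<zeta> = 0\<close> the division gives \<open>0\<close>, and \<open>ker_fun\<close> below then takes the correct value, because
  there \<open>g\<close> is evaluated at the origin for every \<open>j\<close>.\<close>

definition alpha :: "C2 \<Rightarrow> C2 \<Rightarrow> C2 \<Rightarrow> complex" where
  "alpha z w \<zeta> = uc \<zeta> z * cnj (uc \<zeta> w) / of_real ((norm \<zeta>)\<^sup>2)"

lemma herm_minus_alpha:
  assumes "\<zeta> \<noteq> 0"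
  shows "herm z w - alpha z w \<zeta> = vc \<zeta> z * cnj (vc \<zeta> w) / of_real ((norm \<zeta>)\<^sup>2)"
proof -
  have "complex_of_real ((norm \<zeta>)\<^sup>2) \<noteq> 0" using assms by simp
  then show ?thesis
    unfolding alpha_def using uc_vc[of \<zeta> z w] by (simp add: field_simps)
qed

lemma cauchy_schwarz_2:
  fixes a b c d :: real
  assumes "0 \<le> r" "0 \<le> s" "a\<^sup>2 + b\<^sup>2 = r\<^sup>2" "c\<^sup>2 + d\<^sup>2 = s\<^sup>2"
  shows "a * c + b * d \<le> r * s"
proof (rule power2_le_imp_le)
  have "(a * c + b * d)\<^sup>2 \<le> (a\<^sup>2 + b\<^sup>2) * (c\<^sup>2 + d\<^sup>2)"
    using zero_le_power2[of "a * d - b * c"] by (simp add: power2_eq_square algebra_simps)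
  then show "(a * c + b * d)\<^sup>2 \<le> (r * s)\<^sup>2" using assms by (simp add: power_mult_distrib)
qed (use assms in simp)

lemma norm_herm_le: "cmod (herm z w) \<le> norm z * norm w"
proof -
  have "cmod (herm z w) \<le> cmod (z $ 1) * cmod (w $ 1) + cmod (z $ 2) * cmod (w $ 2)"
    unfolding herm_def by (rule order_trans[OF norm_triangle_ineq]) (simp add: norm_mult)
  also have "\<dots> \<le> norm z * norm w"
    by (rule cauchy_schwarz_2) (simp_all add: norm_C2)
  finally show ?thesis .
qed

lemma alpha_0 [simp]: "alpha z w 0 = 0"
  by (simp add: alpha_def)

text \<open>\<open>alpha\<close> and its complement are the contributions to \<open>herm z w\<close>
  of the two orthogonal coordinates in the frame of \<zeta>, so Cauchy-Schwarz in the plane bounds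
  even the sum of their moduli. At \<zeta> = 0 everything sits in the second term.\<close>

lemma norm_alpha_beta: "cmod (alpha z w \<zeta>) + cmod (herm z w - alpha z w \<zeta>) \<le> norm z * norm w"
proof (cases "\<zeta> = 0")
  case False
  have "cmod (uc \<zeta> z) * cmod (uc \<zeta> w) + cmod (vc \<zeta> z) * cmod (vc \<zeta> w) \<le> (norm \<zeta> * norm z) * (norm \<zeta> * norm w)"
    by (rule cauchy_schwarz_2) (simp_all add: norm_uc_vc power_mult_distrib)
  then have "(cmod (uc \<zeta> z) * cmod (uc \<zeta> w) + cmod (vc \<zeta> z) * cmod (vc \<zeta> w)) / (norm \<zeta>)\<^sup>2 \<le> norm z * norm w"
    using False by (simp add: pos_divide_le_eq power2_eq_square mult_ac)
  then show ?thesis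
    unfolding herm_minus_alpha[OF False]
    by (simp add: alpha_def norm_mult norm_divide norm_power add_divide_distrib)
qed (simp add: norm_herm_le)

section \<open>Weighted binomial sums\<close>

definition binom_sum :: "nat \<Rightarrow> (nat \<Rightarrow> complex) \<Rightarrow> complex \<Rightarrow> complex \<Rightarrow> complex" where
  "binom_sum m F a b = (\<Sum>j\<le>m. of_nat (m choose j) * F j * a ^ j * b ^ (m - j))"

text \<open>The effect of differentiating in \<open>a\<close>: absorbing j into the binomial
  coefficient lowers the degree and shifts the sequence \<open>F\<close>.\<close>

lemma binom_sum_shift_up:
  "(\<Sum>j\<le>Suc k. of_nat (Suc k choose j) * F j * (of_nat j * a ^ (j - 1) * b ^ (Suc k - j))) =
     of_nat (Suc k) * binom_sum k (\<lambda>j. F (Suc j)) a b"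
proof -
  have "(\<Sum>j\<le>Suc k. of_nat (Suc k choose j) * F j * (of_nat j * a ^ (j - 1) * b ^ (Suc k - j))) =
    (\<Sum>j\<le>k. of_nat (Suc k choose Suc j) * F (Suc j) * (of_nat (Suc j) * a ^ j * b ^ (k - j)))"
    by (subst sum.atMost_Suc_shift) simp
  also have "\<dots> = (\<Sum>j\<le>k. of_nat (Suc j * (Suc k choose Suc j)) * (F (Suc j) * a ^ j * b ^ (k - j)))"
    by (intro sum.cong refl) (simp only: of_nat_mult mult_ac)
  also have "\<dots> = of_nat (Suc k) * binom_sum k (\<lambda>j. F (Suc j)) a b"
    unfolding Suc_times_binomial binom_sum_def sum_distrib_left
    by (intro sum.cong refl) (simp only: of_nat_mult mult_ac)
  finally show ?thesis .
qed

text \<open>The effect of differentiating in \<open>b\<close>: here the degree drops without a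
  shift. Subtracting this from the previous identity produces the differences
  \<open>F (Suc j) - F j\<close>.\<close>

lemma binom_sum_shift_down:
  "(\<Sum>j\<le>Suc k. of_nat (Suc k choose j) * F j * (a ^ j * (of_nat (Suc k - j) * b ^ (Suc k - j - 1)))) =
     of_nat (Suc k) * binom_sum k F a b"
proof -
  have "(\<Sum>j\<le>Suc k. of_nat (Suc k choose j) * F j * (a ^ j * (of_nat (Suc k - j) * b ^ (Suc k - j - 1)))) =
    (\<Sum>j\<le>k. of_nat ((Suc k - j) * (Suc k choose j)) * (F j * a ^ j * b ^ (k - j)))"
    by (subst sum.atMost_Suc) (simp, intro sum.cong refl, simp add: mult_ac)
  also have "\<dots> = (\<Sum>j\<le>k. of_nat (Suc k * (k choose j)) * (F j * a ^ j * b ^ (k - j)))"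
  proof (intro sum.cong refl)
    fix j assume "j \<in> {..k}"
    then have "(Suc k - j) * (Suc k choose j) = Suc k * (k choose j)"
      by (metis atMost_iff binomial_absorb_comp diff_Suc_1)
    then show "of_nat ((Suc k - j) * (Suc k choose j)) * (F j * a ^ j * b ^ (k - j)) =
      of_nat (Suc k * (k choose j)) * (F j * a ^ j * b ^ (k - j))" by simp
  qed
  also have "\<dots> = of_nat (Suc k) * binom_sum k F a b"
    unfolding binom_sum_def sum_distrib_left
    by (intro sum.cong refl) (simp only: of_nat_mult mult_ac)
  finally show ?thesis .
qed

text \<open>On monomials the weight 2j - (k + 1) is the action of a d/da - b d/db. Such weights
  arise from the chain rule for the second argument of \<open>g\<close>, which is proportional to
  them.\<close>

lemma binom_sum_weighted:
  "(\<Sum>j\<le>Suc k. of_nat (Suc k choose j) * (of_real (2 * real j - real (Suc k)) * F j) * a ^ j * b ^ (Suc k - j)) =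
     of_nat (Suc k) * (a * binom_sum k (\<lambda>j. F (Suc j)) a b - b * binom_sum k F a b)"
proof -
  have "of_nat (Suc k choose j) * (of_real (2 * real j - real (Suc k)) * F j) * a ^ j * b ^ (Suc k - j) =
     a * (of_nat (Suc k choose j) * F j * (of_nat j * a ^ (j - 1) * b ^ (Suc k - j)))
     - b * (of_nat (Suc k choose j) * F j * (a ^ j * (of_nat (Suc k - j) * b ^ (Suc k - j - 1))))"
    if "j \<le> Suc k" for j
  proof -
    have 1: "a * (of_nat j * a ^ (j - 1)) = of_nat j * a ^ j" by (cases j) auto
    have 2: "b * (of_nat (Suc k - j) * b ^ (Suc k - j - 1)) = of_nat (Suc k - j) * b ^ (Suc k - j)"
      by (cases "Suc k - j") auto
    have 3: "complex_of_real (2 * real j - real (Suc k)) = of_nat j - of_nat (Suc k - j)"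
      using that by (simp add: of_nat_diff)
    have "a * (of_nat (Suc k choose j) * F j * (of_nat j * a ^ (j - 1) * b ^ (Suc k - j)))
     - b * (of_nat (Suc k choose j) * F j * (a ^ j * (of_nat (Suc k - j) * b ^ (Suc k - j - 1)))) =
      of_nat (Suc k choose j) * F j * (a * (of_nat j * a ^ (j - 1))) * b ^ (Suc k - j)
     - of_nat (Suc k choose j) * F j * a ^ j * (b * (of_nat (Suc k - j) * b ^ (Suc k - j - 1)))"
      by (simp only: mult_ac)
    also have "\<dots> = of_nat (Suc k choose j) * F j * (of_nat j * a ^ j) * b ^ (Suc k - j)
     - of_nat (Suc k choose j) * F j * a ^ j * (of_nat (Suc k - j) * b ^ (Suc k - j))"
      unfolding 1 2 ..
    finally show ?thesis unfolding 3 by (simp only: algebra_simps)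
  qed
  then have "(\<Sum>j\<le>Suc k. of_nat (Suc k choose j) * (of_real (2 * real j - real (Suc k)) * F j) * a ^ j * b ^ (Suc k - j)) =
    (\<Sum>j\<le>Suc k. a * (of_nat (Suc k choose j) * F j * (of_nat j * a ^ (j - 1) * b ^ (Suc k - j)))
     - b * (of_nat (Suc k choose j) * F j * (a ^ j * (of_nat (Suc k - j) * b ^ (Suc k - j - 1)))))"
    by (intro sum.cong refl) simp
  also have "\<dots> = a * (of_nat (Suc k) * binom_sum k (\<lambda>j. F (Suc j)) a b) - b * (of_nat (Suc k) * binom_sum k F a b)"
    unfolding sum_subtractf sum_distrib_left[symmetric] binom_sum_shift_up binom_sum_shift_down ..
  finally show ?thesis by (simp only: right_diff_distrib mult_ac)
qed

lemma binom_sum_linear: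
  "binom_sum k (\<lambda>j. F j + G j) a b = binom_sum k F a b + binom_sum k G a b"
  "binom_sum k (\<lambda>j. F j - G j) a b = binom_sum k F a b - binom_sum k G a b"
  "binom_sum k (\<lambda>j. c * F j) a b = c * binom_sum k F a b"
  unfolding binom_sum_def
  by (simp_all add: sum.distrib sum_subtractf sum_distrib_left algebra_simps)

text \<open>The weights have total mass \<open>(cmod a + cmod b) ^ m\<close>, which is at most 1;
  this is why a kernel costs no power of the dimension.\<close>

lemma norm_binom_sum_le:
  assumes F: "\<And>j. j \<le> m \<Longrightarrow> cmod (F j) \<le> c" and "cmod a + cmod b \<le> 1"
  shows "cmod (binom_sum m F a b) \<le> c"
proof -
  have c: "0 \<le> c" using F[of 0] norm_ge_zero[of "F 0"] by linarith
  have "cmod (binom_sum m F a b) \<le> (\<Sum>j\<le>m. real (m choose j) * cmod (F j) * cmod a ^ j * cmod b ^ (m - j))"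
    unfolding binom_sum_def by (rule order_trans[OF norm_sum]) (simp add: norm_mult norm_power)
  also have "\<dots> \<le> (\<Sum>j\<le>m. c * (real (m choose j) * cmod a ^ j * cmod b ^ (m - j)))"
  proof (intro sum_mono)
    fix j assume "j \<in> {..m}"
    then show "real (m choose j) * cmod (F j) * cmod a ^ j * cmod b ^ (m - j) \<le> c * (real (m choose j) * cmod a ^ j * cmod b ^ (m - j))"
      using mult_right_mono[OF F[of j], of "real (m choose j) * cmod a ^ j * cmod b ^ (m - j)"] by (simp add: mult_ac)
  qed
  also have "\<dots> = c * (cmod a + cmod b) ^ m"
    by (simp add: binomial_ring sum_distrib_left)
  also have "\<dots> \<le> c * 1" using c assms by (intro mult_left_mono power_le_one) auto
  finally show ?thesis by simp
qed

lemma half_sum_diff: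
  fixes p q :: complex
  assumes "p - q = of_real (2 * x) * R" "p + q = 2 * P + of_real (2 * x) * Q"
  shows "p = P + of_real x * Q + of_real x * R" "q = P + of_real x * Q - of_real x * R"
proof -
  have "2 * p = (p - q) + (p + q)" "2 * q = (p + q) - (p - q)" by simp_all
  then have "2 * p = 2 * (P + of_real x * Q + of_real x * R)" "2 * q = 2 * (P + of_real x * Q - of_real x * R)"
    unfolding assms by (simp_all add: algebra_simps)
  then show "p = P + of_real x * Q + of_real x * R" "q = P + of_real x * Q - of_real x * R"
    by (metis mult_left_cancel zero_neq_numeral)+
qed

text \<open>The kernel of \<open>symbol m f\<close>, as \<open>kern_symbol\<close> shows, but
  written through \<open>alpha\<close>: this removes the choice of a frame and lets the degree
  \<open>m\<close> vary under differentiation.\<close>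

definition ker_fun :: "nat \<Rightarrow> (real \<times> real \<Rightarrow> complex) \<Rightarrow> C2 \<Rightarrow> C2 \<Rightarrow> C2 \<Rightarrow> complex" where
  "ker_fun m f z w \<zeta> = binom_sum m (\<lambda>j. f ((norm \<zeta>)\<^sup>2, (2 * real j - real m) * (norm \<zeta>)\<^sup>2))
     (alpha z w \<zeta>) (herm z w - alpha z w \<zeta>)"

lemma ker_fun_0: "ker_fun m f z w 0 = f 0 * herm z w ^ m"
proof -
  have "ker_fun m f z w 0 = (\<Sum>j\<le>m. if j = 0 then f 0 * herm z w ^ m else 0)"
    unfolding ker_fun_def binom_sum_def by (intro sum.cong refl) (auto simp: zero_prod_def power_0_left)
  then show ?thesis by simp
qed

lemma ker_fun_decay:
  assumes f: "seminorm_le N f c" and "norm z \<le> 1" "norm w \<le> 1"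
  shows "(1 + (norm \<zeta>)\<^sup>2) ^ N * cmod (ker_fun m f z w \<zeta>) \<le> 2 ^ N * c"
proof -
  let ?w = "inverse ((1 + (norm \<zeta>)\<^sup>2) ^ N)"
  have "cmod (ker_fun m f z w \<zeta>) \<le> 2 ^ N * c * ?w"
    unfolding ker_fun_def
  proof (rule norm_binom_sum_le)
    have "norm z * norm w \<le> 1 * 1" using assms by (intro mult_mono) auto
    then show "cmod (alpha z w \<zeta>) + cmod (herm z w - alpha z w \<zeta>) \<le> 1"
      using norm_alpha_beta[of z w \<zeta>] by linarith
    fix j
    let ?x = "((norm \<zeta>)\<^sup>2, (2 * real j - real m) * (norm \<zeta>)\<^sup>2)"
    \<comment> \<open>The first argument of \<open>f\<close> is t = |\<zeta>|^2, so decay of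
      \<open>f\<close> is decay in t^2, and 1 + t \<le> 2 (1 + t^2) suffices.\<close>
    have "(1 + (norm \<zeta>)\<^sup>2) \<le> 2 * (1 + (norm ?x)\<^sup>2)"
    proof -
      have 1: "((norm \<zeta>)\<^sup>2)\<^sup>2 \<le> (norm ?x)\<^sup>2" by (simp add: norm_Pair)
      have 2: "2 * (norm \<zeta>)\<^sup>2 \<le> 1 + ((norm \<zeta>)\<^sup>2)\<^sup>2"
        using zero_le_power2[of "(norm \<zeta>)\<^sup>2 - 1"] unfolding power2_diff by simp
      have "1 + a \<le> 2 * (1 + b)" if "2 * a \<le> 1 + c" "c \<le> b" "0 \<le> b" for a b c :: real
        using that by (simp add: field_simps)
      from this[OF 2 1 zero_le_power2] show ?thesis .
    qed
    then have "(1 + (norm \<zeta>)\<^sup>2) ^ N \<le> (2 * (1 + (norm ?x)\<^sup>2)) ^ N" by (intro power_mono) auto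
    then have "(1 + (norm \<zeta>)\<^sup>2) ^ N * cmod (f ?x) \<le> 2 ^ N * ((1 + (norm ?x)\<^sup>2) ^ N * cmod (f ?x))"
      unfolding power_mult_distrib mult.assoc[symmetric] by (rule mult_right_mono) simp
    also have "\<dots> \<le> 2 ^ N * c" using seminorm_le_0[OF f] by (intro mult_left_mono) auto
    finally show "cmod (f ?x) \<le> 2 ^ N * c * ?w" unfolding le_weight_iff .
  qed
  then show ?thesis unfolding le_weight_iff .
qed

section \<open>Differentiating the kernel in \<zeta>\<close>

lemma norm_sq_has_derivative:
  "((\<lambda>\<zeta>. (norm \<zeta>)\<^sup>2) has_derivative (\<lambda>h. 2 * (\<zeta> \<bullet> h))) (at (\<zeta> :: 'a :: real_inner))"
  unfolding power2_norm_eq_inner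
  by (auto intro!: derivative_eq_intros simp: inner_commute)

definition duu :: "C2 \<Rightarrow> C2 \<Rightarrow> C2 \<Rightarrow> C2 \<Rightarrow> complex" where
  "duu z w \<zeta> h = uc h z * cnj (uc \<zeta> w) + uc \<zeta> z * cnj (uc h w)"

lemma uu_has_derivative: "((\<lambda>\<zeta>. uc \<zeta> z * cnj (uc \<zeta> w)) has_derivative duu z w \<zeta>) (at \<zeta>)"
  unfolding uc_def duu_def[abs_def]
  by (auto intro!: derivative_eq_intros bounded_linear.has_derivative[OF bounded_linear_vec_nth]
      bounded_linear.has_derivative[OF bounded_linear_cnj] simp: fun_eq_iff algebra_simps)

lemma radial_has_derivative:
  assumes f: "schwartz f"
  shows "((\<lambda>\<zeta>::C2. f ((norm \<zeta>)\<^sup>2, c * (norm \<zeta>)\<^sup>2)) has_derivative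
    (\<lambda>h. of_real (2 * (\<zeta> \<bullet> h)) * (d1 f ((norm \<zeta>)\<^sup>2, c * (norm \<zeta>)\<^sup>2) +
        of_real c * d2 f ((norm \<zeta>)\<^sup>2, c * (norm \<zeta>)\<^sup>2)))) (at \<zeta>)"
proof -
  have "((\<lambda>\<zeta>::C2. ((norm \<zeta>)\<^sup>2, c * (norm \<zeta>)\<^sup>2)) has_derivative (\<lambda>h. (2 * (\<zeta> \<bullet> h), c * (2 * (\<zeta> \<bullet> h))))) (at \<zeta>)"
    by (intro has_derivative_Pair has_derivative_mult_right norm_sq_has_derivative)
  from has_derivative_compose[OF this schwartz_has_derivative2[OF f]] show ?thesis
    by (simp add: scaleR_conv_of_real algebra_simps)
qed

text \<open>All contributions of the singular factor \<open>alpha\<close> recombine into the polynomial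
  \<open>2 * uc \<zeta> z * cnj (uc \<zeta> w) - norm \<zeta>\<^sup>2 * herm z w\<close> and its derivative.\<close>

definition ker_deriv :: "nat \<Rightarrow> (real \<times> real \<Rightarrow> complex) \<Rightarrow> C2 \<Rightarrow> C2 \<Rightarrow> C2 \<Rightarrow> C2 \<Rightarrow> complex" where
  "ker_deriv m f z w \<zeta> h =
     of_real (2 * (\<zeta> \<bullet> h)) * ker_fun m (d1 f) z w \<zeta> +
     of_nat m * (
       of_real (2 * (\<zeta> \<bullet> h)) * of_real ((norm \<zeta>)\<^sup>2) * herm z w * ker_fun (m - 1) (avg 0 (d2 (d2 f))) z w \<zeta> +
       of_real (2 * (\<zeta> \<bullet> h)) * (2 * (uc \<zeta> z * cnj (uc \<zeta> w)) - of_real ((norm \<zeta>)\<^sup>2) * herm z w) *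
         ker_fun (m - 1) (avg 1 (d2 (d2 f))) z w \<zeta> +
       (2 * duu z w \<zeta> h - of_real (2 * (\<zeta> \<bullet> h)) * herm z w) * ker_fun (m - 1) (avg 0 (d2 f)) z w \<zeta>)"

text \<open>The derivative falls on \<open>f\<close> (\<open>t1\<close>) or on \<open>alpha\<close>
  (\<open>t2\<close>). In \<open>t2\<close> consecutive values of \<open>f\<close> are subtracted,
  and the resulting factor \<open>2 * ?X\<close> clears the pole of \<open>\<delta>\<close>. In
  \<open>t1\<close> the weights yield \<open>?al\<close> times upper values minus \<open>?be\<close>
  times lower values. The terms in \<open>?P\<close> with bare \<open>?al\<close> and
  \<open>?be\<close> combine to their sum \<open>herm z w\<close>; elsewhere \<open>?al\<close>
  occurs only multiplied by \<open>?X\<close>, where it is polynomial.\<close>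

lemma ker_fun_has_derivative_nonzero:
  assumes f: "schwartz f" and \<zeta>: "\<zeta> \<noteq> 0"
  shows "(ker_fun m f z w has_derivative ker_deriv m f z w \<zeta>) (at \<zeta>)"
proof -
  let ?x = "\<lambda>\<zeta>::C2. (norm \<zeta>)\<^sup>2" and ?s = "herm z w"
  let ?a = "alpha z w" and ?b = "\<lambda>\<zeta>. herm z w - alpha z w \<zeta>"
  let ?A = "uc \<zeta> z * cnj (uc \<zeta> w)"
  let ?F = "\<lambda>f m j. f (?x \<zeta>, (2 * real j - real m) * ?x \<zeta>)"
  have x0: "complex_of_real (?x \<zeta>) \<noteq> 0" using \<zeta> by simp
  \<comment> \<open>The derivative of \<open>alpha\<close>, with its pole at the origin; the
    complement contributes the negative, as \<open>herm z w\<close> does not depend on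
    \<zeta>.\<close>
  define \<delta> where "\<delta> h = duu z w \<zeta> h / of_real (?x \<zeta>) - ?A * of_real (2 * (\<zeta> \<bullet> h)) / (of_real (?x \<zeta>))\<^sup>2" for h
  have a: "(?a has_derivative \<delta>) (at \<zeta>)"
  proof -
    have "((\<lambda>\<zeta>. uc \<zeta> z * cnj (uc \<zeta> w) / of_real (?x \<zeta>)) has_derivative
      (\<lambda>h. (duu z w \<zeta> h * of_real (?x \<zeta>) - ?A * of_real (2 * (\<zeta> \<bullet> h))) / (of_real (?x \<zeta>) * of_real (?x \<zeta>)))) (at \<zeta>)"
      by (intro has_derivative_divide' uu_has_derivative has_derivative_of_real norm_sq_has_derivative x0)
    moreover have "(p * X - q) / (X * X) = p / X - q / X\<^sup>2" if "X \<noteq> 0" for p q X :: complex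
      using that by (simp add: field_simps power2_eq_square)
    ultimately show ?thesis
      unfolding alpha_def[abs_def] \<delta>_def[abs_def] using x0 by (simp only: not_False_eq_True)
  qed
  have b: "(?b has_derivative (\<lambda>h. - \<delta> h)) (at \<zeta>)"
    by (auto intro!: derivative_eq_intros a)
  define F' where "F' j h = of_real (2 * (\<zeta> \<bullet> h)) * (?F (d1 f) m j + of_real (2 * real j - real m) * ?F (d2 f) m j)" for j h
  have "(ker_fun m f z w has_derivative (\<lambda>h. \<Sum>j\<le>m. of_nat (m choose j) *
      (F' j h * (?a \<zeta> ^ j * ?b \<zeta> ^ (m - j)) +
       ?F f m j * (of_nat j * ?a \<zeta> ^ (j - 1) * \<delta> h * ?b \<zeta> ^ (m - j) +
          ?a \<zeta> ^ j * (of_nat (m - j) * ?b \<zeta> ^ (m - j - 1) * (- \<delta> h)))))) (at \<zeta>)"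
  proof -
    have "((\<lambda>\<zeta>. \<Sum>j\<le>m. of_nat (m choose j) * (f (?x \<zeta>, (2 * real j - real m) * ?x \<zeta>) * (?a \<zeta> ^ j * ?b \<zeta> ^ (m - j))))
      has_derivative (\<lambda>h. \<Sum>j\<le>m. of_nat (m choose j) *
      (F' j h * (?a \<zeta> ^ j * ?b \<zeta> ^ (m - j)) +
       ?F f m j * (of_nat j * ?a \<zeta> ^ (j - 1) * \<delta> h * ?b \<zeta> ^ (m - j) +
          ?a \<zeta> ^ j * (of_nat (m - j) * ?b \<zeta> ^ (m - j - 1) * (- \<delta> h)))))) (at \<zeta>)"
    proof (intro has_derivative_sum has_derivative_mult_right)
      fix j
      have 1: "((\<lambda>\<zeta>. f (?x \<zeta>, (2 * real j - real m) * ?x \<zeta>)) has_derivative F' j) (at \<zeta>)"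
        unfolding F'_def by (rule radial_has_derivative[OF f])
      have 2: "((\<lambda>\<zeta>. ?a \<zeta> ^ j * ?b \<zeta> ^ (m - j)) has_derivative (\<lambda>h. of_nat j * ?a \<zeta> ^ (j - 1) * \<delta> h * ?b \<zeta> ^ (m - j) +
          ?a \<zeta> ^ j * (of_nat (m - j) * ?b \<zeta> ^ (m - j - 1) * (- \<delta> h)))) (at \<zeta>)"
        by (rule has_derivative_eq_rhs[OF has_derivative_mult[OF has_derivative_power[OF a] has_derivative_power[OF b]]])
          (simp add: fun_eq_iff mult_ac)
      show "((\<lambda>\<zeta>. f (?x \<zeta>, (2 * real j - real m) * ?x \<zeta>) * (?a \<zeta> ^ j * ?b \<zeta> ^ (m - j))) has_derivative
        (\<lambda>h. F' j h * (?a \<zeta> ^ j * ?b \<zeta> ^ (m - j)) +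
         ?F f m j * (of_nat j * ?a \<zeta> ^ (j - 1) * \<delta> h * ?b \<zeta> ^ (m - j) +
          ?a \<zeta> ^ j * (of_nat (m - j) * ?b \<zeta> ^ (m - j - 1) * (- \<delta> h))))) (at \<zeta>)"
        by (rule has_derivative_eq_rhs[OF has_derivative_mult[OF 1 2]]) (simp add: fun_eq_iff add.commute)
    qed
    then show ?thesis by (simp only: ker_fun_def[abs_def] binom_sum_def mult.assoc)
  qed
  moreover have "(\<Sum>j\<le>m. of_nat (m choose j) *
      (F' j h * (?a \<zeta> ^ j * ?b \<zeta> ^ (m - j)) +
       ?F f m j * (of_nat j * ?a \<zeta> ^ (j - 1) * \<delta> h * ?b \<zeta> ^ (m - j) +
          ?a \<zeta> ^ j * (of_nat (m - j) * ?b \<zeta> ^ (m - j - 1) * (- \<delta> h))))) = ker_deriv m f z w \<zeta> h" for h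
  proof (cases m)
    case 0
    then show ?thesis by (simp add: ker_deriv_def F'_def ker_fun_def binom_sum_def)
  next
    case (Suc k)
    let ?xh = "complex_of_real (2 * (\<zeta> \<bullet> h))" and ?X = "complex_of_real (?x \<zeta>)"
    let ?P = "ker_fun k (avg 0 (d2 f)) z w \<zeta>" and ?Q = "ker_fun k (avg 1 (d2 (d2 f))) z w \<zeta>"
      and ?R = "ker_fun k (avg 0 (d2 (d2 f))) z w \<zeta>"
    let ?al = "?a \<zeta>" and ?be = "?b \<zeta>"
    \<comment> \<open>Lowering the degree recentres the nodes: those of index j + 1 and j in degree
      k + 1 lie symmetrically about node j of degree k, so averages at one centre serve
      both.\<close>
    have arg: "(2 * real (Suc j) - real (Suc k)) * ?x \<zeta> = (2 * real j - real k) * ?x \<zeta> + ?x \<zeta>"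
      "(2 * real j - real (Suc k)) * ?x \<zeta> = (2 * real j - real k) * ?x \<zeta> - ?x \<zeta>" for j
      by (simp_all add: algebra_simps)
    have up: "binom_sum k (\<lambda>j. ?F g (Suc k) (Suc j)) ?al ?be =
        ker_fun k (avg 0 g) z w \<zeta> + ?X * ker_fun k (avg 1 (d2 g)) z w \<zeta> + ?X * ker_fun k (avg 0 (d2 g)) z w \<zeta>"
      if g: "schwartz g" for g
    proof -
      have "?F g (Suc k) (Suc j) = ?F (avg 0 g) k j + ?X * ?F (avg 1 (d2 g)) k j + ?X * ?F (avg 0 (d2 g)) k j" for j
        unfolding arg(1) by (rule half_sum_diff(1)[OF avg_diff_quotient[OF g] avg_sum_quotient[OF g]])
      then show ?thesis by (simp only: ker_fun_def binom_sum_linear)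
    qed
    have down: "binom_sum k (\<lambda>j. ?F g (Suc k) j) ?al ?be =
        ker_fun k (avg 0 g) z w \<zeta> + ?X * ker_fun k (avg 1 (d2 g)) z w \<zeta> - ?X * ker_fun k (avg 0 (d2 g)) z w \<zeta>"
      if g: "schwartz g" for g
    proof -
      have "?F g (Suc k) j = ?F (avg 0 g) k j + ?X * ?F (avg 1 (d2 g)) k j - ?X * ?F (avg 0 (d2 g)) k j" for j
        unfolding arg(2) by (rule half_sum_diff(2)[OF avg_diff_quotient[OF g] avg_sum_quotient[OF g]])
      then show ?thesis by (simp only: ker_fun_def binom_sum_linear)
    qed
    have t1: "(\<Sum>j\<le>m. of_nat (m choose j) * (F' j h * (?al ^ j * ?be ^ (m - j)))) =
       ?xh * ker_fun m (d1 f) z w \<zeta> +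
       ?xh * (of_nat (Suc k) * (?al * (?P + ?X * ?Q + ?X * ?R) - ?be * (?P + ?X * ?Q - ?X * ?R)))"
    proof -
      have "(\<Sum>j\<le>m. of_nat (m choose j) * (F' j h * (?al ^ j * ?be ^ (m - j)))) =
        ?xh * binom_sum m (?F (d1 f) m) ?al ?be +
        ?xh * (\<Sum>j\<le>m. of_nat (m choose j) * (of_real (2 * real j - real m) * ?F (d2 f) m j) * ?al ^ j * ?be ^ (m - j))"
        unfolding F'_def binom_sum_def sum_distrib_left sum.distrib[symmetric]
        by (intro sum.cong refl) (simp only: ring_distribs mult_ac)
      also have "(\<Sum>j\<le>m. of_nat (m choose j) * (of_real (2 * real j - real m) * ?F (d2 f) m j) * ?al ^ j * ?be ^ (m - j)) =
         of_nat (Suc k) * (?al * (?P + ?X * ?Q + ?X * ?R) - ?be * (?P + ?X * ?Q - ?X * ?R))"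
        unfolding Suc binom_sum_weighted up[OF schwartz_d2[OF f]] down[OF schwartz_d2[OF f]] ..
      finally show ?thesis by (simp only: ker_fun_def)
    qed
    have t2: "(\<Sum>j\<le>m. of_nat (m choose j) * (?F f m j * (of_nat j * ?al ^ (j - 1) * \<delta> h * ?be ^ (m - j) +
          ?al ^ j * (of_nat (m - j) * ?be ^ (m - j - 1) * (- \<delta> h))))) = \<delta> h * (of_nat (Suc k) * (2 * ?X * ?P))"
    proof -
      have "(\<Sum>j\<le>m. of_nat (m choose j) * (?F f m j * (of_nat j * ?al ^ (j - 1) * \<delta> h * ?be ^ (m - j) +
          ?al ^ j * (of_nat (m - j) * ?be ^ (m - j - 1) * (- \<delta> h))))) =
        \<delta> h * ((\<Sum>j\<le>m. of_nat (m choose j) * ?F f m j * (of_nat j * ?al ^ (j - 1) * ?be ^ (m - j))) -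
          (\<Sum>j\<le>m. of_nat (m choose j) * ?F f m j * (?al ^ j * (of_nat (m - j) * ?be ^ (m - j - 1)))))"
        unfolding sum_subtractf[symmetric] sum_distrib_left
        by (intro sum.cong refl) (simp add: algebra_simps)
      also have "\<dots> = \<delta> h * (of_nat (Suc k) * binom_sum k (\<lambda>j. ?F f (Suc k) (Suc j) - ?F f (Suc k) j) ?al ?be)"
        unfolding Suc binom_sum_shift_up binom_sum_shift_down binom_sum_linear
        by (simp only: right_diff_distrib)
      also have "(\<lambda>j. ?F f (Suc k) (Suc j) - ?F f (Suc k) j) = (\<lambda>j. (2 * ?X) * ?F (avg 0 (d2 f)) k j)"
        unfolding arg(1) unfolding arg(2) by (simp add: avg_diff_quotient[OF f])
      finally show ?thesis by (simp only: ker_fun_def binom_sum_linear)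
    qed
    have al: "?X * ?al = ?A" unfolding alpha_def using x0 by simp
    have d: "2 * ?X * \<delta> h = 2 * duu z w \<zeta> h - 2 * ?al * ?xh"
      unfolding \<delta>_def alpha_def using x0 by (simp add: field_simps power2_eq_square)
    have "(\<Sum>j\<le>m. of_nat (m choose j) *
      (F' j h * (?al ^ j * ?be ^ (m - j)) +
       ?F f m j * (of_nat j * ?al ^ (j - 1) * \<delta> h * ?be ^ (m - j) +
          ?al ^ j * (of_nat (m - j) * ?be ^ (m - j - 1) * (- \<delta> h))))) =
       ?xh * ker_fun m (d1 f) z w \<zeta> + of_nat (Suc k) * (
       ?xh * (?al * (?P + ?X * ?Q + ?X * ?R) - ?be * (?P + ?X * ?Q - ?X * ?R)) + (2 * ?X * \<delta> h) * ?P)"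
      unfolding distrib_left[of "of_nat (m choose _)"] sum.distrib t1 t2
      by (simp only: ring_distribs mult_ac add_ac)
    also have "?xh * (?al * (?P + ?X * ?Q + ?X * ?R) - ?be * (?P + ?X * ?Q - ?X * ?R)) + (2 * ?X * \<delta> h) * ?P =
       ?xh * ?X * ?s * ?R + ?xh * (2 * ?A - ?X * ?s) * ?Q + (2 * duu z w \<zeta> h - ?xh * ?s) * ?P"
      unfolding d al[symmetric] by (simp only: algebra_simps) (simp add: algebra_simps)
    finally show ?thesis unfolding ker_deriv_def Suc by simp
  qed
  ultimately show ?thesis by (simp only: ext)
qed

lemma ker_fun_has_derivative_0:
  assumes f: "schwartz f"
  shows "(ker_fun m f z w has_derivative (\<lambda>_. 0)) (at 0)"
proof -
  let ?g = "\<lambda>j (\<zeta>::C2). f ((norm \<zeta>)\<^sup>2, (2 * real j - real m) * (norm \<zeta>)\<^sup>2)"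
  have lim: "((\<lambda>\<zeta>. cmod (?g j \<zeta> - f 0) / norm \<zeta>) \<longlongrightarrow> 0) (at 0)" for j
    using radial_has_derivative[OF f, of "2 * real j - real m" 0]
    unfolding has_derivative_iff_norm by (simp add: zero_prod_def)
  have le: "cmod (ker_fun m f z w \<zeta> - ker_fun m f z w 0) \<le>
     (\<Sum>j\<le>m. (real (m choose j) * (norm z * norm w) ^ m) * cmod (?g j \<zeta> - f 0))" for \<zeta>
  proof -
    have "binom_sum m (\<lambda>_. 1) (alpha z w \<zeta>) (herm z w - alpha z w \<zeta>) = herm z w ^ m"
      using binomial_ring[of "alpha z w \<zeta>" "herm z w - alpha z w \<zeta>" m] by (simp add: binom_sum_def)
    then have E: "ker_fun m f z w 0 = binom_sum m (\<lambda>_. f 0) (alpha z w \<zeta>) (herm z w - alpha z w \<zeta>)"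
      unfolding ker_fun_0 using binom_sum_linear(3)[of m "f 0" "\<lambda>_. 1"] by simp
    have "ker_fun m f z w \<zeta> - ker_fun m f z w 0 =
        binom_sum m (\<lambda>j. ?g j \<zeta> - f 0) (alpha z w \<zeta>) (herm z w - alpha z w \<zeta>)"
      by (simp only: E binom_sum_linear) (simp only: ker_fun_def)
    also have "cmod \<dots> \<le> (\<Sum>j\<le>m. (real (m choose j) * (norm z * norm w) ^ m) * cmod (?g j \<zeta> - f 0))"
      unfolding binom_sum_def
    proof (rule sum_norm_le)
      fix j assume j: "j \<in> {..m}"
      have M: "cmod (alpha z w \<zeta>) \<le> norm z * norm w" "cmod (herm z w - alpha z w \<zeta>) \<le> norm z * norm w"
        using norm_alpha_beta[of z w \<zeta>] norm_ge_zero[of "alpha z w \<zeta>"] norm_ge_zero[of "herm z w - alpha z w \<zeta>"]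
        by linarith+
      have "cmod (alpha z w \<zeta>) ^ j * cmod (herm z w - alpha z w \<zeta>) ^ (m - j) \<le>
         (norm z * norm w) ^ j * (norm z * norm w) ^ (m - j)"
        by (intro mult_mono power_mono M) auto
      also have "\<dots> = (norm z * norm w) ^ m" using j by (simp flip: power_add)
      finally have "(real (m choose j) * cmod (?g j \<zeta> - f 0)) *
          (cmod (alpha z w \<zeta>) ^ j * cmod (herm z w - alpha z w \<zeta>) ^ (m - j)) \<le>
          (real (m choose j) * cmod (?g j \<zeta> - f 0)) * (norm z * norm w) ^ m"
        by (intro mult_left_mono) auto
      then show "cmod (of_nat (m choose j) * (?g j \<zeta> - f 0) * alpha z w \<zeta> ^ j * (herm z w - alpha z w \<zeta>) ^ (m - j)) \<le>
          (real (m choose j) * (norm z * norm w) ^ m) * cmod (?g j \<zeta> - f 0)"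
        by (simp add: norm_mult norm_power mult_ac)
    qed
    finally show ?thesis .
  qed
  show ?thesis
    unfolding has_derivative_iff_norm
  proof
    have "((\<lambda>\<zeta>. \<Sum>j\<le>m. (real (m choose j) * (norm z * norm w) ^ m) * (cmod (?g j \<zeta> - f 0) / norm \<zeta>)) \<longlongrightarrow> 0) (at 0)"
      by (intro tendsto_null_sum tendsto_mult_right_zero lim)
    then show "((\<lambda>y. norm (ker_fun m f z w y - ker_fun m f z w 0 - 0) / norm (y - 0)) \<longlongrightarrow> 0) (at 0)"
    proof (rule real_tendsto_sandwich[OF _ _ tendsto_const, rotated 2])
      show "\<forall>\<^sub>F \<zeta> in at 0. norm (ker_fun m f z w \<zeta> - ker_fun m f z w 0 - 0) / norm (\<zeta> - 0) \<le>
        (\<Sum>j\<le>m. (real (m choose j) * (norm z * norm w) ^ m) * (cmod (?g j \<zeta> - f 0) / norm \<zeta>))"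
        using le by (intro always_eventually allI)
          (simp add: divide_right_mono sum_divide_distrib[symmetric])
    qed simp
  qed simp
qed

lemma ker_fun_has_derivative:
  assumes f: "schwartz f"
  shows "(ker_fun m f z w has_derivative ker_deriv m f z w \<zeta>) (at \<zeta>)"
proof (cases "\<zeta> = 0")
  case True
  have "ker_deriv m f z w 0 = (\<lambda>_. 0)"
    by (simp add: ker_deriv_def fun_eq_iff duu_def uc_def)
  then show ?thesis using ker_fun_has_derivative_0[OF f] True by simp
qed (rule ker_fun_has_derivative_nonzero[OF f])

section \<open>A class of functions closed under differentiation\<close>

text \<open>Polynomials in the real coordinates of \<zeta>. Their coefficients are only asked to be
  bounded for z and w in the unit ball: differentiation is in \<zeta> alone, and the estimates are
  uniform over that ball.\<close>

inductive poly3 :: "(C2 \<Rightarrow> C2 \<Rightarrow> C2 \<Rightarrow> complex) \<Rightarrow> bool" where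
  poly3_const: "(\<And>z w. norm z \<le> 1 \<Longrightarrow> norm w \<le> 1 \<Longrightarrow> cmod (c z w) \<le> B) \<Longrightarrow> poly3 (\<lambda>z w \<zeta>. c z w)"
| poly3_coord: "poly3 (\<lambda>z w \<zeta>. of_real (\<zeta> \<bullet> b))"
| poly3_add: "poly3 p \<Longrightarrow> poly3 q \<Longrightarrow> poly3 (\<lambda>z w \<zeta>. p z w \<zeta> + q z w \<zeta>)"
| poly3_mult: "poly3 p \<Longrightarrow> poly3 q \<Longrightarrow> poly3 (\<lambda>z w \<zeta>. p z w \<zeta> * q z w \<zeta>)"

lemma poly3_complex: "poly3 (\<lambda>z w \<zeta>. c)"
  by (rule poly3_const[of _ "cmod c"]) simp

lemma poly3_has_derivative:
  "poly3 q \<Longrightarrow> \<exists>q'. (\<forall>b. poly3 (q' b)) \<and>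
     (\<forall>z w \<zeta>. (q z w has_derivative (\<lambda>h. \<Sum>b\<in>Basis. (h \<bullet> b) *\<^sub>R q' b z w \<zeta>)) (at \<zeta>))"
proof (induction rule: poly3.induct)
  case (poly3_const c B)
  then show ?case using poly3_complex[of 0] by (intro exI[of _ "\<lambda>_ _ _ _. 0"]) simp
next
  case (poly3_coord c)
  have "((\<lambda>\<zeta>::C2. complex_of_real (\<zeta> \<bullet> c)) has_derivative (\<lambda>h. \<Sum>b\<in>Basis. (h \<bullet> b) *\<^sub>R of_real (b \<bullet> c))) (at \<zeta>)" for \<zeta>
  proof -
    have D: "((\<lambda>\<zeta>::C2. complex_of_real (\<zeta> \<bullet> c)) has_derivative (\<lambda>h. of_real (h \<bullet> c))) (at \<zeta>)"
      by (intro has_derivative_of_real has_derivative_inner_left has_derivative_ident)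
    have "complex_of_real (h \<bullet> c) = (\<Sum>b\<in>Basis. (h \<bullet> b) *\<^sub>R of_real (b \<bullet> c))" for h :: C2
    proof -
      have "h \<bullet> c = (\<Sum>b\<in>Basis. (h \<bullet> b) * (c \<bullet> b))" by (rule euclidean_inner)
      then show ?thesis by (simp only: of_real_sum of_real_mult scaleR_conv_of_real inner_commute[of _ c])
    qed
    then show ?thesis by (intro has_derivative_eq_rhs[OF D] ext)
  qed
  moreover have "poly3 (\<lambda>z w \<zeta>. of_real (b \<bullet> c))" for b by (rule poly3_complex)
  ultimately show ?case
    by (intro exI[of _ "\<lambda>b z w \<zeta>. of_real (b \<bullet> c)"]) blast
next
  case (poly3_add p q)
  from poly3_add.IH(1) obtain p' where p'':
      "\<forall>b. poly3 (p' b)" "\<forall>z w \<zeta>. (p z w has_derivative (\<lambda>h. \<Sum>b\<in>Basis. (h \<bullet> b) *\<^sub>R p' b z w \<zeta>)) (at \<zeta>)"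
    by blast
  from poly3_add.IH(2) obtain q' where q'':
      "\<forall>b. poly3 (q' b)" "\<forall>z w \<zeta>. (q z w has_derivative (\<lambda>h. \<Sum>b\<in>Basis. (h \<bullet> b) *\<^sub>R q' b z w \<zeta>)) (at \<zeta>)"
    by blast
  note p' = p''[rule_format] and q' = q''[rule_format]
  have "((\<lambda>\<zeta>. p z w \<zeta> + q z w \<zeta>) has_derivative
      (\<lambda>h. \<Sum>b\<in>Basis. (h \<bullet> b) *\<^sub>R (p' b z w \<zeta> + q' b z w \<zeta>))) (at \<zeta>)" for z w \<zeta>
    using has_derivative_add[OF p'(2) q'(2)] by (simp add: scaleR_add_right sum.distrib)
  then show ?case
    by (intro exI[of _ "\<lambda>b z w \<zeta>. p' b z w \<zeta> + q' b z w \<zeta>"]) (auto intro: poly3.poly3_add p' q')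
next
  case (poly3_mult p q)
  from poly3_mult.IH(1) obtain p' where p'':
      "\<forall>b. poly3 (p' b)" "\<forall>z w \<zeta>. (p z w has_derivative (\<lambda>h. \<Sum>b\<in>Basis. (h \<bullet> b) *\<^sub>R p' b z w \<zeta>)) (at \<zeta>)"
    by blast
  from poly3_mult.IH(2) obtain q' where q'':
      "\<forall>b. poly3 (q' b)" "\<forall>z w \<zeta>. (q z w has_derivative (\<lambda>h. \<Sum>b\<in>Basis. (h \<bullet> b) *\<^sub>R q' b z w \<zeta>)) (at \<zeta>)"
    by blast
  note p' = p''[rule_format] and q' = q''[rule_format]
  have "((\<lambda>\<zeta>. p z w \<zeta> * q z w \<zeta>) has_derivative
      (\<lambda>h. \<Sum>b\<in>Basis. (h \<bullet> b) *\<^sub>R (p z w \<zeta> * q' b z w \<zeta> + p' b z w \<zeta> * q z w \<zeta>))) (at \<zeta>)" for z w \<zeta>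
    using has_derivative_mult[OF p'(2) q'(2)]
    by (simp add: scaleR_add_right sum.distrib sum_distrib_left sum_distrib_right)
  moreover have "poly3 (\<lambda>z w \<zeta>. p z w \<zeta> * q' b z w \<zeta> + p' b z w \<zeta> * q z w \<zeta>)" for b
    by (intro poly3.poly3_add poly3.poly3_mult p' q' poly3_mult.hyps)
  ultimately show ?case
    by (intro exI[of _ "\<lambda>b z w \<zeta>. p z w \<zeta> * q' b z w \<zeta> + p' b z w \<zeta> * q z w \<zeta>"]) blast
qed

lemma poly3_bound:
  "poly3 q \<Longrightarrow> \<exists>C d. 0 \<le> C \<and> (\<forall>z w \<zeta>. norm z \<le> 1 \<longrightarrow> norm w \<le> 1 \<longrightarrow> cmod (q z w \<zeta>) \<le> C * (1 + (norm \<zeta>)\<^sup>2) ^ d)"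
proof (induction rule: poly3.induct)
  case (poly3_const c B)
  then have "0 \<le> B" using norm_ge_zero order_trans by (metis norm_zero zero_le_one)
  then show ?case using poly3_const by (intro exI[of _ B] exI[of _ 0]) auto
next
  case (poly3_coord b)
  have "cmod (of_real (\<zeta> \<bullet> b)) \<le> norm b * (1 + (norm \<zeta>)\<^sup>2) ^ 1" for \<zeta> :: C2
  proof -
    have "norm \<zeta> \<le> 1 + (norm \<zeta>)\<^sup>2"
    proof -
      have "2 * norm \<zeta> \<le> 1 + (norm \<zeta>)\<^sup>2" using zero_le_power2[of "norm \<zeta> - 1"] unfolding power2_diff by simp
      then show ?thesis using norm_ge_zero[of \<zeta>] by linarith
    qed
    then have "norm \<zeta> * norm b \<le> (1 + (norm \<zeta>)\<^sup>2) * norm b" by (intro mult_right_mono) auto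
    then show ?thesis using Cauchy_Schwarz_ineq2[of \<zeta> b] by (simp add: mult.commute)
  qed
  then show ?case using norm_ge_zero by blast
next
  case (poly3_add p q)
  then obtain C d D e where C: "0 \<le> C" "\<And>z w \<zeta>. norm z \<le> 1 \<Longrightarrow> norm w \<le> 1 \<Longrightarrow> cmod (p z w \<zeta>) \<le> C * (1 + (norm \<zeta>)\<^sup>2) ^ d"
    and D: "0 \<le> D" "\<And>z w \<zeta>. norm z \<le> 1 \<Longrightarrow> norm w \<le> 1 \<Longrightarrow> cmod (q z w \<zeta>) \<le> D * (1 + (norm \<zeta>)\<^sup>2) ^ e" by blast
  have "cmod (p z w \<zeta> + q z w \<zeta>) \<le> (C + D) * (1 + (norm \<zeta>)\<^sup>2) ^ (d + e)"
    if "norm z \<le> 1" "norm w \<le> 1" for z w \<zeta>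
  proof -
    have "cmod (p z w \<zeta> + q z w \<zeta>) \<le> C * (1 + (norm \<zeta>)\<^sup>2) ^ d + D * (1 + (norm \<zeta>)\<^sup>2) ^ e"
      by (rule order_trans[OF norm_triangle_ineq add_mono[OF C(2)[OF that] D(2)[OF that]]])
    also have "\<dots> \<le> C * (1 + (norm \<zeta>)\<^sup>2) ^ (d + e) + D * (1 + (norm \<zeta>)\<^sup>2) ^ (d + e)"
      using C(1) D(1) by (intro add_mono mult_left_mono power_increasing) auto
    finally show ?thesis by (simp add: distrib_right)
  qed
  then show ?case using C(1) D(1) by (intro exI[of _ "C + D"] exI[of _ "d + e"]) auto
next
  case (poly3_mult p q)
  then obtain C d D e where C: "0 \<le> C" "\<And>z w \<zeta>. norm z \<le> 1 \<Longrightarrow> norm w \<le> 1 \<Longrightarrow> cmod (p z w \<zeta>) \<le> C * (1 + (norm \<zeta>)\<^sup>2) ^ d"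
    and D: "0 \<le> D" "\<And>z w \<zeta>. norm z \<le> 1 \<Longrightarrow> norm w \<le> 1 \<Longrightarrow> cmod (q z w \<zeta>) \<le> D * (1 + (norm \<zeta>)\<^sup>2) ^ e" by blast
  have "cmod (p z w \<zeta> * q z w \<zeta>) \<le> (C * D) * (1 + (norm \<zeta>)\<^sup>2) ^ (d + e)"
    if "norm z \<le> 1" "norm w \<le> 1" for z w \<zeta>
    using mult_mono[OF C(2)[OF that, of \<zeta>] D(2)[OF that, of \<zeta>]] C(1)
    by (simp add: norm_mult power_add mult_ac)
  then show ?case using C(1) D(1) by (intro exI[of _ "C * D"] exI[of _ "d + e"]) auto
qed

lemma vec_nth_eq_inner: "(\<zeta> :: C2) $ i = of_real (\<zeta> \<bullet> axis i 1) + \<i> * of_real (\<zeta> \<bullet> axis i \<i>)"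
  by (simp add: inner_axis complex_eq_iff inner_complex_def)

lemma poly3_nth: "poly3 (\<lambda>z w \<zeta>. \<zeta> $ i)" and poly3_cnj_nth: "poly3 (\<lambda>z w \<zeta>. cnj (\<zeta> $ i))"
proof -
  show "poly3 (\<lambda>z w \<zeta>. \<zeta> $ i)"
    unfolding vec_nth_eq_inner by (intro poly3_add poly3_mult poly3_coord poly3_complex)
  have "cnj (\<zeta> $ i) = of_real (\<zeta> \<bullet> axis i 1) + (- \<i>) * of_real (\<zeta> \<bullet> axis i \<i>)" for \<zeta> :: C2
    by (subst vec_nth_eq_inner) simp
  then show "poly3 (\<lambda>z w \<zeta>. cnj (\<zeta> $ i))"
    by (simp only:) (intro poly3_add poly3_mult poly3_coord poly3_complex)
qed

lemma poly3_z: "poly3 (\<lambda>z w \<zeta>. z $ i)" and poly3_cnj_w: "poly3 (\<lambda>z w \<zeta>. cnj (w $ i))"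
  using order_trans[OF Finite_Cartesian_Product.norm_nth_le]
  by (auto intro!: poly3_const[of _ 1])

lemma poly3_uminus: "poly3 p \<Longrightarrow> poly3 (\<lambda>z w \<zeta>. - p z w \<zeta>)"
  using poly3_mult[OF poly3_complex[of "-1"]] by simp

lemma poly3_diff: "poly3 p \<Longrightarrow> poly3 q \<Longrightarrow> poly3 (\<lambda>z w \<zeta>. p z w \<zeta> - q z w \<zeta>)"
  using poly3_add[OF _ poly3_uminus, of p q] by simp

lemma poly3_norm_sq: "poly3 (\<lambda>z w \<zeta>. of_real ((norm \<zeta>)\<^sup>2))"
  unfolding of_real_norm_C2 by (intro poly3_add poly3_mult poly3_nth poly3_cnj_nth)

lemma poly3_herm: "poly3 (\<lambda>z w \<zeta>. herm z w)"
  unfolding herm_def by (intro poly3_add poly3_mult poly3_z poly3_cnj_w)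

lemma poly3_uu: "poly3 (\<lambda>z w \<zeta>. uc \<zeta> z * cnj (uc \<zeta> w))"
  unfolding uc_def complex_cnj_diff complex_cnj_mult
  by (intro poly3_diff poly3_mult poly3_nth poly3_cnj_nth poly3_z poly3_cnj_w)

lemma poly3_duu: "poly3 (\<lambda>z w \<zeta>. duu z w \<zeta> b)"
  unfolding duu_def uc_def complex_cnj_diff complex_cnj_mult
  by (intro poly3_add poly3_diff poly3_mult poly3_nth poly3_cnj_nth poly3_z poly3_cnj_w poly3_complex)

text \<open>The decrement \<open>m\<close> records how often a derivative has fallen on the eigenprojections: each time
  the dimension drops by one and a factor of size at most \<open>n\<close> appears.\<close>

inductive tame :: "(nat \<Rightarrow> (real \<times> real \<Rightarrow> complex) \<Rightarrow> C2 \<Rightarrow> C2 \<Rightarrow> C2 \<Rightarrow> complex) \<Rightarrow> bool" where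
  tame_ker: "opr L \<Longrightarrow> tame (\<lambda>n g. ker_fun (n - m) (L g))"
| tame_add: "tame \<Psi> \<Longrightarrow> tame \<Theta> \<Longrightarrow> tame (\<lambda>n g z w \<zeta>. \<Psi> n g z w \<zeta> + \<Theta> n g z w \<zeta>)"
| tame_poly: "poly3 q \<Longrightarrow> tame \<Psi> \<Longrightarrow> tame (\<lambda>n g z w \<zeta>. q z w \<zeta> * \<Psi> n g z w \<zeta>)"
| tame_dim: "tame \<Psi> \<Longrightarrow> tame (\<lambda>n g z w \<zeta>. of_nat (n - m) * \<Psi> n g z w \<zeta>)"

lemma ker_deriv_tame:
  assumes L: "opr L"
  shows "tame (\<lambda>n g z w \<zeta>. ker_deriv (n - m) (L g) z w \<zeta> b)"
proof -
  have B: "(1, 0) \<in> (Basis :: (real \<times> real) set)" "(0, 1) \<in> (Basis :: (real \<times> real) set)" by (auto simp: Basis_real2)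
  have x: "poly3 (\<lambda>z w \<zeta>. of_real (2 * (\<zeta> \<bullet> b)))"
    unfolding of_real_mult by (intro poly3_mult poly3_coord poly3_complex)
  note o1 = opr_pderivative[OF L B(1)] and o2 = opr_pderivative[OF L B(2)]
  \<comment> \<open>Truncated subtraction is harmless: kernels of degree n - m - 1 come with the
    factor n - m, which is 0 when the degree cannot drop.\<close>
  note k = tame_ker[of _ "m + 1", unfolded diff_diff_left[symmetric]]
  show ?thesis
    unfolding ker_deriv_def
    by (intro tame_add tame_dim tame_poly poly3_mult poly3_diff poly3_complex poly3_duu poly3_uu
        poly3_herm poly3_norm_sq x tame_ker[OF o1] k opr_avg o2 opr_pderivative[OF o2 B(2)])
qed

text \<open>The families \<open>\<Psi>'\<close> are found before \<open>n\<close>, \<open>g\<close>,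
  \<open>z\<close> and \<open>w\<close> are fixed; this order of quantifiers makes all later
  constants uniform.\<close>

lemma tame_has_derivative:
  "tame \<Psi> \<Longrightarrow> \<exists>\<Psi>'. (\<forall>b. tame (\<Psi>' b)) \<and> (\<forall>n g z w \<zeta>. schwartz g \<longrightarrow>
     (\<Psi> n g z w has_derivative (\<lambda>h. \<Sum>b\<in>Basis. (h \<bullet> b) *\<^sub>R \<Psi>' b n g z w \<zeta>)) (at \<zeta>))"
proof (induction rule: tame.induct)
  case (tame_ker L m)
  have "(ker_fun (n - m) (L g) z w has_derivative
      (\<lambda>h. \<Sum>b\<in>Basis. (h \<bullet> b) *\<^sub>R ker_deriv (n - m) (L g) z w \<zeta> b)) (at \<zeta>)" if "schwartz g" for n g z w \<zeta>
  proof -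
    have D: "(ker_fun (n - m) (L g) z w has_derivative ker_deriv (n - m) (L g) z w \<zeta>) (at \<zeta>)"
      by (rule ker_fun_has_derivative[OF opr_schwartz[OF tame_ker that]])
    have lin: "linear (ker_deriv (n - m) (L g) z w \<zeta>)" using has_derivative_linear[OF D] .
    have "ker_deriv (n - m) (L g) z w \<zeta> h = (\<Sum>b\<in>Basis. (h \<bullet> b) *\<^sub>R ker_deriv (n - m) (L g) z w \<zeta> b)" for h
    proof -
      have "ker_deriv (n - m) (L g) z w \<zeta> (\<Sum>b\<in>Basis. (h \<bullet> b) *\<^sub>R b) =
          (\<Sum>b\<in>Basis. (h \<bullet> b) *\<^sub>R ker_deriv (n - m) (L g) z w \<zeta> b)"
        by (simp only: linear_sum[OF lin] linear_scale[OF lin])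
      then show ?thesis by (simp only: euclidean_representation)
    qed
    then show ?thesis using D by (metis (no_types, lifting) ext)
  qed
  then show ?case using ker_deriv_tame[OF tame_ker]
    by (intro exI[of _ "\<lambda>b n g z w \<zeta>. ker_deriv (n - m) (L g) z w \<zeta> b"]) blast
next
  case (tame_add \<Psi> \<Theta>)
  from tame_add.IH(1) obtain \<Psi>' where \<Psi>': "\<forall>b. tame (\<Psi>' b)" "\<forall>n g z w \<zeta>. schwartz g \<longrightarrow>
     (\<Psi> n g z w has_derivative (\<lambda>h. \<Sum>b\<in>Basis. (h \<bullet> b) *\<^sub>R \<Psi>' b n g z w \<zeta>)) (at \<zeta>)"
    by blast
  from tame_add.IH(2) obtain \<Theta>' where \<Theta>': "\<forall>b. tame (\<Theta>' b)" "\<forall>n g z w \<zeta>. schwartz g \<longrightarrow>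
     (\<Theta> n g z w has_derivative (\<lambda>h. \<Sum>b\<in>Basis. (h \<bullet> b) *\<^sub>R \<Theta>' b n g z w \<zeta>)) (at \<zeta>)"
    by blast
  note 1 = \<Psi>'[rule_format] and 2 = \<Theta>'[rule_format]
  have "((\<lambda>\<zeta>. \<Psi> n g z w \<zeta> + \<Theta> n g z w \<zeta>) has_derivative
      (\<lambda>h. \<Sum>b\<in>Basis. (h \<bullet> b) *\<^sub>R (\<Psi>' b n g z w \<zeta> + \<Theta>' b n g z w \<zeta>))) (at \<zeta>)"
    if "schwartz g" for n g z w \<zeta>
    using has_derivative_add[OF 1(2)[OF that] 2(2)[OF that]] by (simp add: scaleR_add_right sum.distrib)
  moreover have "tame (\<lambda>n g z w \<zeta>. \<Psi>' b n g z w \<zeta> + \<Theta>' b n g z w \<zeta>)" for b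
    by (intro tame.tame_add 1 2)
  ultimately show ?case
    by (intro exI[of _ "\<lambda>b n g z w \<zeta>. \<Psi>' b n g z w \<zeta> + \<Theta>' b n g z w \<zeta>"]) blast
next
  case (tame_poly q \<Psi>)
  from tame_poly.IH obtain \<Psi>' where \<Psi>': "\<forall>b. tame (\<Psi>' b)" "\<forall>n g z w \<zeta>. schwartz g \<longrightarrow>
     (\<Psi> n g z w has_derivative (\<lambda>h. \<Sum>b\<in>Basis. (h \<bullet> b) *\<^sub>R \<Psi>' b n g z w \<zeta>)) (at \<zeta>)"
    by blast
  note 1 = \<Psi>'[rule_format]
  from poly3_has_derivative[OF tame_poly.hyps(1)] obtain q' where q'':
      "\<forall>b. poly3 (q' b)" "\<forall>z w \<zeta>. (q z w has_derivative (\<lambda>h. \<Sum>b\<in>Basis. (h \<bullet> b) *\<^sub>R q' b z w \<zeta>)) (at \<zeta>)"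
    by blast
  note q' = q''[rule_format]
  have "((\<lambda>\<zeta>. q z w \<zeta> * \<Psi> n g z w \<zeta>) has_derivative
      (\<lambda>h. \<Sum>b\<in>Basis. (h \<bullet> b) *\<^sub>R (q z w \<zeta> * \<Psi>' b n g z w \<zeta> + q' b z w \<zeta> * \<Psi> n g z w \<zeta>))) (at \<zeta>)"
    if "schwartz g" for n g z w \<zeta>
    using has_derivative_mult[OF q'(2) 1(2)[OF that]]
    by (simp add: scaleR_add_right sum.distrib sum_distrib_left sum_distrib_right)
  moreover have "tame (\<lambda>n g z w \<zeta>. q z w \<zeta> * \<Psi>' b n g z w \<zeta> + q' b z w \<zeta> * \<Psi> n g z w \<zeta>)" for b
    by (intro tame.tame_add tame.tame_poly 1 q' tame_poly.hyps)
  ultimately show ?case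
    by (intro exI[of _ "\<lambda>b n g z w \<zeta>. q z w \<zeta> * \<Psi>' b n g z w \<zeta> + q' b z w \<zeta> * \<Psi> n g z w \<zeta>"]) blast
next
  case (tame_dim \<Psi> m)
  from tame_dim.IH obtain \<Psi>' where \<Psi>': "\<forall>b. tame (\<Psi>' b)" "\<forall>n g z w \<zeta>. schwartz g \<longrightarrow>
     (\<Psi> n g z w has_derivative (\<lambda>h. \<Sum>b\<in>Basis. (h \<bullet> b) *\<^sub>R \<Psi>' b n g z w \<zeta>)) (at \<zeta>)"
    by blast
  note 1 = \<Psi>'[rule_format]
  have "((\<lambda>\<zeta>. of_nat (n - m) * \<Psi> n g z w \<zeta>) has_derivative
      (\<lambda>h. \<Sum>b\<in>Basis. (h \<bullet> b) *\<^sub>R (of_nat (n - m) * \<Psi>' b n g z w \<zeta>))) (at \<zeta>)"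
    if "schwartz g" for n g z w \<zeta>
    using has_derivative_mult_right[OF 1(2)[OF that], of "of_nat (n - m)"]
    by (simp add: sum_distrib_left)
  moreover have "tame (\<lambda>n g z w \<zeta>. of_nat (n - m) * \<Psi>' b n g z w \<zeta>)" for b
    by (intro tame.tame_dim 1)
  ultimately show ?case
    by (intro exI[of _ "\<lambda>b n g z w \<zeta>. of_nat (n - m) * \<Psi>' b n g z w \<zeta>"]) blast
qed

text \<open>A polynomial factor is paid for by demanding more decay of the rest, hence the induction
  over all \<open>K\<close>; each factor n - m costs one power of n + 1.\<close>

lemma tame_bound:
  "tame \<Psi> \<Longrightarrow> \<exists>N C d. 0 \<le> C \<and> (\<forall>n g c z w \<zeta>. schwartz g \<longrightarrow> seminorm_le N g c \<longrightarrow> norm z \<le> 1 \<longrightarrow> norm w \<le> 1 \<longrightarrow>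
     (1 + (norm \<zeta>)\<^sup>2) ^ K * cmod (\<Psi> n g z w \<zeta>) \<le> C * real (n + 1) ^ d * c)"
proof (induction arbitrary: K rule: tame.induct)
  case (tame_ker L m)
  obtain N C where C: "0 \<le> C" "\<And>g c. schwartz g \<Longrightarrow> seminorm_le N g c \<Longrightarrow> seminorm_le K (L g) (C * c)"
    using opr_seminorm_le[OF tame_ker, of K] by blast
  have "(1 + (norm \<zeta>)\<^sup>2) ^ K * cmod (ker_fun (n - m) (L g) z w \<zeta>) \<le> (2 ^ K * C) * real (n + 1) ^ 0 * c"
    if "schwartz g" "seminorm_le N g c" "norm z \<le> 1" "norm w \<le> 1" for n g c z w \<zeta>
    using ker_fun_decay[OF C(2)[OF that(1,2)] that(3,4), of \<zeta> "n - m"] by (simp add: mult.assoc)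
  then show ?case using C(1) by (intro exI[of _ N] exI[of _ "2 ^ K * C"] exI[of _ 0]) auto
next
  case (tame_add \<Psi> \<Theta>)
  obtain N1 C1 d1 where 1: "0 \<le> C1" "\<And>n g c z w \<zeta>. schwartz g \<Longrightarrow> seminorm_le N1 g c \<Longrightarrow> norm z \<le> 1 \<Longrightarrow> norm w \<le> 1 \<Longrightarrow>
     (1 + (norm \<zeta>)\<^sup>2) ^ K * cmod (\<Psi> n g z w \<zeta>) \<le> C1 * real (n + 1) ^ d1 * c"
    using tame_add.IH(1)[of K] by blast
  obtain N2 C2 d2 where 2: "0 \<le> C2" "\<And>n g c z w \<zeta>. schwartz g \<Longrightarrow> seminorm_le N2 g c \<Longrightarrow> norm z \<le> 1 \<Longrightarrow> norm w \<le> 1 \<Longrightarrow>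
     (1 + (norm \<zeta>)\<^sup>2) ^ K * cmod (\<Theta> n g z w \<zeta>) \<le> C2 * real (n + 1) ^ d2 * c"
    using tame_add.IH(2)[of K] by blast
  have "(1 + (norm \<zeta>)\<^sup>2) ^ K * cmod (\<Psi> n g z w \<zeta> + \<Theta> n g z w \<zeta>) \<le> (C1 + C2) * real (n + 1) ^ (d1 + d2) * c"
    if g: "schwartz g" and c: "seminorm_le (N1 + N2) g c" and zw: "norm z \<le> 1" "norm w \<le> 1" for n g c z w \<zeta>
  proof -
    have "(1 + (norm \<zeta>)\<^sup>2) ^ K * cmod (\<Psi> n g z w \<zeta> + \<Theta> n g z w \<zeta>) \<le>
      (1 + (norm \<zeta>)\<^sup>2) ^ K * (cmod (\<Psi> n g z w \<zeta>) + cmod (\<Theta> n g z w \<zeta>))"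
      by (intro mult_left_mono norm_triangle_ineq) simp
    also have "\<dots> \<le> C1 * real (n + 1) ^ d1 * c + C2 * real (n + 1) ^ d2 * c"
      unfolding distrib_left
      by (intro add_mono 1(2) 2(2) g zw seminorm_le_mono[OF c]) auto
    also have "\<dots> \<le> C1 * real (n + 1) ^ (d1 + d2) * c + C2 * real (n + 1) ^ (d1 + d2) * c"
      using 1(1) 2(1) seminorm_le_nonneg[OF c]
      by (intro add_mono mult_right_mono mult_left_mono power_increasing) auto
    finally show ?thesis by (simp add: distrib_right)
  qed
  then show ?case using 1(1) 2(1) by (intro exI[of _ "N1 + N2"] exI[of _ "C1 + C2"] exI[of _ "d1 + d2"]) auto
next
  case (tame_poly q \<Psi>)
  obtain D e where D: "0 \<le> D" "\<And>z w \<zeta>. norm z \<le> 1 \<Longrightarrow> norm w \<le> 1 \<Longrightarrow> cmod (q z w \<zeta>) \<le> D * (1 + (norm \<zeta>)\<^sup>2) ^ e"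
    using poly3_bound[OF tame_poly.hyps(1)] by blast
  obtain N C d where C: "0 \<le> C" "\<And>n g c z w \<zeta>. schwartz g \<Longrightarrow> seminorm_le N g c \<Longrightarrow> norm z \<le> 1 \<Longrightarrow> norm w \<le> 1 \<Longrightarrow>
     (1 + (norm \<zeta>)\<^sup>2) ^ (K + e) * cmod (\<Psi> n g z w \<zeta>) \<le> C * real (n + 1) ^ d * c"
    using tame_poly.IH[of "K + e"] by blast
  have "(1 + (norm \<zeta>)\<^sup>2) ^ K * cmod (q z w \<zeta> * \<Psi> n g z w \<zeta>) \<le> (D * C) * real (n + 1) ^ d * c"
    if g: "schwartz g" and c: "seminorm_le N g c" and zw: "norm z \<le> 1" "norm w \<le> 1" for n g c z w \<zeta>
  proof -
    have "(1 + (norm \<zeta>)\<^sup>2) ^ K * cmod (q z w \<zeta> * \<Psi> n g z w \<zeta>) =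
       cmod (q z w \<zeta>) * ((1 + (norm \<zeta>)\<^sup>2) ^ K * cmod (\<Psi> n g z w \<zeta>))" by (simp add: norm_mult)
    also have "\<dots> \<le> (D * (1 + (norm \<zeta>)\<^sup>2) ^ e) * ((1 + (norm \<zeta>)\<^sup>2) ^ K * cmod (\<Psi> n g z w \<zeta>))"
      by (intro mult_right_mono D zw) simp
    also have "\<dots> = D * ((1 + (norm \<zeta>)\<^sup>2) ^ (K + e) * cmod (\<Psi> n g z w \<zeta>))" by (simp add: power_add)
    also have "\<dots> \<le> D * (C * real (n + 1) ^ d * c)" by (intro mult_left_mono C(2) g c zw D(1))
    finally show ?thesis by (simp add: mult_ac)
  qed
  then show ?case using C(1) D(1) by (intro exI[of _ N] exI[of _ "D * C"] exI[of _ d]) auto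
next
  case (tame_dim \<Psi> m)
  obtain N C d where C: "0 \<le> C" "\<And>n g c z w \<zeta>. schwartz g \<Longrightarrow> seminorm_le N g c \<Longrightarrow> norm z \<le> 1 \<Longrightarrow> norm w \<le> 1 \<Longrightarrow>
     (1 + (norm \<zeta>)\<^sup>2) ^ K * cmod (\<Psi> n g z w \<zeta>) \<le> C * real (n + 1) ^ d * c"
    using tame_dim.IH[of K] by blast
  have "(1 + (norm \<zeta>)\<^sup>2) ^ K * cmod (of_nat (n - m) * \<Psi> n g z w \<zeta>) \<le> C * real (n + 1) ^ Suc d * c"
    if g: "schwartz g" and c: "seminorm_le N g c" and zw: "norm z \<le> 1" "norm w \<le> 1" for n g c z w \<zeta>
  proof -
    have "(1 + (norm \<zeta>)\<^sup>2) ^ K * cmod (of_nat (n - m) * \<Psi> n g z w \<zeta>) =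
       real (n - m) * ((1 + (norm \<zeta>)\<^sup>2) ^ K * cmod (\<Psi> n g z w \<zeta>))" by (simp add: norm_mult)
    also have "\<dots> \<le> real (n + 1) * ((1 + (norm \<zeta>)\<^sup>2) ^ K * cmod (\<Psi> n g z w \<zeta>))"
      by (intro mult_right_mono) auto
    also have "\<dots> \<le> real (n + 1) * (C * real (n + 1) ^ d * c)" by (intro mult_left_mono C(2) g c zw) simp
    finally show ?thesis by (simp add: mult_ac)
  qed
  then show ?case using C(1) by (intro exI[of _ N] exI[of _ C] exI[of _ "Suc d"]) auto
qed

section \<open>Matrices and their kernels\<close>

text \<open>Matrices are encoded as functions that are polynomial in \<open>z\<close> and conjugate
  polynomial in \<open>w\<close>. In this picture \<open>tau\<close> acts by substitution of
  variables.\<close>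

definition kern :: "nat \<Rightarrow> complex mat \<Rightarrow> C2 \<Rightarrow> C2 \<Rightarrow> complex" where
  "kern n A z w = (\<Sum>a\<le>n. \<Sum>b\<le>n. A $$ (a, b) * basis_poly n a z * cnj (basis_poly n b w))"

section \<open>Recovering matrix entries from kernel values\<close>

definition unity_root :: "nat \<Rightarrow> nat \<Rightarrow> complex" where
  "unity_root n m = cis (2 * pi * real m / real (n + 1))"

lemma norm_unity_root [simp]: "cmod (unity_root n m) = 1"
  by (simp add: unity_root_def)

lemma unity_root_power_swap: "unity_root n k ^ m = unity_root n m ^ k"
proof -
  have "real m * (2 * pi * real k / real (n + 1)) = real k * (2 * pi * real m / real (n + 1))" by simp
  then show ?thesis by (simp only: unity_root_def Complex.DeMoivre)
qed

lemma unity_root_inject: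
  assumes "m \<le> n" "a \<le> n" "unity_root n m = unity_root n a"
  shows "m = a"
proof -
  have r: "unity_root n j = exp (2 * of_real pi * \<i> * of_nat j / of_nat (n + 1))" for j
    by (simp add: unity_root_def cis_conv_exp mult_ac)
  have "m mod (n + 1) = a mod (n + 1)"
    using assms(3) unfolding r by (subst (asm) complex_root_unity_eq) auto
  then show ?thesis using assms by simp
qed

text \<open>A geometric sum over a full period: n + 1 roots are just enough to separate the
  exponents 0, ..., n.\<close>

lemma unity_root_orthogonal:
  assumes "m \<le> n" "a \<le> n"
  shows "(\<Sum>k\<le>n. cnj (unity_root n a ^ k) * unity_root n m ^ k) = (if m = a then of_nat (n + 1) else 0)"
proof -
  define x where "x = cnj (unity_root n a) * unity_root n m"
  have s: "(\<Sum>k\<le>n. cnj (unity_root n a ^ k) * unity_root n m ^ k) = (\<Sum>k\<le>n. x ^ k)"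
    by (simp add: x_def power_mult_distrib)
  have one: "cnj (unity_root n a) * unity_root n a = 1"
    using complex_norm_square[of "unity_root n a"] by (simp add: mult.commute)
  show ?thesis
  proof (cases "m = a")
    case True
    then show ?thesis unfolding s using one by (simp add: x_def)
  next
    case False
    have "x \<noteq> 1"
    proof
      assume "x = 1"
      then have "unity_root n a * x = unity_root n a" by simp
      then have "unity_root n m = unity_root n a"
        unfolding x_def using one by (metis mult.assoc mult.commute mult.right_neutral)
      then show False using unity_root_inject assms False by blast
    qed
    have r1: "unity_root n j ^ Suc n = 1" for j
    proof -
      have "unity_root n j ^ Suc n = cis (2 * pi * real j)"
      proof -
        have "real (Suc n) * (2 * pi * real j / real (n + 1)) = 2 * pi * real j" by (simp add: field_simps)
        then show ?thesis by (simp only: unity_root_def Complex.DeMoivre)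
      qed
      then show ?thesis by (simp add: cis_multiple_2pi)
    qed
    have "x ^ Suc n = cnj (unity_root n a ^ Suc n) * unity_root n m ^ Suc n"
      by (simp only: x_def power_mult_distrib complex_cnj_power)
    also have "\<dots> = 1" unfolding r1 by simp
    finally have "(1 - x) * (\<Sum>k\<le>n. x ^ k) = 0"
      unfolding sum_gp_basic by simp
    then show ?thesis unfolding s using \<open>x \<noteq> 1\<close> False by simp
  qed
qed

text \<open>Matrix entries are recovered from the kernel by a discrete Fourier transform on the torus
  \<open>|z\<^sub>1|\<^sup>2 = a / n\<close>, \<open>|z\<^sub>2|\<^sup>2 = 1 - a / n\<close>, on which the monomial of degree \<open>a\<close> in \<open>z\<^sub>1\<close> is largest.\<close>

definition pt :: "nat \<Rightarrow> nat \<Rightarrow> nat \<Rightarrow> C2" where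
  "pt n a k = vector [of_real (sqrt (real a / real n)) * unity_root n k, of_real (sqrt (1 - real a / real n))]"

definition rho :: "nat \<Rightarrow> nat \<Rightarrow> real" where
  "rho n a = sqrt (real (n choose a)) * sqrt (real a / real n) ^ a * sqrt (1 - real a / real n) ^ (n - a)"

text \<open>For \<open>n = 0\<close> the division by 0 gives 0, and the point is the second unit
  vector.\<close>

lemma norm_pt: "a \<le> n \<Longrightarrow> norm (pt n a k) = 1"
proof -
  assume "a \<le> n"
  then have "0 \<le> 1 - real a / real n" by (cases "n = 0") (auto simp: field_simps)
  then have "(norm (pt n a k))\<^sup>2 = 1"
    by (simp add: norm_C2 pt_def norm_mult power_mult_distrib)
  then show ?thesis by (simp add: power2_eq_1_iff)
     (metis norm_ge_zero not_one_le_zero neg_0_le_iff_le order_trans zero_neq_neg_one le_minus_one_simps(3))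
qed

lemma basis_poly_pt:
  "basis_poly n m (pt n a k) =
     of_real (sqrt (real (n choose m)) * sqrt (real a / real n) ^ m * sqrt (1 - real a / real n) ^ (n - m)) * unity_root n m ^ k"
  by (simp add: basis_poly_def pt_def power_mult_distrib unity_root_power_swap[of n k m])

lemma sum_root_basis_poly:
  assumes "m \<le> n" "a \<le> n"
  shows "(\<Sum>k\<le>n. cnj (unity_root n a ^ k) * basis_poly n m (pt n a k)) = (if m = a then of_nat (n + 1) * of_real (rho n a) else 0)"
proof -
  let ?r = "of_real (sqrt (real (n choose m)) * sqrt (real a / real n) ^ m * sqrt (1 - real a / real n) ^ (n - m))"
  have "(\<Sum>k\<le>n. cnj (unity_root n a ^ k) * basis_poly n m (pt n a k)) = ?r * (\<Sum>k\<le>n. cnj (unity_root n a ^ k) * unity_root n m ^ k)"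
    unfolding basis_poly_pt sum_distrib_left by (intro sum.cong refl) (simp only: mult_ac)
  then show ?thesis
    unfolding unity_root_orthogonal[OF assms] by (simp add: rho_def mult_ac)
qed

text \<open>The binomial distribution with parameters \<open>n\<close> and \<open>a / n\<close> has its largest weight at \<open>a\<close>.\<close>

lemma rho_bound:
  assumes a: "a \<le> n"
  shows "0 < rho n a" "1 \<le> real (n + 1) * (rho n a)\<^sup>2"
proof -
  define p q where "p = real a / real n" and "q = 1 - real a / real n"
  define t where "t m = real (n choose m) * p ^ m * q ^ (n - m)" for m
  have pq: "0 \<le> p" "0 \<le> q" "p + q = 1"
    using a by (cases "n = 0"; auto simp: p_def q_def field_simps)+
  have rho: "(rho n a)\<^sup>2 = t a"
    using pq unfolding rho_def t_def q_def[symmetric] unfolding p_def[symmetric]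
    by (simp add: power_mult_distrib flip: power_mult) (simp add: mult.commute[of _ 2] power_mult)
  have sum1: "(\<Sum>m\<le>n. t m) = 1"
    using binomial_ring[of p q n] pq by (simp add: t_def)
  have max: "t m \<le> t a" if "m \<le> n" for m
  \<comment> \<open>Here q = 0 (unless n = 0), so consecutive weights cannot be compared by ratios,
    but all the mass sits at \<open>a\<close>.\<close>
  proof (cases "a = n")
    case True
    have "t m \<le> (\<Sum>m\<le>n. t m)" using that pq by (intro member_le_sum) (auto simp: t_def)
    also have "\<dots> = t a" using True sum1 by (cases "n = 0") (auto simp: t_def p_def q_def)
    finally show ?thesis .
  next
    case False
    then have n: "0 < n" "a < n" using a by auto
    then have q: "0 < q" by (simp add: q_def)
    \<comment> \<open>The ratio of consecutive weights. They increase where (m + 1) q \<le> (n - m)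
      p, and for p = a / n with a < n this means m < a.\<close>
    have step: "t (Suc m) * (real (Suc m) * q) = t m * (real (n - m) * p)" if "m < n" for m
    proof -
      have "Suc m * (n choose Suc m) = (n - m) * (n choose m)"
        using binomial_absorb_comp[of n m] binomial_absorption[of m n] by simp
      then have c: "real (Suc m) * real (n choose Suc m) = real (n - m) * real (n choose m)"
        by (metis of_nat_mult)
      have "q ^ (n - m) = q * q ^ (n - Suc m)" using that by (metis Suc_diff_Suc power_Suc)
      then have "t (Suc m) * (real (Suc m) * q) = (real (Suc m) * real (n choose Suc m)) * (p * p ^ m) * q ^ (n - m)"
        by (simp add: t_def mult_ac)
      then show ?thesis unfolding c by (simp add: t_def mult_ac)
    qed
    have up: "t m \<le> t (Suc m)" if "m < a" for m
    proof -
      have "real (Suc m) * q \<le> real (n - m) * p"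
      proof -
        have "real (Suc m) * real (n - a) \<le> real (n - m) * real a"
        proof -
          have "real (Suc m) * real n \<le> real a * real n" using that by (intro mult_right_mono) auto
          moreover have "real (Suc m) * real n - real (Suc m) * real a \<le> real n * real a - real m * real a"
            using calculation by (simp add: algebra_simps)
          moreover have "m \<le> n" using that n by simp
          ultimately show ?thesis using that n by (simp add: of_nat_diff algebra_simps)
        qed
        moreover have "p = real a / real n" "q = real (n - a) / real n"
          using n by (simp_all add: p_def q_def of_nat_diff field_simps)
        ultimately show ?thesis using n by (simp add: divide_right_mono)
      qed
      then have "t m * (real (Suc m) * q) \<le> t (Suc m) * (real (Suc m) * q)"
        unfolding step[OF order.strict_trans[OF that n(2)]] using pq by (intro mult_left_mono) (auto simp: t_def)
      then show ?thesis using q by (simp add: mult_le_cancel_right)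
    qed
    have down: "t (Suc m) \<le> t m" if "a \<le> m" "m < n" for m
    proof -
      have "real (n - m) * p \<le> real (Suc m) * q"
      proof -
        have "real (n - m) * real a \<le> real (Suc m) * real (n - a)"
        proof -
          have "real a * real n \<le> real m * real n" using that by (intro mult_right_mono) auto
          then have "real a + real a * real n \<le> real n + real m * real n"
            using a by (intro add_mono) auto
          then have "real n * real a - real m * real a \<le> real (Suc m) * real n - real (Suc m) * real a"
            by (simp add: algebra_simps)
          then show ?thesis using that n by (simp add: of_nat_diff algebra_simps)
        qed
        moreover have "p = real a / real n" "q = real (n - a) / real n"
          using n by (simp_all add: p_def q_def of_nat_diff field_simps)
        ultimately show ?thesis using n by (simp add: divide_right_mono)
      qed
      then have "t (Suc m) * (real (Suc m) * q) \<le> t m * (real (Suc m) * q)"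
        unfolding step[OF that(2)] using pq by (intro mult_left_mono) (auto simp: t_def)
      then show ?thesis using q by (simp add: mult_le_cancel_right)
    qed
    show ?thesis
    proof (cases "m \<le> a")
      case True
      then show ?thesis
      proof (induction rule: inc_induct)
        case (step j)
        then show ?case using up[of j] by simp
      qed simp
    next
      case False
      then have "a \<le> m" by simp
      then show ?thesis using \<open>m \<le> n\<close>
      proof (induction rule: dec_induct)
        case (step j)
        then show ?case using down[of j] by simp
      qed simp
    qed
  qed
  \<comment> \<open>The largest of n + 1 weights with sum 1 is at least their mean.\<close>
  have "1 \<le> real (n + 1) * t a"
    using sum_bounded_above[of "{..n}" t "t a"] max sum1 by simp
  then show 1: "1 \<le> real (n + 1) * (rho n a)\<^sup>2" by (simp add: rho)
  have "0 \<le> rho n a"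
    using pq by (simp add: rho_def p_def q_def)
  moreover have "rho n a \<noteq> 0" using 1 by auto
  ultimately show "0 < rho n a" by simp
qed

text \<open>Coefficients of the inverse discrete Fourier transform in both variables, divided by the
  amplitudes \<open>rho\<close> of the two monomials.\<close>

definition ecoef :: "nat \<Rightarrow> nat \<Rightarrow> nat \<Rightarrow> nat \<Rightarrow> nat \<Rightarrow> complex" where
  "ecoef n a b k l = cnj (unity_root n a ^ k) * unity_root n b ^ l * of_real (inverse ((real (n + 1))\<^sup>2 * rho n a * rho n b))"

definition mat_coeff :: "nat \<Rightarrow> nat \<Rightarrow> nat \<Rightarrow> (C2 \<Rightarrow> C2 \<Rightarrow> complex) \<Rightarrow> complex" where
  "mat_coeff n a b K = (\<Sum>k\<le>n. \<Sum>l\<le>n. ecoef n a b k l * K (pt n a k) (pt n b l))"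

lemma sum4_swap:
  fixes g :: "nat \<Rightarrow> nat \<Rightarrow> nat \<Rightarrow> nat \<Rightarrow> complex"
  shows "(\<Sum>k\<le>n. \<Sum>l\<le>n. \<Sum>p\<le>n. \<Sum>q\<le>n. g k l p q) = (\<Sum>p\<le>n. \<Sum>q\<le>n. \<Sum>k\<le>n. \<Sum>l\<le>n. g k l p q)"
proof -
  have "(\<Sum>k\<le>n. \<Sum>l\<le>n. \<Sum>p\<le>n. \<Sum>q\<le>n. g k l p q) = (\<Sum>k\<le>n. \<Sum>p\<le>n. \<Sum>l\<le>n. \<Sum>q\<le>n. g k l p q)"
    by (intro sum.cong refl sum.swap)
  also have "\<dots> = (\<Sum>p\<le>n. \<Sum>k\<le>n. \<Sum>l\<le>n. \<Sum>q\<le>n. g k l p q)"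
    by (rule sum.swap)
  also have "\<dots> = (\<Sum>p\<le>n. \<Sum>k\<le>n. \<Sum>q\<le>n. \<Sum>l\<le>n. g k l p q)"
    by (intro sum.cong refl sum.swap)
  also have "\<dots> = (\<Sum>p\<le>n. \<Sum>q\<le>n. \<Sum>k\<le>n. \<Sum>l\<le>n. g k l p q)"
    by (intro sum.cong refl sum.swap)
  finally show ?thesis .
qed

lemma mat_coeff_kern:
  assumes a: "a \<le> n" and b: "b \<le> n"
  shows "mat_coeff n a b (kern n A) = A $$ (a, b)"
proof -
  let ?c = "complex_of_real (inverse ((real (n + 1))\<^sup>2 * rho n a * rho n b))"
  let ?S = "\<lambda>p. \<Sum>k\<le>n. cnj (unity_root n a ^ k) * basis_poly n p (pt n a k)"
  let ?T = "\<lambda>q. \<Sum>l\<le>n. unity_root n b ^ l * cnj (basis_poly n q (pt n b l))"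
  have T: "?T q = (if q = b then of_nat (n + 1) * of_real (rho n b) else 0)" if "q \<le> n" for q
  proof -
    have "?T q = cnj (\<Sum>l\<le>n. cnj (unity_root n b ^ l) * basis_poly n q (pt n b l))" by simp
    then show ?thesis unfolding sum_root_basis_poly[OF that b] by simp
  qed
  have "mat_coeff n a b (kern n A) = (\<Sum>k\<le>n. \<Sum>l\<le>n. \<Sum>p\<le>n. \<Sum>q\<le>n.
      ?c * A $$ (p, q) * (cnj (unity_root n a ^ k) * basis_poly n p (pt n a k)) * (unity_root n b ^ l * cnj (basis_poly n q (pt n b l))))"
    unfolding mat_coeff_def kern_def ecoef_def sum_distrib_left
    by (intro sum.cong refl) (simp only: mult_ac)
  also have "\<dots> = (\<Sum>p\<le>n. \<Sum>q\<le>n. ?c * A $$ (p, q) * (\<Sum>k\<le>n. \<Sum>l\<le>n.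
      (cnj (unity_root n a ^ k) * basis_poly n p (pt n a k)) * (unity_root n b ^ l * cnj (basis_poly n q (pt n b l)))))"
    unfolding sum_distrib_left
    by (subst sum4_swap) (intro sum.cong refl, simp only: mult_ac)
  also have "\<dots> = (\<Sum>p\<le>n. \<Sum>q\<le>n. ?c * A $$ (p, q) * (?S p * ?T q))"
    by (simp only: sum_product)
  also have "\<dots> = (\<Sum>p\<le>n. \<Sum>q\<le>n. if p = a \<and> q = b then ?c * A $$ (a, b) *
      ((of_nat (n + 1) * of_real (rho n a)) * (of_nat (n + 1) * of_real (rho n b))) else 0)"
  proof (intro sum.cong refl)
    fix p q assume "p \<in> {..n}" "q \<in> {..n}"
    then have "p \<le> n" "q \<le> n" by auto
    show "?c * A $$ (p, q) * (?S p * ?T q) = (if p = a \<and> q = b then ?c * A $$ (a, b) *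
      ((of_nat (n + 1) * of_real (rho n a)) * (of_nat (n + 1) * of_real (rho n b))) else 0)"
      unfolding sum_root_basis_poly[OF \<open>p \<le> n\<close> a] T[OF \<open>q \<le> n\<close>] by (cases "p = a"; cases "q = b") simp_all
  qed
  also have "\<dots> = ?c * A $$ (a, b) * ((of_nat (n + 1) * of_real (rho n a)) * (of_nat (n + 1) * of_real (rho n b)))"
  proof -
    have "(\<Sum>q\<le>n. if p = a \<and> q = b then X else 0) = (if p = a then X else 0)" for p and X :: complex
      using b by (cases "p = a") auto
    then show ?thesis using a by simp
  qed
  also have "\<dots> = A $$ (a, b)"
  proof -
    have "?c * ((of_nat (n + 1) * of_real (rho n a)) * (of_nat (n + 1) * of_real (rho n b))) =
      of_real (inverse ((real (n + 1))\<^sup>2 * rho n a * rho n b) * ((real (n + 1))\<^sup>2 * rho n a * rho n b))"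
      by (simp only: of_real_mult of_real_of_nat_eq power2_eq_square mult_ac)
    also have "inverse ((real (n + 1))\<^sup>2 * rho n a * rho n b) * ((real (n + 1))\<^sup>2 * rho n a * rho n b) = 1"
      using rho_bound(1)[OF a] rho_bound(1)[OF b] by (intro left_inverse) simp
    finally have "?c * ((of_nat (n + 1) * of_real (rho n a)) * (of_nat (n + 1) * of_real (rho n b))) = 1" by simp
    then show ?thesis by (metis mult.assoc mult.commute mult.right_neutral)
  qed
  finally show ?thesis .
qed

text \<open>The (n + 1)^2 coefficients have modulus 1 / ((n + 1)^2 r s), where r and s are the two
  amplitudes, and \<open>rho_bound\<close> gives r s \<ge> 1 / (n + 1). Recovering an entry thus
  loses a single factor n + 1.\<close>

lemma norm_mat_coeff_le:
  assumes a: "a \<le> n" and b: "b \<le> n" and K: "\<And>z w. norm z = 1 \<Longrightarrow> norm w = 1 \<Longrightarrow> cmod (K z w) \<le> c"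
  shows "cmod (mat_coeff n a b K) \<le> real (n + 1) * c"
proof -
  let ?N = "real (n + 1)"
  have c: "0 \<le> c" using K[OF norm_pt[OF a] norm_pt[OF b], of 0 0] norm_ge_zero order_trans by blast
  note ra = rho_bound[OF a] and rb = rho_bound[OF b]
  have "1 \<le> (?N * (rho n a)\<^sup>2) * (?N * (rho n b)\<^sup>2)"
    using mult_mono[OF ra(2) rb(2)] by simp
  then have "1\<^sup>2 \<le> (?N * rho n a * rho n b)\<^sup>2" by (simp add: power_mult_distrib power2_eq_square mult_ac)
  then have 1: "1 \<le> ?N * rho n a * rho n b"
    using ra(1) rb(1) by (intro power2_le_imp_le[of 1]) auto
  let ?i = "inverse (?N\<^sup>2 * rho n a * rho n b)"
  have i0: "0 < ?i" using ra(1) rb(1) by simp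
  have "cmod (mat_coeff n a b K) \<le> (\<Sum>k\<le>n. \<Sum>l\<le>n. ?i * c)"
    unfolding mat_coeff_def
  proof (intro sum_norm_le)
    fix k l
    have "cmod (ecoef n a b k l) = ?i"
      unfolding ecoef_def norm_mult norm_power complex_mod_cnj norm_unity_root norm_of_real using i0 by simp
    then show "cmod (ecoef n a b k l * K (pt n a k) (pt n b l)) \<le> ?i * c"
      unfolding norm_mult using i0 K[OF norm_pt[OF a] norm_pt[OF b]] by (intro mult_mono) auto
  qed
  also have "\<dots> = (?N\<^sup>2 * ?i) * c" by (simp add: power2_eq_square)
  also have "?N\<^sup>2 * ?i = ?N * inverse (?N * rho n a * rho n b)"
    by (simp add: power2_eq_square)
  also have "\<dots> * c \<le> (?N * 1) * c"
    using c le_imp_inverse_le[OF 1] unfolding inverse_1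
    by (intro mult_right_mono mult_left_mono) (simp_all only: zero_less_one of_nat_0_le_iff)
  finally show ?thesis by simp
qed

lemma kern_inject:
  assumes "A \<in> carrier_mat (n + 1) (n + 1)" "B \<in> carrier_mat (n + 1) (n + 1)"
    and "\<And>z w. kern n A z w = kern n B z w"
  shows "A = B"
proof (rule eq_matI)
  have "kern n A = kern n B" using assms(3) by (intro ext)
  then show "A $$ (i, j) = B $$ (i, j)" if "i < dim_row B" "j < dim_col B" for i j
    using mat_coeff_kern[of i n j A] mat_coeff_kern[of i n j B] that assms(2) by auto
qed (use assms in auto)

section \<open>Products, adjoints and the representation in terms of kernels\<close>

lemma mat_mult_index:
  assumes "A \<in> carrier_mat (n + 1) (n + 1)" "B \<in> carrier_mat (n + 1) (n + 1)" "i \<le> n" "j \<le> n"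
  shows "(A * B) $$ (i, j) = (\<Sum>r\<le>n. A $$ (i, r) * B $$ (r, j))"
  using assms by (auto simp: scalar_prod_def atLeast0LessThan lessThan_Suc_atMost)

lemma mat_adjoint_carrier:
  fixes A :: "complex mat"
  shows "A \<in> carrier_mat n m \<Longrightarrow> mat_adjoint A \<in> carrier_mat m n"
  unfolding mat_adjoint_def by (intro carrier_matI) simp_all

lemma mat_adjoint_index:
  fixes A :: "complex mat"
  shows "A \<in> carrier_mat n m \<Longrightarrow> i < m \<Longrightarrow> j < n \<Longrightarrow> mat_adjoint A $$ (i, j) = cnj (A $$ (j, i))"
  unfolding mat_adjoint_def by (auto simp: mat_of_rows_index)

lemma basis_poly_mult_cnj:
  "basis_poly n m z * cnj (basis_poly n m w) =
     of_nat (n choose m) * (z $ 1 * cnj (w $ 1)) ^ m * (z $ 2 * cnj (w $ 2)) ^ (n - m)"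
proof -
  have "complex_of_real (sqrt (real (n choose m))) * of_real (sqrt (real (n choose m))) = of_nat (n choose m)"
    by (simp flip: of_real_mult)
  moreover have "(s * x ^ m * y ^ k) * (s * x' ^ m * y' ^ k) = (s * s) * (x * x') ^ m * (y * y') ^ k"
    for s x y x' y' :: complex and k by (simp add: power_mult_distrib)
  ultimately show ?thesis
    unfolding basis_poly_def complex_cnj_mult complex_cnj_power complex_cnj_complex_of_real by (simp only:)
qed

lemma sum_basis_poly: "(\<Sum>m\<le>n. basis_poly n m z * cnj (basis_poly n m w)) = herm z w ^ n"
  by (simp add: basis_poly_mult_cnj herm_def binomial_ring)

lemma kern_one: "kern n (1\<^sub>m (n + 1)) z w = herm z w ^ n"
proof -
  have "kern n (1\<^sub>m (n + 1)) z w = (\<Sum>a\<le>n. \<Sum>b\<le>n. if a = b then basis_poly n a z * cnj (basis_poly n b w) else 0)"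
    unfolding kern_def by (intro sum.cong refl) auto
  then show ?thesis by (simp add: sum_basis_poly)
qed

text \<open>Column r of \<open>tau n k\<close> holds the coordinates of the substituted basis
  polynomial, so summing over the row index performs the substitution in the first variable.\<close>

lemma kern_tau_mult:
  assumes B: "B \<in> carrier_mat (n + 1) (n + 1)"
  shows "kern n (tau n k * B) z w = kern n B (matrix_inv k *v z) w"
proof -
  have t: "(\<Sum>a\<le>n. tau n k $$ (a, r) * basis_poly n a z) = basis_poly n r (matrix_inv k *v z)" if "r \<le> n" for r
    using fun_cong[OF tau_basis_poly[OF that, of k], of z] by (simp add: tau_op_def)
  have "kern n (tau n k * B) z w = (\<Sum>a\<le>n. \<Sum>b\<le>n. \<Sum>r\<le>n.
      tau n k $$ (a, r) * basis_poly n a z * (B $$ (r, b) * cnj (basis_poly n b w)))"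
    unfolding kern_def
    by (intro sum.cong refl) (simp add: mat_mult_index[OF tau_carrier B] sum_distrib_left sum_distrib_right mult_ac)
  also have "\<dots> = (\<Sum>r\<le>n. \<Sum>b\<le>n. \<Sum>a\<le>n. tau n k $$ (a, r) * basis_poly n a z * (B $$ (r, b) * cnj (basis_poly n b w)))"
    by (subst sum.swap, subst sum.swap[of _ "{..n}" "{..n}"], subst (2) sum.swap) (rule refl)
  also have "\<dots> = (\<Sum>r\<le>n. \<Sum>b\<le>n. basis_poly n r (matrix_inv k *v z) * (B $$ (r, b) * cnj (basis_poly n b w)))"
    by (intro sum.cong refl) (simp add: t flip: sum_distrib_right)
  finally show ?thesis unfolding kern_def by (simp add: mult_ac)
qed

lemma kern_adjoint:
  assumes "A \<in> carrier_mat (n + 1) (n + 1)"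
  shows "kern n (mat_adjoint A) z w = cnj (kern n A w z)"
proof -
  have "kern n (mat_adjoint A) z w = (\<Sum>a\<le>n. \<Sum>b\<le>n. cnj (A $$ (b, a)) * basis_poly n a z * cnj (basis_poly n b w))"
    unfolding kern_def using assms by (intro sum.cong refl) (simp add: mat_adjoint_index)
  also have "\<dots> = (\<Sum>b\<le>n. \<Sum>a\<le>n. cnj (A $$ (b, a)) * basis_poly n a z * cnj (basis_poly n b w))"
    by (rule sum.swap)
  finally show ?thesis unfolding kern_def by (simp add: mult_ac)
qed

lemma mat_adjoint_mult:
  fixes A B :: "complex mat"
  assumes A: "A \<in> carrier_mat (n + 1) (n + 1)" and B: "B \<in> carrier_mat (n + 1) (n + 1)"
  shows "mat_adjoint (A * B) = mat_adjoint B * mat_adjoint A"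
proof (rule eq_matI)
  fix i j assume "i < dim_row (mat_adjoint B * mat_adjoint A)" "j < dim_col (mat_adjoint B * mat_adjoint A)"
  then have ij: "i \<le> n" "j \<le> n"
    using mat_adjoint_carrier[OF A] mat_adjoint_carrier[OF B] by auto
  have AB: "A * B \<in> carrier_mat (n + 1) (n + 1)" using A B by simp
  show "mat_adjoint (A * B) $$ (i, j) = (mat_adjoint B * mat_adjoint A) $$ (i, j)"
    using ij by (simp add: mat_adjoint_index[OF AB] mat_mult_index[OF A B]
        mat_mult_index[OF mat_adjoint_carrier[OF B] mat_adjoint_carrier[OF A]]
        mat_adjoint_index[OF A] mat_adjoint_index[OF B] mult.commute)
qed (use mat_adjoint_carrier[OF A] mat_adjoint_carrier[OF B] mat_adjoint_carrier[of "A * B" "n + 1" "n + 1"] A B in auto)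

lemma mat_adjoint_adjoint:
  fixes A :: "complex mat"
  assumes A: "A \<in> carrier_mat (n + 1) (n + 1)"
  shows "mat_adjoint (mat_adjoint A) = A"
  using mat_adjoint_carrier[OF A] mat_adjoint_carrier[OF mat_adjoint_carrier[OF A]] A
  by (intro eq_matI) (auto simp: mat_adjoint_index[OF A] mat_adjoint_index[OF mat_adjoint_carrier[OF A]])

lemma kern_mult_adjoint_tau:
  assumes B: "B \<in> carrier_mat (n + 1) (n + 1)"
  shows "kern n (B * mat_adjoint (tau n k)) z w = kern n B z (matrix_inv k *v w)"
proof -
  note B' = mat_adjoint_carrier[OF B]
  have "B * mat_adjoint (tau n k) = mat_adjoint (tau n k * mat_adjoint B)"
    by (simp only: mat_adjoint_mult[OF tau_carrier B'] mat_adjoint_adjoint[OF B])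
  then have "kern n (B * mat_adjoint (tau n k)) z w = cnj (kern n (tau n k * mat_adjoint B) w z)"
    using kern_adjoint[of "tau n k * mat_adjoint B" n] tau_carrier[of n k] B' by simp
  also have "\<dots> = cnj (kern n (mat_adjoint B) (matrix_inv k *v w) z)"
    by (simp only: kern_tau_mult[OF B'])
  also have "\<dots> = kern n B z (matrix_inv k *v w)" by (simp add: kern_adjoint[OF B])
  finally show ?thesis .
qed

lemma kern_tau_conj:
  assumes B: "B \<in> carrier_mat (n + 1) (n + 1)"
  shows "kern n (tau n k * B * mat_adjoint (tau n k)) z w = kern n B (matrix_inv k *v z) (matrix_inv k *v w)"
  using kern_mult_adjoint_tau[of "tau n k * B" n k] kern_tau_mult[OF B] tau_carrier[of n k] B by simp

lemma SU2_matrix_inv: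
  assumes "k \<in> SU2"
  shows "matrix_inv k = (\<chi> i j. cnj (k $ j $ i))"
proof -
  have 1: "k ** (\<chi> i j. cnj (k $ j $ i)) = Finite_Cartesian_Product.mat 1" using assms by (simp add: SU2_def)
  have "matrix_inv k = matrix_inv k ** (k ** (\<chi> i j. cnj (k $ j $ i)))" unfolding 1 by simp
  also have "\<dots> = (\<chi> i j. cnj (k $ j $ i))"
    unfolding matrix_mul_assoc SU2_inv(2)[OF assms] by simp
  finally show ?thesis .
qed

lemma herm_adjoint: "herm (k *v z) w = herm z ((\<chi> i j. cnj (k $ j $ i)) *v w)"
  by (simp add: herm_def matrix_vector_mult_def sum_2 algebra_simps)

lemma herm_SU2:
  assumes "k \<in> SU2"
  shows "herm (k *v z) (k *v w) = herm z w" "herm (matrix_inv k *v z) (matrix_inv k *v w) = herm z w"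
proof -
  show "herm (k *v z) (k *v w) = herm z w"
    unfolding herm_adjoint SU2_matrix_inv[OF assms, symmetric] matrix_vector_mul_assoc SU2_inv(2)[OF assms] by simp
  have "herm (matrix_inv k *v z) (matrix_inv k *v w) = herm (k *v (matrix_inv k *v z)) w"
    unfolding herm_adjoint[of k] SU2_matrix_inv[OF assms, symmetric] ..
  then show "herm (matrix_inv k *v z) (matrix_inv k *v w) = herm z w"
    unfolding matrix_vector_mul_assoc SU2_inv(1)[OF assms] by simp
qed

text \<open>The kernel of the identity matrix is \<open>herm z w ^ n\<close>, which
  \<open>SU2\<close> leaves invariant; since kernels determine matrices, the identity is fixed by
  conjugation. The third part makes the inverse in \<open>equivariant\<close> accessible to the
  kernel calculus.\<close>

lemma tau_unitary:
  assumes "k \<in> SU2"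
  shows "tau n k * mat_adjoint (tau n k) = 1\<^sub>m (n + 1)" "mat_adjoint (tau n k) * tau n k = 1\<^sub>m (n + 1)"
    "the (mat_inverse (tau n k)) = mat_adjoint (tau n k)"
proof -
  note c = tau_carrier[of n k] mat_adjoint_carrier[OF tau_carrier[of n k]]
  show 1: "tau n k * mat_adjoint (tau n k) = 1\<^sub>m (n + 1)"
  proof (rule kern_inject)
    fix z w
    show "kern n (tau n k * mat_adjoint (tau n k)) z w = kern n (1\<^sub>m (n + 1)) z w"
      using kern_tau_conj[OF one_carrier_mat, of n k z w]
      by (simp only: right_mult_one_mat[OF c(1)] kern_one herm_SU2[OF assms])
  qed (use c in auto)
  show 2: "mat_adjoint (tau n k) * tau n k = 1\<^sub>m (n + 1)"
    using mat_mult_left_right_inverse[OF c 1] .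
  obtain B where B: "mat_inverse (tau n k) = Some B" using tau_invertible[OF assms] by blast
  then have B': "B * tau n k = 1\<^sub>m (n + 1)" "B \<in> carrier_mat (n + 1) (n + 1)"
    using mat_inverse(2)[OF c(1)] by auto
  have "B = B * (tau n k * mat_adjoint (tau n k))" unfolding 1 using B'(2) by simp
  also have "\<dots> = (B * tau n k) * mat_adjoint (tau n k)"
    using B'(2) c by (simp only: assoc_mult_mat)
  also have "\<dots> = mat_adjoint (tau n k)" unfolding B'(1) using c(2) by simp
  finally show "the (mat_inverse (tau n k)) = mat_adjoint (tau n k)" by (simp add: B)
qed

text \<open>Conjugation becomes a substitution in \<open>x\<close> and \<open>y\<close>, which
  commutes with Fourier transforms in \<open>z\<close>. Equivariance of transforms thus reduces to
  the behaviour of the scalar transform under rotations.\<close>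

lemma equivariant_iff:
  assumes F: "\<And>z. F z \<in> carrier_mat (n + 1) (n + 1)"
  shows "equivariant n F \<longleftrightarrow> (\<forall>\<theta>. \<forall>k\<in>SU2. \<forall>z x y.
     kern n (F (exp (\<i> * of_real \<theta>) *s (k *v z))) x y = kern n (F z) (matrix_inv k *v x) (matrix_inv k *v y))"
proof -
  have "F (exp (\<i> * of_real \<theta>) *s (k *v z)) = tau n k * F z * the (mat_inverse (tau n k)) \<longleftrightarrow>
    (\<forall>x y. kern n (F (exp (\<i> * of_real \<theta>) *s (k *v z))) x y = kern n (F z) (matrix_inv k *v x) (matrix_inv k *v y))"
    if k: "k \<in> SU2" for \<theta> k z
  proof -
    have "tau n k * F z * mat_adjoint (tau n k) \<in> carrier_mat (n + 1) (n + 1)"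
      using F[of z] tau_carrier[of n k] mat_adjoint_carrier[OF tau_carrier[of n k]] by auto
    then show ?thesis
      unfolding tau_unitary(3)[OF k] kern_tau_conj[OF F, symmetric] using kern_inject[OF F] by metis
  qed
  then show ?thesis unfolding equivariant_def by blast
qed

lemma kern_diag: 
  assumes "A \<in> carrier_mat (n + 1) (n + 1)" "\<And>a b. a \<le> n \<Longrightarrow> b \<le> n \<Longrightarrow> a \<noteq> b \<Longrightarrow> A $$ (a, b) = 0"
  shows "kern n A z w = (\<Sum>j\<le>n. A $$ (j, j) * (basis_poly n j z * cnj (basis_poly n j w)))"
proof -
  have "kern n A z w = (\<Sum>a\<le>n. \<Sum>b\<le>n. if a = b then A $$ (a, a) * (basis_poly n a z * cnj (basis_poly n a w)) else 0)"
    unfolding kern_def using assms(2) by (intro sum.cong refl) auto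
  then show ?thesis by simp
qed

lemma kern_E_mat: "j \<le> n \<Longrightarrow> kern n (E_mat n j) z w = basis_poly n j z * cnj (basis_poly n j w)"
  by (subst kern_diag) (auto simp: E_mat_def if_distrib[of "\<lambda>x. x * _"] cong: if_cong)

text \<open>Stated off the sphere as well, since the measurability of the projections is derived
  from a formula valid at every nonzero \<zeta>.\<close>

lemma k_mat_inv:
  assumes "\<zeta> \<noteq> 0"
  shows "matrix_inv (k_mat \<zeta>) *v z = vector [uc \<zeta> z / of_real ((norm \<zeta>)\<^sup>2), vc \<zeta> z / of_real ((norm \<zeta>)\<^sup>2)]"
proof -
  let ?x = "complex_of_real ((norm \<zeta>)\<^sup>2)"
  define l :: "complex ^ 2 ^ 2" where
    "l = vector [vector [\<zeta> $ 2 / ?x, - (\<zeta> $ 1) / ?x], vector [cnj (\<zeta> $ 1) / ?x, cnj (\<zeta> $ 2) / ?x]]"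
  have x: "?x = \<zeta> $ 1 * cnj (\<zeta> $ 1) + \<zeta> $ 2 * cnj (\<zeta> $ 2)" "?x \<noteq> 0"
    using assms by (auto simp: of_real_norm_C2[symmetric])
  have 1: "k_mat \<zeta> ** l = Finite_Cartesian_Product.mat 1" "l ** k_mat \<zeta> = Finite_Cartesian_Product.mat 1"
    using x(2) by (simp_all add: vec_eq_iff forall_2 matrix_matrix_mult_def sum_2 l_def k_mat_def
        Finite_Cartesian_Product.mat_def divide_simps del: of_real_power) (simp_all add: x(1)[unfolded of_real_power] algebra_simps)
  have "matrix_inv (k_mat \<zeta>) = l"
  proof -
    have "\<exists>k'. k_mat \<zeta> ** k' = Finite_Cartesian_Product.mat 1 \<and> k' ** k_mat \<zeta> = Finite_Cartesian_Product.mat 1"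
      using 1 by blast
    from someI_ex[OF this] have "matrix_inv (k_mat \<zeta>) ** k_mat \<zeta> = Finite_Cartesian_Product.mat 1"
      unfolding matrix_inv_def by blast
    then show ?thesis by (metis 1(1) matrix_mul_assoc matrix_mul_lid matrix_mul_rid)
  qed
  then show ?thesis
    by (simp add: vec_eq_iff forall_2 matrix_vector_mult_def sum_2 l_def uc_def vc_def diff_divide_distrib add_divide_distrib)
qed

section \<open>Inversion of the spherical transform\<close>

text \<open>The value at 0 is the unit vector for which \<open>k_mat\<close> is the identity, so
  that \<open>symbol_axis\<close> includes r = 0.\<close>

definition unit_dir :: "C2 \<Rightarrow> C2" where
  "unit_dir \<zeta> = (if \<zeta> = 0 then axis 2 1 else sgn \<zeta>)"

lemma norm_unit_dir [simp]: "norm (unit_dir \<zeta>) = 1"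
proof -
  have "norm (axis 2 1 :: C2) = 1" by (simp add: norm_vec_def L2_set_def sum_2 axis_def)
  then show ?thesis by (simp add: unit_dir_def norm_sgn)
qed

definition diag_at :: "nat \<Rightarrow> (real \<times> real \<Rightarrow> complex) \<Rightarrow> real \<Rightarrow> complex mat" where
  "diag_at n g \<xi> = Matrix.mat (n + 1) (n + 1) (\<lambda>(i, j). if i = j then g (\<xi>, (2 * real i - real n) * \<xi>) else 0)"

lemma diag_at_carrier: "diag_at n g \<xi> \<in> carrier_mat (n + 1) (n + 1)"
  by (simp add: diag_at_def)

definition symbol :: "nat \<Rightarrow> (real \<times> real \<Rightarrow> complex) \<Rightarrow> C2 \<Rightarrow> complex mat" where
  "symbol n g \<zeta> = tau n (k_mat (unit_dir \<zeta>)) * diag_at n g ((norm \<zeta>)\<^sup>2) * mat_adjoint (tau n (k_mat (unit_dir \<zeta>)))"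

lemma tau_conj_carrier:
  "B \<in> carrier_mat (n + 1) (n + 1) \<Longrightarrow> tau n k * B * mat_adjoint (tau n k) \<in> carrier_mat (n + 1) (n + 1)"
  using tau_carrier[of n k] mat_adjoint_carrier[OF tau_carrier[of n k]] by auto

lemma symbol_carrier: "symbol n g \<zeta> \<in> carrier_mat (n + 1) (n + 1)"
  unfolding symbol_def by (rule tau_conj_carrier[OF diag_at_carrier])

lemma k_mat_inv_unit:
  assumes "norm u = 1"
  shows "matrix_inv (k_mat u) *v z = vector [uc u z, vc u z]"
proof -
  have "u \<noteq> 0" using assms by auto
  then show ?thesis using k_mat_inv[of u z] assms by simp
qed

lemma basis_poly_prod:
  "basis_poly n j (vector [x, y]) * cnj (basis_poly n j (vector [x', y'])) =
     of_nat (n choose j) * (x * cnj x') ^ j * (y * cnj y') ^ (n - j)"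
  by (simp only: basis_poly_mult_cnj vector_2)

text \<open>The normalising factors of the frame combine to the quotient \<open>alpha\<close>. At 0
  all eigenvalues equal \<open>g 0\<close>, and the binomial theorem removes the frame.\<close>

lemma kern_symbol: "kern n (symbol n g \<zeta>) z w = ker_fun n g z w \<zeta>"
proof -
  let ?u = "unit_dir \<zeta>"
  let ?G = "\<lambda>j. g ((norm \<zeta>)\<^sup>2, (2 * real j - real n) * (norm \<zeta>)\<^sup>2)"
  let ?a = "uc ?u z * cnj (uc ?u w)" and ?b = "vc ?u z * cnj (vc ?u w)"
  have "kern n (symbol n g \<zeta>) z w = kern n (diag_at n g ((norm \<zeta>)\<^sup>2)) (vector [uc ?u z, vc ?u z]) (vector [uc ?u w, vc ?u w])"
    unfolding symbol_def kern_tau_conj[OF diag_at_carrier] k_mat_inv_unit[OF norm_unit_dir] ..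
  also have "\<dots> = binom_sum n ?G ?a ?b"
    by (subst kern_diag) (auto simp: diag_at_def basis_poly_prod binom_sum_def mult_ac)
  also have "\<dots> = ker_fun n g z w \<zeta>"
  proof (cases "\<zeta> = 0")
    case True
    have "binom_sum n (\<lambda>_. g 0) ?a ?b = g 0 * binom_sum n (\<lambda>_. 1) ?a ?b"
      using binom_sum_linear(3)[of n "g 0" "\<lambda>_. 1"] by simp
    also have "\<dots> = g 0 * (?a + ?b) ^ n" by (simp add: binom_sum_def binomial_ring)
    finally show ?thesis unfolding uc_vc True ker_fun_0 by (simp add: zero_prod_def)
  next
    case False
    have u: "?u $ i = \<zeta> $ i / of_real (norm \<zeta>)" for i
      using False by (simp add: unit_dir_def sgn_div_norm scaleR_conv_of_real[where 'a = complex] divide_inverse mult.commute)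
    have "uc ?u x = uc \<zeta> x / of_real (norm \<zeta>)" "vc ?u x = vc \<zeta> x / of_real (norm \<zeta>)" for x
      by (simp_all add: uc_def vc_def u diff_divide_distrib add_divide_distrib)
    then have "?a = alpha z w \<zeta>" "?b = herm z w - alpha z w \<zeta>"
      unfolding herm_minus_alpha[OF False] by (simp_all add: alpha_def power2_eq_square)
    then show ?thesis by (simp only: ker_fun_def)
  qed
  finally show ?thesis .
qed

lemma symbol_entry:
  "a \<le> n \<Longrightarrow> b \<le> n \<Longrightarrow> symbol n g \<zeta> $$ (a, b) = mat_coeff n a b (\<lambda>z w. ker_fun n g z w \<zeta>)"
  using mat_coeff_kern[of a n b "symbol n g \<zeta>"] kern_symbol[of n g \<zeta>] by (metis (no_types, lifting) ext)

text \<open>At fixed arguments the tame families form a class that is closed under partial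
  derivatives and decays to every order.\<close>

lemma schwartz_tame:
  assumes "tame \<Psi>" and g: "schwartz g" and zw: "norm z \<le> 1" "norm w \<le> 1"
  shows "schwartz (\<Psi> n g z w)"
proof -
  define X where "X h \<longleftrightarrow> (\<exists>\<Psi>. tame \<Psi> \<and> h = \<Psi> n g z w)" for h
  have "X (\<Psi> n g z w)" using assms(1) unfolding X_def by blast
  then show ?thesis
  proof (coinduct rule: schwartz_coinduct[where X = X])
    case (decay h N)
    then obtain \<Psi> where \<Psi>: "tame \<Psi>" "h = \<Psi> n g z w" unfolding X_def by blast
    obtain M C d where "\<And>n g c z w \<zeta>. schwartz g \<Longrightarrow> seminorm_le M g c \<Longrightarrow> norm z \<le> 1 \<Longrightarrow> norm w \<le> 1 \<Longrightarrow>
       (1 + (norm \<zeta>)\<^sup>2) ^ N * cmod (\<Psi> n g z w \<zeta>) \<le> C * real (n + 1) ^ d * c"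
      using tame_bound[OF \<Psi>(1), of N] by blast
    from this[OF g seminorm_le_schwartz_norm[OF g] zw] show ?case unfolding \<Psi>(2) by blast
  next
    case (step h)
    then obtain \<Psi> where \<Psi>: "tame \<Psi>" "h = \<Psi> n g z w" unfolding X_def by blast
    from tame_has_derivative[OF \<Psi>(1)] obtain \<Psi>' where \<Psi>': "\<forall>b. tame (\<Psi>' b)" "\<forall>n g z w \<zeta>. schwartz g \<longrightarrow>
       (\<Psi> n g z w has_derivative (\<lambda>h. \<Sum>b\<in>Basis. (h \<bullet> b) *\<^sub>R \<Psi>' b n g z w \<zeta>)) (at \<zeta>)" by blast
    show ?case
      using \<Psi>' g unfolding X_def \<Psi>(2) by (intro exI[of _ "\<lambda>b. \<Psi>' b n g z w"]) blast
  qed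
qed

lemma tame_ker_fun: "tame (\<lambda>n g. ker_fun n g)"
  using tame_ker[OF opr_id, of 0] by simp

lemma schwartz_ker_fun_pt:
  "schwartz g \<Longrightarrow> norm z = 1 \<Longrightarrow> norm w = 1 \<Longrightarrow> schwartz (ker_fun n g z w)"
  using schwartz_tame[OF tame_ker_fun] by simp

lemma schwartz_symbol:
  assumes "schwartz g" "a \<le> n" "b \<le> n"
  shows "schwartz (\<lambda>\<zeta>. symbol n g \<zeta> $$ (a, b))"
  unfolding symbol_entry[OF assms(2,3)] mat_coeff_def using assms
  by (intro schwartz_sum schwartz_cmult schwartz_ker_fun_pt norm_pt)

lemma mat_coeff_inv_fourier:
  assumes "\<And>z w. norm z = 1 \<Longrightarrow> norm w = 1 \<Longrightarrow> schwartz (K z w)" "a \<le> n" "b \<le> n"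
  shows "inv_fourier (\<lambda>\<zeta>. mat_coeff n a b (\<lambda>z w. K z w \<zeta>)) x = mat_coeff n a b (\<lambda>z w. inv_fourier (K z w) x)"
proof -
  have s: "schwartz (\<lambda>\<zeta>. ecoef n a b k l * K (pt n a k) (pt n b l) \<zeta>)" for k l
    by (intro schwartz_cmult assms(1) norm_pt assms(2,3))
  have "fourier (\<lambda>\<zeta>. mat_coeff n a b (\<lambda>z w. K z w \<zeta>)) y = mat_coeff n a b (\<lambda>z w. fourier (K z w) y)" for y
  proof -
    have "fourier (\<lambda>\<zeta>. mat_coeff n a b (\<lambda>z w. K z w \<zeta>)) y =
        (\<Sum>k\<le>n. fourier (\<lambda>\<zeta>. \<Sum>l\<le>n. ecoef n a b k l * K (pt n a k) (pt n b l) \<zeta>) y)"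
      unfolding mat_coeff_def by (intro fourier_sum schwartz_integrable schwartz_sum s)
    also have "\<dots> = (\<Sum>k\<le>n. \<Sum>l\<le>n. fourier (\<lambda>\<zeta>. ecoef n a b k l * K (pt n a k) (pt n b l) \<zeta>) y)"
      by (intro sum.cong refl fourier_sum schwartz_integrable s)
    finally show ?thesis by (simp only: fourier_cmult mat_coeff_def)
  qed
  then show ?thesis
    unfolding inv_fourier_def by (simp add: mat_coeff_def sum_distrib_left mult_ac)
qed

section \<open>Fourier transforms of matrix functions, and equivariance\<close>

lemma fourier_kern:
  assumes "\<And>a b. a \<le> n \<Longrightarrow> b \<le> n \<Longrightarrow> schwartz (\<lambda>z. F z $$ (a, b))"
  shows "fourier (\<lambda>z. kern n (F z) x y) \<zeta> =
    kern n (Matrix.mat (n + 1) (n + 1) (\<lambda>(a, b). fourier (\<lambda>z. F z $$ (a, b)) \<zeta>)) x y"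
    "schwartz (\<lambda>z. kern n (F z) x y)"
proof -
  let ?c = "\<lambda>a b. basis_poly n a x * cnj (basis_poly n b y)"
  have eq: "(\<lambda>z. kern n (F z) x y) = (\<lambda>z. \<Sum>a\<le>n. \<Sum>b\<le>n. ?c a b * F z $$ (a, b))"
    unfolding kern_def by (simp add: mult_ac)
  have s: "schwartz (\<lambda>z. ?c a b * F z $$ (a, b))" if "a \<le> n" "b \<le> n" for a b
    by (intro schwartz_cmult assms that)
  then show "schwartz (\<lambda>z. kern n (F z) x y)" unfolding eq by (intro schwartz_sum) auto
  have "fourier (\<lambda>z. kern n (F z) x y) \<zeta> = (\<Sum>a\<le>n. fourier (\<lambda>z. \<Sum>b\<le>n. ?c a b * F z $$ (a, b)) \<zeta>)"
    unfolding eq using s by (intro fourier_sum schwartz_integrable schwartz_sum) auto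
  also have "\<dots> = (\<Sum>a\<le>n. \<Sum>b\<le>n. ?c a b * fourier (\<lambda>z. F z $$ (a, b)) \<zeta>)"
  proof (intro sum.cong refl)
    fix a assume a: "a \<in> {..n}"
    have "fourier (\<lambda>z. \<Sum>b\<le>n. ?c a b * F z $$ (a, b)) \<zeta> = (\<Sum>b\<le>n. fourier (\<lambda>z. ?c a b * F z $$ (a, b)) \<zeta>)"
      using s a by (intro fourier_sum schwartz_integrable) auto
    then show "fourier (\<lambda>z. \<Sum>b\<le>n. ?c a b * F z $$ (a, b)) \<zeta> = (\<Sum>b\<le>n. ?c a b * fourier (\<lambda>z. F z $$ (a, b)) \<zeta>)"
      by (simp only: fourier_cmult)
  qed
  also have "\<dots> = kern n (Matrix.mat (n + 1) (n + 1) (\<lambda>(a, b). fourier (\<lambda>z. F z $$ (a, b)) \<zeta>)) x y"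
    unfolding kern_def by (intro sum.cong refl) (simp add: mult_ac)
  finally show "fourier (\<lambda>z. kern n (F z) x y) \<zeta> =
    kern n (Matrix.mat (n + 1) (n + 1) (\<lambda>(a, b). fourier (\<lambda>z. F z $$ (a, b)) \<zeta>)) x y" .
qed

definition mat_fourier :: "nat \<Rightarrow> (C2 \<Rightarrow> complex mat) \<Rightarrow> C2 \<Rightarrow> complex mat" where
  "mat_fourier n F \<zeta> = Matrix.mat (n + 1) (n + 1) (\<lambda>(a, b). fourier (\<lambda>z. F z $$ (a, b)) \<zeta>)"

definition mat_inv_fourier :: "nat \<Rightarrow> (C2 \<Rightarrow> complex mat) \<Rightarrow> C2 \<Rightarrow> complex mat" where
  "mat_inv_fourier n F z = Matrix.mat (n + 1) (n + 1) (\<lambda>(a, b). inv_fourier (\<lambda>\<zeta>. F \<zeta> $$ (a, b)) z)"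

lemma mat_fourier_carrier: "mat_fourier n F \<zeta> \<in> carrier_mat (n + 1) (n + 1)"
  and mat_inv_fourier_carrier: "mat_inv_fourier n F \<zeta> \<in> carrier_mat (n + 1) (n + 1)"
  by (simp_all add: mat_fourier_def mat_inv_fourier_def)

lemma kern_smult: "A \<in> carrier_mat (n + 1) (n + 1) \<Longrightarrow> kern n (c \<cdot>\<^sub>m A) x y = c * kern n A x y"
  unfolding kern_def by (simp add: sum_distrib_left mult_ac)

lemma inv_fourier_kern:
  assumes "\<And>a b. a \<le> n \<Longrightarrow> b \<le> n \<Longrightarrow> schwartz (\<lambda>z. F z $$ (a, b))"
  shows "kern n (mat_inv_fourier n F z) x y = inv_fourier (\<lambda>\<zeta>. kern n (F \<zeta>) x y) z"
proof -
  have "mat_inv_fourier n F z = of_real (inverse ((2 * pi) ^ DIM(C2))) \<cdot>\<^sub>m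
      Matrix.mat (n + 1) (n + 1) (\<lambda>(a, b). fourier (\<lambda>z. F z $$ (a, b)) (- z))"
    by (rule eq_matI) (auto simp: mat_inv_fourier_def inv_fourier_def)
  moreover have "Matrix.mat (n + 1) (n + 1) (\<lambda>(a, b). fourier (\<lambda>z. F z $$ (a, b)) (- z)) \<in> carrier_mat (n + 1) (n + 1)"
    by simp
  moreover note fourier_kern(1)[of n F x y "- z", OF assms]
  ultimately show ?thesis by (simp only: inv_fourier_def kern_smult)
qed

lemma SU2_action_orthogonal:
  assumes k: "k \<in> SU2"
  shows "orthogonal_transformation (\<lambda>z. exp (\<i> * of_real \<theta>) *s (k *v z))"
  unfolding orthogonal_transformation
proof
  show "linear (\<lambda>z. exp (\<i> * of_real \<theta>) *s (k *v z))"
    by (rule linearI) (simp_all add: vec_eq_iff matrix_vector_mult_def sum_2 scaleR_conv_of_real[where 'a = complex] algebra_simps)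
  show "\<forall>v. norm (exp (\<i> * of_real \<theta>) *s (k *v v)) = norm v"
  proof
    fix v :: C2
    have "complex_of_real ((norm (k *v v))\<^sup>2) = of_real ((norm v)\<^sup>2)"
      using herm_SU2(1)[OF k, of v v] by (simp only: herm_self)
    then have "(norm (k *v v))\<^sup>2 = (norm v)\<^sup>2" by (simp only: of_real_eq_iff)
    moreover have "(norm (exp (\<i> * of_real \<theta>) *s (k *v v)))\<^sup>2 = (norm (k *v v))\<^sup>2"
      by (simp add: norm_C2 norm_mult)
    ultimately show "norm (exp (\<i> * of_real \<theta>) *s (k *v v)) = norm v"
      by (metis norm_ge_zero power2_eq_imp_eq)
  qed
qed

text \<open>Up to sign \<open>uc \<zeta> z\<close> is the determinant with columns \<zeta> and z,
  hence unchanged when \<open>SU2\<close> acts on both; the phase cancels against its conjugate in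
  \<open>alpha\<close>.\<close>

lemma ker_fun_equivariant:
  assumes k: "k \<in> SU2"
  shows "ker_fun n g x y (exp (\<i> * of_real \<theta>) *s (k *v \<zeta>)) =
    ker_fun n g (matrix_inv k *v x) (matrix_inv k *v y) \<zeta>"
proof -
  let ?T = "\<lambda>\<zeta>. exp (\<i> * of_real \<theta>) *s (k *v \<zeta>)"
  have norm: "norm (?T \<zeta>) = norm \<zeta>"
    using orthogonal_transformation_norm[OF SU2_action_orthogonal[OF k]] .
  have d: "k $ 1 $ 1 * k $ 2 $ 2 - k $ 1 $ 2 * k $ 2 $ 1 = 1"
    using k by (simp add: SU2_def det_2)
  have "uc (?T \<zeta>) (k *v x) = exp (\<i> * of_real \<theta>) * uc \<zeta> x" for x
  proof -
    have "uc (?T \<zeta>) (k *v x) = exp (\<i> * of_real \<theta>) * ((k $ 1 $ 1 * k $ 2 $ 2 - k $ 1 $ 2 * k $ 2 $ 1) * uc \<zeta> x)"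
      by (simp add: uc_def matrix_vector_mult_def sum_2 algebra_simps)
    then show ?thesis unfolding d by simp
  qed
  from this[of "matrix_inv k *v _"] have u: "uc (?T \<zeta>) x = exp (\<i> * of_real \<theta>) * uc \<zeta> (matrix_inv k *v x)" for x
    by (simp add: matrix_vector_mul_assoc SU2_inv[OF k])
  have "exp (\<i> * of_real \<theta>) * cnj (exp (\<i> * of_real \<theta>)) = 1"
    using complex_norm_square[of "exp (\<i> * of_real \<theta>)"] by simp
  then have "uc (?T \<zeta>) x * cnj (uc (?T \<zeta>) y) = uc \<zeta> (matrix_inv k *v x) * cnj (uc \<zeta> (matrix_inv k *v y))"
    unfolding u complex_cnj_mult by (metis (no_types, lifting) mult.assoc mult.left_commute mult_1)
  then show ?thesis
    by (simp only: ker_fun_def alpha_def norm herm_SU2(2)[OF k])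
qed

lemma mat_inv_fourier_symbol_schwartz_K:
  assumes g: "schwartz g"
  shows "mat_inv_fourier n (symbol n g) \<in> schwartz_K n"
  unfolding schwartz_K_def
proof (intro CollectI conjI allI impI)
  show "mat_inv_fourier n (symbol n g) z \<in> carrier_mat (n + 1) (n + 1)" for z
    by (rule mat_inv_fourier_carrier)
  show "schwartz (\<lambda>z. mat_inv_fourier n (symbol n g) z $$ (a, b))" if "a \<le> n" "b \<le> n" for a b
    using schwartz_inv_fourier[OF schwartz_symbol[OF g that]] that by (simp add: mat_inv_fourier_def)
  show "equivariant n (mat_inv_fourier n (symbol n g))"
    unfolding equivariant_iff[OF mat_inv_fourier_carrier]
  proof (intro allI ballI)
    fix \<theta> k z x y assume k: "k \<in> SU2"
    let ?T = "\<lambda>\<zeta>. exp (\<i> * of_real \<theta>) *s (k *v \<zeta>)"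
    have s: "schwartz (ker_fun n g x y)" for x y
      using fourier_kern(2)[of n "symbol n g" x y] schwartz_symbol[OF g] by (simp add: kern_symbol)
    have kf: "kern n (mat_inv_fourier n (symbol n g) z) x y = inv_fourier (ker_fun n g x y) z" for x y z
      using inv_fourier_kern[of n "symbol n g"] schwartz_symbol[OF g] by (simp add: kern_symbol)
    show "kern n (mat_inv_fourier n (symbol n g) (?T z)) x y =
        kern n (mat_inv_fourier n (symbol n g) z) (matrix_inv k *v x) (matrix_inv k *v y)"
      unfolding kf inv_fourier_orthogonal[OF schwartz_measurable[OF s] SU2_action_orthogonal[OF k]]
        ker_fun_equivariant[OF k] ..
  qed
qed

lemma mat_fourier_equivariant:
  assumes F: "F \<in> schwartz_K n"
  shows "equivariant n (mat_fourier n F)"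
  unfolding equivariant_iff[OF mat_fourier_carrier]
proof (intro allI ballI)
  fix \<theta> k \<zeta> x y assume k: "k \<in> SU2"
  let ?T = "\<lambda>\<zeta>. exp (\<i> * of_real \<theta>) *s (k *v \<zeta>)"
  have Fs: "schwartz (\<lambda>z. F z $$ (a, b))" if "a \<le> n" "b \<le> n" for a b
    using F that by (simp add: schwartz_K_def)
  have eq: "kern n (F (?T z)) x y = kern n (F z) (matrix_inv k *v x) (matrix_inv k *v y)" for z
    using F k equivariant_iff[of F n] by (simp add: schwartz_K_def)
  have kf: "kern n (mat_fourier n F \<zeta>) x y = fourier (\<lambda>z. kern n (F z) x y) \<zeta>" for x y \<zeta>
    using fourier_kern(1)[of n F x y \<zeta>, OF Fs] by (simp only: mat_fourier_def)
  show "kern n (mat_fourier n F (?T \<zeta>)) x y = kern n (mat_fourier n F \<zeta>) (matrix_inv k *v x) (matrix_inv k *v y)"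
  proof -
    have "fourier (\<lambda>z. kern n (F z) x y) (?T \<zeta>) = fourier (\<lambda>z. kern n (F (?T z)) x y) \<zeta>"
      by (rule fourier_orthogonal[OF schwartz_measurable[OF fourier_kern(2)[of n F, OF Fs]] SU2_action_orthogonal[OF k]])
    then show ?thesis by (simp only: kf eq)
  qed
qed

text \<open>The diagonal torus element with entries \<open>cis \<theta>\<close> and
  \<open>cis (- \<theta>)\<close>, combined with the scalar phase \<open>cis \<theta>\<close>, fixes
  the second axis. The basis polynomials are eigenvectors of the torus with distinct weights, so
  invariance kills the off-diagonal entries.\<close>

lemma equivariant_axis_diag:
  assumes G: "\<And>z. G z \<in> carrier_mat (n + 1) (n + 1)" and eq: "equivariant n G"
    and ab: "a \<le> n" "b \<le> n" "a \<noteq> b"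
  shows "G (axis 2 (of_real r)) $$ (a, b) = 0"
proof -
  \<comment> \<open>For this angle the factor of entry (a, b) is \<open>cis pi\<close>, that is
    -1.\<close>
  define \<theta> where "\<theta> = pi / (2 * (real b - real a))"
  define k :: "complex ^ 2 ^ 2" where "k = vector [vector [cis \<theta>, 0], vector [0, cis (- \<theta>)]]"
  have k: "k \<in> SU2"
    by (simp add: SU2_def k_def vec_eq_iff forall_2 matrix_matrix_mult_def sum_2 det_2
        Finite_Cartesian_Product.mat_def cis_mult cis_cnj)
  let ?A = "G (axis 2 (of_real r))"
  define B where "B = Matrix.mat (n + 1) (n + 1) (\<lambda>(i, j). cis (2 * \<theta> * (real j - real i)) * ?A $$ (i, j))"
  have fixed: "exp (\<i> * of_real \<theta>) *s (k *v axis 2 (of_real r)) = axis 2 (of_real r)"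
    by (simp add: vec_eq_iff forall_2 matrix_vector_mult_def sum_2 k_def axis_def cis_conv_exp[symmetric])
       (simp add: mult.assoc[symmetric] cis_mult)
  have inv: "matrix_inv k *v x = vector [cis (- \<theta>) * x $ 1, cis \<theta> * x $ 2]" for x
    unfolding SU2_matrix_inv[OF k]
    by (simp add: vec_eq_iff forall_2 matrix_vector_mult_def sum_2 k_def cis_cnj)
  have e: "basis_poly n i (matrix_inv k *v x) = cis (\<theta> * (real n - 2 * real i)) * basis_poly n i x" if "i \<le> n" for i x
  proof -
    have "cis (- \<theta>) ^ i * cis \<theta> ^ (n - i) = cis (\<theta> * (real n - 2 * real i))"
      unfolding Complex.DeMoivre cis_mult using that by (simp add: of_nat_diff algebra_simps)
    then show ?thesis
      unfolding inv basis_poly_def by (simp add: power_mult_distrib)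
  qed
  have "?A = B"
  proof (rule kern_inject[OF G])
    show "B \<in> carrier_mat (n + 1) (n + 1)" by (simp add: B_def)
    fix x y
    have "kern n ?A x y = kern n ?A (matrix_inv k *v x) (matrix_inv k *v y)"
      using eq k unfolding equivariant_iff[OF G] by (metis fixed)
    also have "\<dots> = kern n B x y"
      unfolding kern_def
    proof (intro sum.cong refl)
      fix i j assume "i \<in> {..n}" "j \<in> {..n}"
      then have ij: "i \<le> n" "j \<le> n" by auto
      have "cis (\<theta> * (real n - 2 * real i)) * cnj (cis (\<theta> * (real n - 2 * real j))) = cis (2 * \<theta> * (real j - real i))"
        by (simp add: cis_cnj cis_mult algebra_simps)
      moreover have "B $$ (i, j) = cis (2 * \<theta> * (real j - real i)) * ?A $$ (i, j)"
        using ij by (simp add: B_def)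
      moreover have "A * (c * X) * (d * Y) = (c * d) * A * X * Y" for A c X d Y :: complex by simp
      ultimately show "?A $$ (i, j) * basis_poly n i (matrix_inv k *v x) * cnj (basis_poly n j (matrix_inv k *v y)) =
          B $$ (i, j) * basis_poly n i x * cnj (basis_poly n j y)"
        unfolding e[OF ij(1)] e[OF ij(2)] complex_cnj_mult by (simp only:)
    qed
    finally show "kern n ?A x y = kern n B x y" .
  qed
  then have "?A $$ (a, b) = B $$ (a, b)" by simp
  also have "\<dots> = cis (2 * \<theta> * (real b - real a)) * ?A $$ (a, b)" using ab by (simp add: B_def)
  also have "2 * \<theta> * (real b - real a) = pi" using ab by (simp add: \<theta>_def field_simps)
  finally show ?thesis by simp
qed

text \<open>The second equation expresses that \<open>G\<close> is even, since the phase at angle pi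
  acts trivially on values. It absorbs the minus sign in the argument of the spherical
  function.\<close>

lemma equivariant_radial:
  assumes eq: "equivariant n G" and u: "norm u = 1"
  shows "G (r *\<^sub>R u) = tau n (k_mat u) * G (axis 2 (of_real r)) * mat_adjoint (tau n (k_mat u))"
    "G (- (r *\<^sub>R u)) = tau n (k_mat u) * G (axis 2 (of_real r)) * mat_adjoint (tau n (k_mat u))"
proof -
  have k: "k_mat u \<in> SU2" by (rule k_mat_SU2[OF u])
  have "k_mat u *v axis 2 (of_real r) = r *\<^sub>R u"
    by (simp add: k_mat_def vec_eq_iff forall_2 matrix_vector_mult_def sum_2 axis_def scaleR_conv_of_real[where 'a = complex] mult.commute)
  then have act: "G (exp (\<i> * of_real \<theta>) *s (r *\<^sub>R u)) =
      tau n (k_mat u) * G (axis 2 (of_real r)) * mat_adjoint (tau n (k_mat u))" for \<theta>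
    using eq k unfolding equivariant_def tau_unitary(3)[OF k, symmetric] by metis
  have "exp (\<i> * of_real 0) *s (r *\<^sub>R u) = r *\<^sub>R u" "exp (\<i> * of_real pi) *s (r *\<^sub>R u) = - (r *\<^sub>R u)"
    by (simp_all add: vec_eq_iff mult.commute[of \<i>] exp_pi_i)
  then show "G (r *\<^sub>R u) = tau n (k_mat u) * G (axis 2 (of_real r)) * mat_adjoint (tau n (k_mat u))"
    "G (- (r *\<^sub>R u)) = tau n (k_mat u) * G (axis 2 (of_real r)) * mat_adjoint (tau n (k_mat u))"
    using act[of 0] act[of pi] by simp_all
qed

section \<open>Traces against rank one projections, and the surface measure\<close>

lemma mat_trace_mult_commute:
  assumes "A \<in> carrier_mat (n + 1) (n + 1)" "B \<in> carrier_mat (n + 1) (n + 1)"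
  shows "mat_trace (A * B) = mat_trace (B * A)"
proof -
  have t: "mat_trace (X * Y) = (\<Sum>i\<le>n. \<Sum>r\<le>n. X $$ (i, r) * Y $$ (r, i))"
    if "X \<in> carrier_mat (n + 1) (n + 1)" "Y \<in> carrier_mat (n + 1) (n + 1)" for X Y :: "complex mat"
    using that mat_mult_index[OF that] by (simp add: mat_trace_def lessThan_Suc_atMost)
  show ?thesis
    unfolding t[OF assms] t[OF assms(2,1)] by (subst sum.swap) (simp add: mult.commute)
qed

lemma mat_trace_mult:
  assumes "A \<in> carrier_mat (n + 1) (n + 1)" "B \<in> carrier_mat (n + 1) (n + 1)"
  shows "mat_trace (A * B) = (\<Sum>a\<le>n. \<Sum>b\<le>n. A $$ (a, b) * B $$ (b, a))"
  using assms mat_mult_index[OF assms] by (simp add: mat_trace_def lessThan_Suc_atMost)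

lemma E_mat_carrier: "E_mat n j \<in> carrier_mat (n + 1) (n + 1)"
  by (simp add: E_mat_def)

lemma conj_mult:
  fixes t s D E :: "complex mat"
  assumes c: "t \<in> carrier_mat N N" "s \<in> carrier_mat N N" "D \<in> carrier_mat N N" "E \<in> carrier_mat N N"
    and st: "s * t = 1\<^sub>m N"
  shows "(t * D * s) * (t * E * s) = (t * (D * E)) * s" "s * (t * D) = D"
proof -
  note assoc = assoc_mult_mat[of _ N N _ N _ N]
  have cancel: "s * (t * X) = X" if "X \<in> carrier_mat N N" for X
    using assoc_mult_mat[OF c(2,1) that] that unfolding st by simp
  then show "s * (t * D) = D" using c by blast
  have "(t * D * s) * (t * E * s) = t * (D * (s * (t * (E * s))))"
    using c by (simp add: assoc)
  also have "s * (t * (E * s)) = E * s" using c by (intro cancel) simp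
  finally show "(t * D * s) * (t * E * s) = (t * (D * E)) * s"
    using c by (simp add: assoc)
qed

text \<open>Unitarity and cyclicity of the trace reduce everything to the trace of
  \<open>D * E_mat n j\<close>.\<close>

lemma mat_trace_tau_conj:
  assumes k: "k \<in> SU2" and D: "D \<in> carrier_mat (n + 1) (n + 1)" and j: "j \<le> n"
  shows "mat_trace ((tau n k * D * mat_adjoint (tau n k)) * (tau n k * E_mat n j * mat_adjoint (tau n k))) = D $$ (j, j)"
proof -
  let ?t = "tau n k" and ?s = "mat_adjoint (tau n k)" and ?E = "E_mat n j"
  note t = tau_carrier[of n k] and s = mat_adjoint_carrier[OF tau_carrier[of n k]] and E = E_mat_carrier[of n j]
  have DE: "D * ?E \<in> carrier_mat (n + 1) (n + 1)" using D E by simp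
  have "mat_trace ((?t * D * ?s) * (?t * ?E * ?s)) = mat_trace (?s * (?t * (D * ?E)))"
    unfolding conj_mult(1)[OF t s D E tau_unitary(2)[OF k]]
    using t DE by (intro mat_trace_mult_commute[OF _ s]) simp
  also have "?s * (?t * (D * ?E)) = D * ?E"
    by (rule conj_mult(2)[OF t s DE E tau_unitary(2)[OF k]])
  also have "mat_trace (D * ?E) = (\<Sum>a\<le>n. \<Sum>b\<le>n. if b = j \<and> a = j then D $$ (j, j) else 0)"
    unfolding mat_trace_mult[OF D E] by (intro sum.cong refl) (auto simp: E_mat_def)
  also have "\<dots> = (\<Sum>a\<le>n. if a = j then D $$ (j, j) else 0)"
    using j by (intro sum.cong refl) auto
  also have "\<dots> = D $$ (j, j)" using j by simp
  finally show ?thesis .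
qed

interpretation sphere: prob_space sphere_measure
  by (rule prob_spaceI) (rule sphere_measure_total(1))

lemma AE_sphere: "AE \<zeta> in sphere_measure. norm \<zeta> = 1"
proof -
  have "AE \<zeta> in sphere_measure. \<zeta> \<in> sphere 0 1"
    using sphere_measure_total(2) by (intro sphere.AE_prob_1) (simp add: sphere.emeasure_eq_measure)
  then show ?thesis by (simp add: dist_norm)
qed

lemma sets_sphere_measure [measurable_cong, simp]: "sets sphere_measure = sets borel"
  and space_sphere_measure [simp]: "space sphere_measure = UNIV"
  by (simp_all add: sphere_measure_def)

definition proj :: "nat \<Rightarrow> nat \<Rightarrow> C2 \<Rightarrow> complex mat" where
  "proj n j \<zeta> = tau n (k_mat \<zeta>) * E_mat n j * mat_adjoint (tau n (k_mat \<zeta>))"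

lemma proj_carrier: "proj n j \<zeta> \<in> carrier_mat (n + 1) (n + 1)"
  unfolding proj_def by (rule tau_conj_carrier[OF E_mat_carrier])

lemma proj_entry:
  assumes "\<zeta> \<noteq> 0" "j \<le> n" "a \<le> n" "b \<le> n"
  shows "proj n j \<zeta> $$ (a, b) = mat_coeff n a b (\<lambda>z w. of_nat (n choose j) *
     (uc \<zeta> z / of_real ((norm \<zeta>)\<^sup>2) * cnj (uc \<zeta> w / of_real ((norm \<zeta>)\<^sup>2))) ^ j *
     (vc \<zeta> z / of_real ((norm \<zeta>)\<^sup>2) * cnj (vc \<zeta> w / of_real ((norm \<zeta>)\<^sup>2))) ^ (n - j))"
proof -
  have "kern n (proj n j \<zeta>) = (\<lambda>z w. of_nat (n choose j) *
     (uc \<zeta> z / of_real ((norm \<zeta>)\<^sup>2) * cnj (uc \<zeta> w / of_real ((norm \<zeta>)\<^sup>2))) ^ j *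
     (vc \<zeta> z / of_real ((norm \<zeta>)\<^sup>2) * cnj (vc \<zeta> w / of_real ((norm \<zeta>)\<^sup>2))) ^ (n - j))"
    unfolding proj_def
    by (intro ext) (simp only: kern_tau_conj[OF E_mat_carrier] kern_E_mat[OF assms(2)] k_mat_inv[OF assms(1)] basis_poly_prod)
  then show ?thesis using mat_coeff_kern[OF assms(3,4)] by metis
qed

lemma uc_vc_measurable [measurable]:
  "(\<lambda>\<zeta>. uc \<zeta> z) \<in> borel_measurable borel" "(\<lambda>\<zeta>. vc \<zeta> z) \<in> borel_measurable borel"
  unfolding uc_def vc_def by (intro borel_measurable_continuous_onI continuous_intros)+

text \<open>Away from 0 the entry is an explicit expression in \<zeta>; the single point 0 is split
  off.\<close>

lemma proj_measurable:
  assumes "j \<le> n" "a \<le> n" "b \<le> n"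
  shows "(\<lambda>\<zeta>. proj n j \<zeta> $$ (a, b)) \<in> borel_measurable borel"
proof -
  let ?q = "\<lambda>\<zeta>. mat_coeff n a b (\<lambda>z w. of_nat (n choose j) *
     (uc \<zeta> z / of_real ((norm \<zeta>)\<^sup>2) * cnj (uc \<zeta> w / of_real ((norm \<zeta>)\<^sup>2))) ^ j *
     (vc \<zeta> z / of_real ((norm \<zeta>)\<^sup>2) * cnj (vc \<zeta> w / of_real ((norm \<zeta>)\<^sup>2))) ^ (n - j))"
  have [measurable]: "(\<lambda>x. cnj (f x)) \<in> borel_measurable borel" if "f \<in> borel_measurable borel" for f :: "C2 \<Rightarrow> complex"
    by (rule measurable_compose[OF that]) (intro borel_measurable_continuous_onI continuous_intros)
  have "?q \<in> borel_measurable borel"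
    unfolding mat_coeff_def by measurable
  then have "(\<lambda>\<zeta>. if \<zeta> = 0 then proj n j 0 $$ (a, b) else ?q \<zeta>) \<in> borel_measurable borel"
    by measurable
  also have "(\<lambda>\<zeta>. if \<zeta> = 0 then proj n j 0 $$ (a, b) else ?q \<zeta>) = (\<lambda>\<zeta>. proj n j \<zeta> $$ (a, b))"
  proof
    fix \<zeta>
    show "(if \<zeta> = 0 then proj n j 0 $$ (a, b) else ?q \<zeta>) = proj n j \<zeta> $$ (a, b)"
      using proj_entry[OF _ assms, of \<zeta>] by (cases "\<zeta> = 0") (simp_all only: if_True if_False simp_thms)
  qed
  finally show ?thesis .
qed

text \<open>At unit vectors the modulus of the kernel is one term of a binomial expansion whose base
  is at most 1 by Cauchy-Schwarz. A crude bound, sufficient for integrability on the sphere.\<close>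

lemma proj_bound:
  assumes "norm \<zeta> = 1" "j \<le> n" "a \<le> n" "b \<le> n"
  shows "cmod (proj n j \<zeta> $$ (a, b)) \<le> real (n + 1)"
proof -
  have "\<zeta> \<noteq> 0" using assms by auto
  have le: "real (n choose j) * (cmod (uc \<zeta> z) * cmod (uc \<zeta> w)) ^ j * (cmod (vc \<zeta> z) * cmod (vc \<zeta> w)) ^ (n - j) \<le> 1"
    if "norm z = 1" "norm w = 1" for z w
  proof -
    let ?a = "cmod (uc \<zeta> z) * cmod (uc \<zeta> w)" and ?b = "cmod (vc \<zeta> z) * cmod (vc \<zeta> w)"
    have "?a + ?b \<le> 1 * 1"
      by (rule cauchy_schwarz_2) (simp_all add: norm_uc_vc assms that)
    then have "(?a + ?b) ^ n \<le> 1" by (intro power_le_one) auto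
    moreover have "real (n choose j) * ?a ^ j * ?b ^ (n - j) \<le> (\<Sum>j\<le>n. real (n choose j) * ?a ^ j * ?b ^ (n - j))"
      using assms by (intro member_le_sum) auto
    ultimately show ?thesis by (simp add: binomial_ring)
  qed
  have "cmod (proj n j \<zeta> $$ (a, b)) \<le> real (n + 1) * 1"
    unfolding proj_entry[OF \<open>\<zeta> \<noteq> 0\<close> assms(2-4)]
    by (rule norm_mat_coeff_le[OF assms(3,4)])
      (use le assms(1) in \<open>simp add: norm_mult norm_power\<close>)
  then show ?thesis by simp
qed

lemma integral_sum2:
  fixes f :: "nat \<Rightarrow> nat \<Rightarrow> 'x \<Rightarrow> complex"
  assumes "\<And>a b. a \<le> n \<Longrightarrow> b \<le> n \<Longrightarrow> integrable M (f a b)"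
  shows "(\<integral>x. (\<Sum>a\<le>n. \<Sum>b\<le>n. f a b x) \<partial>M) = (\<Sum>a\<le>n. \<Sum>b\<le>n. \<integral>x. f a b x \<partial>M)"
proof -
  have "(\<integral>x. (\<Sum>a\<le>n. \<Sum>b\<le>n. f a b x) \<partial>M) = (\<Sum>a\<le>n. \<integral>x. (\<Sum>b\<le>n. f a b x) \<partial>M)"
    using assms by (intro Bochner_Integration.integral_sum Bochner_Integration.integrable_sum) auto
  also have "\<dots> = (\<Sum>a\<le>n. \<Sum>b\<le>n. \<integral>x. f a b x \<partial>M)"
    using assms by (intro sum.cong refl Bochner_Integration.integral_sum) auto
  finally show ?thesis .
qed

section \<open>The transform as a diagonal entry of the Fourier transform\<close>

lemma spherical_transform_apply:
  assumes "(\<xi>, \<eta>) \<in> Sigma_D n" "(SOME j. j \<le> n \<and> \<eta> = (- real n + 2 * real j) * \<xi>) = j"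
  shows "spherical_transform n F (\<xi>, \<eta>) =
    (\<integral>z. mat_trace (F z * spherical_fun n \<xi> j (- z)) \<partial>lborel) / of_nat (n + 1)"
  using assms by (simp only: spherical_transform_def restrict_apply if_True case_prod_conv Let_def)

text \<open>By Fubini the integral over z is done first and gives the Fourier transform at
  \<open>- (sqrt \<xi> *\<^sub>R \<zeta>)\<close>. By equivariance its trace against the projection
  at \<zeta> is the same for all unit \<zeta>, so the spherical mean of a constant remains. The two
  factors n + 1 cancel.\<close>

lemma spherical_transform_value:
  assumes F: "F \<in> schwartz_K n" and \<xi>: "0 \<le> \<xi>" and j: "j \<le> n"
  shows "(\<integral>z. mat_trace (F z * spherical_fun n \<xi> j (- z)) \<partial>lborel) / of_nat (n + 1) =
     mat_fourier n F (axis 2 (of_real (sqrt \<xi>))) $$ (j, j)"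
proof -
  let ?r = "sqrt \<xi>"
  let ?D = "mat_fourier n F (axis 2 (of_real ?r))"
  have Fc: "F z \<in> carrier_mat (n + 1) (n + 1)" for z using F by (simp add: schwartz_K_def)
  have Fs: "schwartz (\<lambda>z. F z $$ (a, b))" if "a \<le> n" "b \<le> n" for a b
    using F that by (simp add: schwartz_K_def)
  interpret P: pair_sigma_finite "lborel :: C2 measure" sphere_measure by standard
  let ?f = "\<lambda>a b z \<zeta>. F z $$ (a, b) * (cis (?r * (z \<bullet> \<zeta>)) * proj n j \<zeta> $$ (b, a))"
  have pint: "integrable sphere_measure (\<lambda>\<zeta>. proj n j \<zeta> $$ (b, a))" if "a \<le> n" "b \<le> n" for a b
  proof (rule sphere.integrable_const_bound[where B = "real (n + 1)"])
    show "AE \<zeta> in sphere_measure. cmod (proj n j \<zeta> $$ (b, a)) \<le> real (n + 1)"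
      using AE_sphere by eventually_elim (rule proj_bound[OF _ j that(2,1)])
    show "(\<lambda>\<zeta>. proj n j \<zeta> $$ (b, a)) \<in> borel_measurable sphere_measure"
      using proj_measurable[OF j that(2,1)] by simp
  qed
  have fm: "(\<lambda>(z, \<zeta>). ?f a b z \<zeta>) \<in> borel_measurable (lborel \<Otimes>\<^sub>M sphere_measure)" if "a \<le> n" "b \<le> n" for a b
  proof -
    note [measurable] = schwartz_measurable[OF Fs[OF that]] proj_measurable[OF j that(2,1)]
    show ?thesis by measurable
  qed
  have fint: "integrable (lborel \<Otimes>\<^sub>M sphere_measure) (\<lambda>(z, \<zeta>). ?f a b z \<zeta>)" if "a \<le> n" "b \<le> n" for a b
  proof (rule P.Fubini_integrable[OF fm[OF that]])
    have n: "norm (case (z, \<zeta>) of (z, \<zeta>) \<Rightarrow> ?f a b z \<zeta>) = cmod (F z $$ (a, b)) * cmod (proj n j \<zeta> $$ (b, a))" for z \<zeta>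
      by (simp add: norm_mult)
    show "integrable lborel (\<lambda>z. \<integral>\<zeta>. norm (case (z, \<zeta>) of (z, \<zeta>) \<Rightarrow> ?f a b z \<zeta>) \<partial>sphere_measure)"
      unfolding n using schwartz_integrable[OF Fs[OF that]] by simp
    show "AE z in lborel. integrable sphere_measure (\<lambda>\<zeta>. case (z, \<zeta>) of (z, \<zeta>) \<Rightarrow> ?f a b z \<zeta>)"
    proof (rule AE_I2, unfold split_conv, rule integrable_mult_right)
      fix z
      note [measurable] = proj_measurable[OF j that(2,1)]
      show "integrable sphere_measure (\<lambda>\<zeta>. cis (?r * (z \<bullet> \<zeta>)) * proj n j \<zeta> $$ (b, a))"
        by (rule Bochner_Integration.integrable_bound[OF pint[OF that]]) (auto simp: norm_mult)
    qed
  qed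
  have inner: "(\<integral>z. ?f a b z \<zeta> \<partial>lborel) = mat_fourier n F (- (?r *\<^sub>R \<zeta>)) $$ (a, b) * proj n j \<zeta> $$ (b, a)"
    if "a \<le> n" "b \<le> n" for a b \<zeta>
  proof -
    have "(\<integral>z. ?f a b z \<zeta> \<partial>lborel) = (\<integral>z. proj n j \<zeta> $$ (b, a) * (cis (- (z \<bullet> - (?r *\<^sub>R \<zeta>))) * F z $$ (a, b)) \<partial>lborel)"
      by (intro Bochner_Integration.integral_cong refl) simp
    also have "\<dots> = proj n j \<zeta> $$ (b, a) * fourier (\<lambda>z. F z $$ (a, b)) (- (?r *\<^sub>R \<zeta>))"
      unfolding fourier_def by (rule integral_mult_right_zero)
    finally show ?thesis using that by (simp add: mat_fourier_def)
  qed
  have tr: "mat_trace (F z * spherical_fun n \<xi> j (- z)) =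
      of_nat (n + 1) * (\<Sum>a\<le>n. \<Sum>b\<le>n. \<integral>\<zeta>. ?f a b z \<zeta> \<partial>sphere_measure)" for z
  proof -
    have c: "spherical_fun n \<xi> j (- z) \<in> carrier_mat (n + 1) (n + 1)" by (simp add: spherical_fun_def)
    have "F z $$ (a, b) * spherical_fun n \<xi> j (- z) $$ (b, a) =
        of_nat (n + 1) * (\<integral>\<zeta>. ?f a b z \<zeta> \<partial>sphere_measure)" if "a \<le> n" "b \<le> n" for a b
    proof -
      have "exp (- \<i> * complex_of_real (?r * (- z \<bullet> \<zeta>))) = cis (?r * (z \<bullet> \<zeta>))" for \<zeta>
        by (simp add: cis_conv_exp)
      then have "spherical_fun n \<xi> j (- z) $$ (b, a) =
          of_nat (n + 1) * (\<integral>\<zeta>. cis (?r * (z \<bullet> \<zeta>)) * proj n j \<zeta> $$ (b, a) \<partial>sphere_measure)"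
        using that by (simp add: spherical_fun_def proj_def del: of_nat_Suc)
      then show ?thesis by (simp only: integral_mult_right_zero mult_ac)
    qed
    then show ?thesis
      unfolding mat_trace_mult[OF Fc c] sum_distrib_left by (intro sum.cong refl) auto
  qed
  have cint: "integrable lborel (\<lambda>z. \<integral>\<zeta>. ?f a b z \<zeta> \<partial>sphere_measure)" if "a \<le> n" "b \<le> n" for a b
    using P.integrable_fst[OF fint[OF that]] by simp
  have cint2: "integrable sphere_measure (\<lambda>\<zeta>. \<integral>z. ?f a b z \<zeta> \<partial>lborel)" if "a \<le> n" "b \<le> n" for a b
    using P.integrable_snd[OF fint[OF that]] by simp
  have fub: "(\<integral>z. \<integral>\<zeta>. ?f a b z \<zeta> \<partial>sphere_measure \<partial>lborel) = (\<integral>\<zeta>. \<integral>z. ?f a b z \<zeta> \<partial>lborel \<partial>sphere_measure)"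
    if "a \<le> n" "b \<le> n" for a b
    by (rule P.Fubini_integral[symmetric, OF fint[OF that]])
  have "(\<integral>z. mat_trace (F z * spherical_fun n \<xi> j (- z)) \<partial>lborel) / of_nat (n + 1) =
      (\<integral>z. (\<Sum>a\<le>n. \<Sum>b\<le>n. \<integral>\<zeta>. ?f a b z \<zeta> \<partial>sphere_measure) \<partial>lborel)"
    unfolding tr integral_mult_right_zero by (simp del: of_nat_Suc)
  also have "\<dots> = (\<Sum>a\<le>n. \<Sum>b\<le>n. \<integral>\<zeta>. \<integral>z. ?f a b z \<zeta> \<partial>lborel \<partial>sphere_measure)"
  proof -
    have "(\<integral>z. (\<Sum>a\<le>n. \<Sum>b\<le>n. \<integral>\<zeta>. ?f a b z \<zeta> \<partial>sphere_measure) \<partial>lborel) =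
        (\<Sum>a\<le>n. \<Sum>b\<le>n. \<integral>z. \<integral>\<zeta>. ?f a b z \<zeta> \<partial>sphere_measure \<partial>lborel)"
      by (rule integral_sum2[OF cint])
    also have "\<dots> = (\<Sum>a\<le>n. \<Sum>b\<le>n. \<integral>\<zeta>. \<integral>z. ?f a b z \<zeta> \<partial>lborel \<partial>sphere_measure)"
      by (intro sum.cong refl fub) (simp_all only: atMost_iff)
    finally show ?thesis .
  qed
  also have "\<dots> = (\<integral>\<zeta>. (\<Sum>a\<le>n. \<Sum>b\<le>n. \<integral>z. ?f a b z \<zeta> \<partial>lborel) \<partial>sphere_measure)"
    by (rule integral_sum2[OF cint2, symmetric])
  also have "\<dots> = (\<integral>\<zeta>. ?D $$ (j, j) \<partial>sphere_measure)"
  proof (rule integral_cong_AE)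
    show "(\<lambda>\<zeta>. \<Sum>a\<le>n. \<Sum>b\<le>n. \<integral>z. ?f a b z \<zeta> \<partial>lborel) \<in> borel_measurable sphere_measure"
      using cint2 by (intro borel_measurable_sum) auto
    show "AE \<zeta> in sphere_measure. (\<Sum>a\<le>n. \<Sum>b\<le>n. \<integral>z. ?f a b z \<zeta> \<partial>lborel) = ?D $$ (j, j)"
      using AE_sphere
    proof eventually_elim
      case (elim \<zeta>)
      have "(\<Sum>a\<le>n. \<Sum>b\<le>n. \<integral>z. ?f a b z \<zeta> \<partial>lborel) = mat_trace (mat_fourier n F (- (?r *\<^sub>R \<zeta>)) * proj n j \<zeta>)"
        unfolding mat_trace_mult[OF mat_fourier_carrier proj_carrier] by (intro sum.cong refl) (simp add: inner)
      also have "\<dots> = ?D $$ (j, j)"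
        unfolding equivariant_radial(2)[OF mat_fourier_equivariant[OF F] elim] proj_def
        by (rule mat_trace_tau_conj[OF k_mat_SU2[OF elim] mat_fourier_carrier j])
      finally show ?case .
    qed
  qed simp
  also have "\<dots> = ?D $$ (j, j)" using sphere.prob_space by simp
  finally show ?thesis .
qed

section \<open>Existence and uniqueness of the preimage of a restricted Schwartz function\<close>

lemma tau_one: "tau n (Finite_Cartesian_Product.mat 1) = 1\<^sub>m (n + 1)"
proof (rule kern_inject[OF tau_carrier one_carrier_mat])
  have one: "(Finite_Cartesian_Product.mat 1 :: complex ^ 2 ^ 2) \<in> SU2"
    by (simp add: SU2_def vec_eq_iff forall_2 matrix_matrix_mult_def sum_2 det_2 Finite_Cartesian_Product.mat_def)
  have inv: "matrix_inv (Finite_Cartesian_Product.mat 1 :: complex ^ 2 ^ 2) = Finite_Cartesian_Product.mat 1"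
    using SU2_inv(1)[OF one] by simp
  fix z w
  show "kern n (tau n (Finite_Cartesian_Product.mat 1)) z w = kern n (1\<^sub>m (n + 1)) z w"
    using kern_tau_mult[OF one_carrier_mat, of n "Finite_Cartesian_Product.mat 1" z w]
    by (simp only: right_mult_one_mat[OF tau_carrier] inv matrix_vector_mul_lid)
qed

lemma symbol_axis:
  assumes "0 \<le> r"
  shows "symbol n g (axis 2 (of_real r)) = diag_at n g (r\<^sup>2)"
proof -
  have u: "unit_dir (axis 2 (of_real r)) = axis 2 1"
  proof (cases "r = 0")
    case False
    have "norm (axis 2 (of_real r) :: C2) = r" using assms by (simp add: norm_vec_def L2_set_def sum_2 axis_def)
    moreover have "axis 2 (of_real r) \<noteq> (0 :: C2)" using False by (simp add: axis_eq_0_iff)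
    ultimately show ?thesis using False
      by (simp add: unit_dir_def sgn_div_norm vec_eq_iff forall_2 axis_def scaleR_conv_of_real[where 'a = complex])
  qed (simp add: unit_dir_def axis_eq_0_iff)
  have k: "k_mat (axis 2 1) = Finite_Cartesian_Product.mat 1"
    by (simp add: k_mat_def vec_eq_iff forall_2 Finite_Cartesian_Product.mat_def axis_def)
  have nr: "(norm (axis 2 (of_real r) :: C2))\<^sup>2 = r\<^sup>2"
    by (simp add: norm_C2 axis_def)
  have adj: "mat_adjoint (1\<^sub>m (n + 1) :: complex mat) = 1\<^sub>m (n + 1)"
    using mat_adjoint_carrier[OF one_carrier_mat, of "n + 1"]
    by (intro eq_matI) (auto simp: mat_adjoint_index[OF one_carrier_mat])
  show ?thesis
    unfolding symbol_def u k tau_one nr adj using diag_at_carrier[of n g "r\<^sup>2"] by simp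
qed

lemma mat_fourier_mat_inv_fourier_symbol:
  assumes g: "schwartz g"
  shows "mat_fourier n (mat_inv_fourier n (symbol n g)) = symbol n g"
proof (rule ext, rule eq_matI)
  fix \<zeta> a b assume "a < dim_row (symbol n g \<zeta>)" "b < dim_col (symbol n g \<zeta>)"
  then have ab: "a \<le> n" "b \<le> n" using symbol_carrier[of n g \<zeta>] by auto
  then have "(\<lambda>z. mat_inv_fourier n (symbol n g) z $$ (a, b)) = inv_fourier (\<lambda>\<zeta>. symbol n g \<zeta> $$ (a, b))"
    by (simp add: mat_inv_fourier_def)
  then show "mat_fourier n (mat_inv_fourier n (symbol n g)) \<zeta> $$ (a, b) = symbol n g \<zeta> $$ (a, b)"
    using ab fourier_inv_fourier[OF schwartz_symbol[OF g ab]] by (simp add: mat_fourier_def)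
qed (simp_all only: carrier_matD[OF symbol_carrier] carrier_matD[OF mat_fourier_carrier])

lemma spherical_transform_inverse:
  assumes g: "schwartz g"
  shows "spherical_transform n (mat_inv_fourier n (symbol n g)) = restrict g (Sigma_D n)"
proof
  fix p :: "real \<times> real"
  show "spherical_transform n (mat_inv_fourier n (symbol n g)) p = restrict g (Sigma_D n) p"
  proof (cases "p \<in> Sigma_D n")
    case True
    obtain \<xi> \<eta> where p: "p = (\<xi>, \<eta>)" by force
    \<comment> \<open>At the origin the choice is arbitrary, but every j leads to the same point and
      hence to the same value of \<open>g\<close>.\<close>
    define j where "j = (SOME j. j \<le> n \<and> \<eta> = (- real n + 2 * real j) * \<xi>)"
    from True have \<xi>: "0 \<le> \<xi>" and "\<exists>j. j \<le> n \<and> \<eta> = (- real n + 2 * real j) * \<xi>"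
      by (auto simp: p Sigma_D_def)
    from someI_ex[OF this(2)] have j: "j \<le> n" "\<eta> = (- real n + 2 * real j) * \<xi>" by (simp_all add: j_def)
    have "spherical_transform n (mat_inv_fourier n (symbol n g)) p =
      symbol n g (axis 2 (of_real (sqrt \<xi>))) $$ (j, j)"
      unfolding p spherical_transform_apply[OF True[unfolded p] j_def[symmetric]]
        spherical_transform_value[OF mat_inv_fourier_symbol_schwartz_K[OF g] \<xi> j(1)]
        mat_fourier_mat_inv_fourier_symbol[OF g] ..
    also have "\<dots> = g p"
      using \<xi> j by (simp add: symbol_axis diag_at_def p)
    finally show ?thesis using True by simp
  qed (auto simp: spherical_transform_def)
qed

text \<open>The data give the diagonal of the Fourier transform on the axis for r > 0, where the
  index j is uniquely determined; \<open>equivariant_axis_diag\<close> gives the rest of the matrix,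
  and equivariance carries it to every nonzero \<zeta>.\<close>

lemma spherical_transform_inject:
  assumes g: "schwartz g" and F: "F \<in> schwartz_K n" and eq: "spherical_transform n F = restrict g (Sigma_D n)"
  shows "F = mat_inv_fourier n (symbol n g)"
proof -
  have Fc: "F z \<in> carrier_mat (n + 1) (n + 1)" for z using F by (simp add: schwartz_K_def)
  have Fs: "schwartz (\<lambda>z. F z $$ (a, b))" if "a \<le> n" "b \<le> n" for a b
    using F that by (simp add: schwartz_K_def)
  have axis: "mat_fourier n F (axis 2 (of_real r)) = diag_at n g (r\<^sup>2)" if r: "0 < r" for r
  proof (rule eq_matI)
    fix a b assume "a < dim_row (diag_at n g (r\<^sup>2))" "b < dim_col (diag_at n g (r\<^sup>2))"
    then have ab: "a \<le> n" "b \<le> n" by (auto simp: diag_at_def)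
    show "mat_fourier n F (axis 2 (of_real r)) $$ (a, b) = diag_at n g (r\<^sup>2) $$ (a, b)"
    proof (cases "a = b")
      case False
      then show ?thesis
        using equivariant_axis_diag[OF mat_fourier_carrier mat_fourier_equivariant[OF F] ab] ab
        by (simp add: diag_at_def)
    next
      case True
      let ?\<eta> = "(- real n + 2 * real a) * r\<^sup>2"
      have mem: "(r\<^sup>2, ?\<eta>) \<in> Sigma_D n" using ab by (auto simp: Sigma_D_def)
      have u: "(SOME j. j \<le> n \<and> ?\<eta> = (- real n + 2 * real j) * r\<^sup>2) = a"
        using ab r by (intro some_equality) auto
      have "g (r\<^sup>2, ?\<eta>) = spherical_transform n F (r\<^sup>2, ?\<eta>)" using eq mem by simp
      also have "\<dots> = mat_fourier n F (axis 2 (of_real r)) $$ (a, a)"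
        unfolding spherical_transform_apply[OF mem u] spherical_transform_value[OF F zero_le_power2 ab(1)]
        using r by simp
      finally show ?thesis using True ab by (simp add: diag_at_def)
    qed
  qed (simp_all add: mat_fourier_def diag_at_def)
  have nz: "mat_fourier n F \<zeta> = symbol n g \<zeta>" if "\<zeta> \<noteq> 0" for \<zeta>
  proof -
    have "\<zeta> = norm \<zeta> *\<^sub>R unit_dir \<zeta>" using that by (simp add: unit_dir_def sgn_div_norm)
    then have "mat_fourier n F \<zeta> = mat_fourier n F (norm \<zeta> *\<^sub>R unit_dir \<zeta>)" by simp
    also have "\<dots> = symbol n g \<zeta>"
      unfolding equivariant_radial(1)[OF mat_fourier_equivariant[OF F] norm_unit_dir] symbol_def
      using axis[of "norm \<zeta>"] that by simp
    finally show ?thesis .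
  qed
  show ?thesis
  proof (rule ext, rule eq_matI)
    fix z a b assume "a < dim_row (mat_inv_fourier n (symbol n g) z)" "b < dim_col (mat_inv_fourier n (symbol n g) z)"
    then have ab: "a \<le> n" "b \<le> n" by (auto simp: mat_inv_fourier_def)
    let ?f = "\<lambda>z. F z $$ (a, b)" and ?h = "\<lambda>\<zeta>. symbol n g \<zeta> $$ (a, b)"
    note s = schwartz_fourier[OF Fs[OF ab]] schwartz_symbol[OF g ab]
    \<comment> \<open>The two functions have been compared only away from 0. A second Fourier
      transform ignores that null set, and its injectivity gives equality everywhere.\<close>
    have "fourier (fourier ?f) y = fourier ?h y" for y
      unfolding fourier_def[of "fourier ?f"] fourier_def[of ?h]
    proof (rule integral_cong_AE)
      note [measurable] = s[THEN schwartz_measurable]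
      show "(\<lambda>x. cis (- (x \<bullet> y)) * fourier ?f x) \<in> borel_measurable lborel" by measurable
      show "(\<lambda>x. cis (- (x \<bullet> y)) * ?h x) \<in> borel_measurable lborel" by measurable
      show "AE x in lborel. cis (- (x \<bullet> y)) * fourier ?f x = cis (- (x \<bullet> y)) * ?h x"
        using AE_lborel_singleton[of "0 :: C2"]
      proof eventually_elim
        case (elim x)
        have "mat_fourier n F x $$ (a, b) = fourier ?f x" using ab by (simp add: mat_fourier_def)
        then have "fourier ?f x = ?h x" by (simp only: nz[OF elim])
        then show ?case by simp
      qed
    qed
    then have "fourier ?f = ?h" by (intro fourier_inject[OF s] ext)
    then have "?f = inv_fourier ?h" using inv_fourier_fourier[OF Fs[OF ab]] by simp
    then show "F z $$ (a, b) = mat_inv_fourier n (symbol n g) z $$ (a, b)"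
      using ab by (simp add: mat_inv_fourier_def fun_eq_iff)
  qed (use Fc in \<open>auto simp: mat_inv_fourier_def\<close>)
qed

lemma inverse_spherical_transform_eq:
  assumes g: "schwartz g"
  shows "inverse_spherical_transform n (restrict g (Sigma_D n)) = mat_inv_fourier n (symbol n g)"
proof -
  have mem: "restrict g (Sigma_D n) \<in> spherical_transform n ` schwartz_K n"
    using spherical_transform_inverse[OF g] mat_inv_fourier_symbol_schwartz_K[OF g] by (metis imageI)
  show ?thesis
    unfolding inverse_spherical_transform_def
    by (rule spherical_transform_inject[OF g inv_into_into[OF mem] f_inv_into_f[OF mem]])
qed

section \<open>The norm estimate\<close>

lemma tame_diff:
  assumes "tame \<Psi>" "tame \<Theta>"
  shows "tame (\<lambda>n g z w \<zeta>. \<Psi> n g z w \<zeta> - \<Theta> n g z w \<zeta>)"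
  using tame_add[OF assms(1) tame_poly[OF poly3_complex[of "-1"] assms(2)]] by simp

lemma tame_sum:
  assumes "finite I" "\<And>i. i \<in> I \<Longrightarrow> tame (\<Psi> i)"
  shows "tame (\<lambda>n g z w \<zeta>. \<Sum>i\<in>I. \<Psi> i n g z w \<zeta>)"
  using assms
proof (induction I)
  case empty
  show ?case using tame_poly[OF poly3_complex[of 0] tame_ker_fun] by simp
next
  case (insert i I)
  then have "tame (\<lambda>n g z w \<zeta>. \<Psi> i n g z w \<zeta> + (\<Sum>i\<in>I. \<Psi> i n g z w \<zeta>))"
    by (intro tame_add) auto
  with insert show ?case by simp
qed

lemma tame_pderivative:
  assumes "tame \<Psi>"
  shows "\<exists>\<Psi>'. \<forall>b. tame (\<Psi>' b) \<and>
    (b \<in> Basis \<longrightarrow> (\<forall>n g z w. schwartz g \<longrightarrow> pderivative b (\<Psi> n g z w) = \<Psi>' b n g z w))"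
proof -
  from tame_has_derivative[OF assms] obtain \<Psi>' where \<Psi>': "\<forall>b. tame (\<Psi>' b)" "\<forall>n g z w \<zeta>. schwartz g \<longrightarrow>
       (\<Psi> n g z w has_derivative (\<lambda>h. \<Sum>b\<in>Basis. (h \<bullet> b) *\<^sub>R \<Psi>' b n g z w \<zeta>)) (at \<zeta>)" by blast
  have "pderivative b (\<Psi> n g z w) = \<Psi>' b n g z w" if "b \<in> Basis" "schwartz g" for b n g z w
    by (rule ext, rule pderivative_eqI[OF \<Psi>'(2)[rule_format, OF that(2)] that(1)])
  with \<Psi>'(1) show ?thesis by (intro exI[of _ \<Psi>']) simp
qed

text \<open>One family serves for all arguments, as \<open>tame_bound\<close> requires;
  \<open>choice\<close> picks the second derivatives for all directions before \<open>n\<close> and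
  \<open>g\<close> are introduced.\<close>

lemma tame_one_minus_laplacian:
  assumes "tame \<Psi>"
  shows "\<exists>\<Theta>. tame \<Theta> \<and> (\<forall>n g z w. schwartz g \<longrightarrow> (one_minus_laplacian ^^ K) (\<Psi> n g z w) = \<Theta> n g z w)"
proof (induction K)
  case 0
  show ?case using assms by auto
next
  case (Suc K)
  then obtain \<Theta> where \<Theta>: "tame \<Theta>" "\<And>n g z w. schwartz g \<Longrightarrow> (one_minus_laplacian ^^ K) (\<Psi> n g z w) = \<Theta> n g z w"
    by blast
  from tame_pderivative[OF \<Theta>(1)] obtain D where D': "\<forall>b. tame (D b) \<and>
    (b \<in> Basis \<longrightarrow> (\<forall>n g z w. schwartz g \<longrightarrow> pderivative b (\<Theta> n g z w) = D b n g z w))" ..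
  have D: "\<And>b. tame (D b)"
    "\<And>b n g z w. b \<in> Basis \<Longrightarrow> schwartz g \<Longrightarrow> pderivative b (\<Theta> n g z w) = D b n g z w"
    using D' by simp_all
  have "\<forall>b. \<exists>T. tame T \<and> (b \<in> Basis \<longrightarrow> (\<forall>n g z w. schwartz g \<longrightarrow> pderivative b (D b n g z w) = T n g z w))"
  proof
    fix b
    from tame_pderivative[OF D(1)[of b]] obtain T where T: "\<forall>b'. tame (T b') \<and>
      (b' \<in> Basis \<longrightarrow> (\<forall>n g z w. schwartz g \<longrightarrow> pderivative b' (D b n g z w) = T b' n g z w))" ..
    from T[rule_format, of b] show "\<exists>T. tame T \<and> (b \<in> Basis \<longrightarrow> (\<forall>n g z w. schwartz g \<longrightarrow> pderivative b (D b n g z w) = T n g z w))"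
      by (intro exI[of _ "T b"]) simp
  qed
  from choice[OF this] obtain E where E': "\<forall>b. tame (E b) \<and>
    (b \<in> Basis \<longrightarrow> (\<forall>n g z w. schwartz g \<longrightarrow> pderivative b (D b n g z w) = E b n g z w))" ..
  have E: "\<And>b. tame (E b)"
    "\<And>b n g z w. b \<in> Basis \<Longrightarrow> schwartz g \<Longrightarrow> pderivative b (D b n g z w) = E b n g z w"
    using E' by simp_all
  have "(one_minus_laplacian ^^ Suc K) (\<Psi> n g z w) = (\<lambda>\<zeta>. \<Theta> n g z w \<zeta> - (\<Sum>b\<in>Basis. E b n g z w \<zeta>))"
    if "schwartz g" for n g z w
  proof -
    have "(one_minus_laplacian ^^ Suc K) (\<Psi> n g z w) = one_minus_laplacian (\<Theta> n g z w)"
      by (simp only: funpow.simps comp_def \<Theta>(2)[OF that])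
    moreover have "(\<Sum>b\<in>Basis. pderivative b (pderivative b (\<Theta> n g z w)) \<zeta>) = (\<Sum>b\<in>Basis. E b n g z w \<zeta>)" for \<zeta>
      by (rule sum.cong[OF refl]) (simp only: D(2)[OF _ that] E(2)[OF _ that])
    ultimately show ?thesis by (simp only: one_minus_laplacian_def)
  qed
  moreover have "tame (\<lambda>n g z w \<zeta>. \<Theta> n g z w \<zeta> - (\<Sum>b\<in>Basis. E b n g z w \<zeta>))"
    by (intro tame_diff tame_sum \<Theta>(1) E(1)) simp
  ultimately show ?case
    by (intro exI[of _ "\<lambda>n g z w \<zeta>. \<Theta> n g z w \<zeta> - (\<Sum>b\<in>Basis. E b n g z w \<zeta>)"]) blast
qed

text \<open>The weight is traded for \<open>K\<close> applications of
  \<open>one_minus_laplacian\<close>, and the remaining sup norm is at most an integral. The decay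
  exponent 4 is the real dimension of \<open>C2\<close>, as \<open>integrable_weight\<close>
  demands.\<close>

lemma inv_fourier_tame_bound:
  assumes "tame \<Psi>"
  shows "\<exists>N C d. 0 \<le> C \<and> (\<forall>n g c z w x. schwartz g \<longrightarrow> seminorm_le N g c \<longrightarrow> norm z \<le> 1 \<longrightarrow> norm w \<le> 1 \<longrightarrow>
     (1 + (norm x)\<^sup>2) ^ K * cmod (inv_fourier (\<Psi> n g z w) x) \<le> C * real (n + 1) ^ d * c)"
proof -
  obtain \<Theta> where \<Theta>: "tame \<Theta>" "\<And>n g z w. schwartz g \<Longrightarrow> (one_minus_laplacian ^^ K) (\<Psi> n g z w) = \<Theta> n g z w"
    using tame_one_minus_laplacian[OF assms] by blast
  obtain N C d where C: "0 \<le> C" "\<And>n g c z w \<zeta>. schwartz g \<Longrightarrow> seminorm_le N g c \<Longrightarrow> norm z \<le> 1 \<Longrightarrow> norm w \<le> 1 \<Longrightarrow>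
     (1 + (norm \<zeta>)\<^sup>2) ^ 4 * cmod (\<Theta> n g z w \<zeta>) \<le> C * real (n + 1) ^ d * c"
    using tame_bound[OF \<Theta>(1), of 4] by blast
  define I where "I = (\<integral>x. inverse ((1 + (norm (x :: C2))\<^sup>2) ^ 4) \<partial>lborel)"
  have int: "integrable lborel (\<lambda>x::C2. inverse ((1 + (norm x)\<^sup>2) ^ 4))"
    by (rule integrable_weight) simp
  have I: "0 \<le> I" unfolding I_def by (rule integral_nonneg_AE) simp
  have "(1 + (norm x)\<^sup>2) ^ K * cmod (inv_fourier (\<Psi> n g z w) x) \<le> (C * I) * real (n + 1) ^ d * c"
    if g: "schwartz g" and c: "seminorm_le N g c" and zw: "norm z \<le> 1" "norm w \<le> 1" for n g c z w x
  proof -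
    have s: "schwartz (\<Theta> n g z w)" by (rule schwartz_tame[OF \<Theta>(1) g zw])
    have "(1 + (norm x)\<^sup>2) ^ K * cmod (inv_fourier (\<Psi> n g z w) x) =
        cmod (of_real ((1 + (norm x)\<^sup>2) ^ K) * inv_fourier (\<Psi> n g z w) x)"
      unfolding norm_mult norm_of_real by simp
    also have "\<dots> = cmod (inv_fourier (\<Theta> n g z w) x)"
      unfolding inv_fourier_one_minus_laplacian_funpow[OF schwartz_tame[OF assms g zw], symmetric] \<Theta>(2)[OF g] ..
    also have "\<dots> \<le> (\<integral>\<zeta>. cmod (\<Theta> n g z w \<zeta>) \<partial>lborel)" by (rule norm_inv_fourier_le)
    also have "\<dots> \<le> (\<integral>\<zeta>. (C * real (n + 1) ^ d * c) * inverse ((1 + (norm (\<zeta> :: C2))\<^sup>2) ^ 4) \<partial>lborel)"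
    proof (rule integral_mono)
      show "integrable lborel (\<lambda>\<zeta>. cmod (\<Theta> n g z w \<zeta>))" using schwartz_integrable[OF s] by (rule integrable_norm)
      show "integrable lborel (\<lambda>\<zeta>::C2. (C * real (n + 1) ^ d * c) * inverse ((1 + (norm \<zeta>)\<^sup>2) ^ 4))"
        by (intro integrable_mult_right int)
      show "cmod (\<Theta> n g z w \<zeta>) \<le> (C * real (n + 1) ^ d * c) * inverse ((1 + (norm \<zeta>)\<^sup>2) ^ 4)" for \<zeta>
        using C(2)[OF g c zw] unfolding le_weight_iff .
    qed
    also have "\<dots> = (C * real (n + 1) ^ d * c) * I" unfolding I_def by (rule integral_mult_right_zero)
    finally show ?thesis by (simp add: mult_ac)
  qed
  then show ?thesis using C(1) I by (intro exI[of _ N] exI[of _ "C * I"] exI[of _ d]) auto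
qed

section \<open>Laplacians as multipliers\<close>

lemma inv_fourier_add:
  "schwartz f \<Longrightarrow> schwartz h \<Longrightarrow> inv_fourier (\<lambda>x. f x + h x) y = inv_fourier f y + inv_fourier h y"
  by (simp add: inv_fourier_def fourier_add schwartz_integrable distrib_left)

lemma inv_fourier_cmult: "inv_fourier (\<lambda>x. a * f x) y = a * inv_fourier f y"
  by (simp add: inv_fourier_def fourier_cmult)

text \<open>With the factor -4 the operator is minus the sum of the second partials in the four real
  directions, so its multiplier is positive. Each Laplacian thus becomes a polynomial factor on the
  symbol, which stays within \<open>tame\<close>.\<close>

lemma laplacian_inv_fourier:
  assumes h: "schwartz h"
  shows "laplacian (inv_fourier h) = inv_fourier (\<lambda>\<zeta>. of_real ((norm \<zeta>)\<^sup>2) * h \<zeta>)"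
proof
  fix z
  let ?x = "\<lambda>j (\<zeta>::C2). complex_of_real (\<zeta> \<bullet> axis j 1)" and ?y = "\<lambda>j (\<zeta>::C2). complex_of_real (\<zeta> \<bullet> axis j \<i>)"
  have B: "axis j 1 \<in> (Basis :: C2 set)" "axis j \<i> \<in> (Basis :: C2 set)" for j
    by (auto simp: axis_in_Basis_iff Basis_complex_def)
  have s: "schwartz (\<lambda>\<zeta>. a * (?x j \<zeta> * f \<zeta>))" "schwartz (\<lambda>\<zeta>. a * (?y j \<zeta> * f \<zeta>))" if "schwartz f" for a j f
    by (intro schwartz_cmult schwartz_inner_mult that)+
  have W: "wirtinger_bar j (inv_fourier f) = inv_fourier (\<lambda>\<zeta>. (\<i> / 2) * (?x j \<zeta> * f \<zeta>) + (- 1 / 2) * (?y j \<zeta> * f \<zeta>))"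
    "wirtinger j (inv_fourier f) = inv_fourier (\<lambda>\<zeta>. (\<i> / 2) * (?x j \<zeta> * f \<zeta>) + (1 / 2) * (?y j \<zeta> * f \<zeta>))"
    if f: "schwartz f" for j f
    unfolding wirtinger_def wirtinger_bar_def pderivative_inv_fourier[OF f B(1)] pderivative_inv_fourier[OF f B(2)]
      inv_fourier_add[OF s[OF f]] inv_fourier_cmult
    by (simp_all add: fun_eq_iff inv_fourier_add[OF s[OF f]] inv_fourier_cmult add_divide_distrib diff_divide_distrib algebra_simps)
  \<comment> \<open>The product of the two linear multipliers; its mixed terms in \<open>?x\<close>
    and \<open>?y\<close> cancel.\<close>
  define k where "k j \<zeta> = (- 1 / 4) * (?x j \<zeta> * (?x j \<zeta> * h \<zeta>)) + (- 1 / 4) * (?y j \<zeta> * (?y j \<zeta> * h \<zeta>))" for j \<zeta>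
  have ks: "schwartz (k j)" for j
    unfolding k_def[abs_def] by (intro schwartz_add schwartz_cmult schwartz_inner_mult h)
  have WW: "wirtinger j (wirtinger_bar j (inv_fourier h)) = inv_fourier (k j)" for j
  proof -
    have "wirtinger j (wirtinger_bar j (inv_fourier h)) = inv_fourier (\<lambda>\<zeta>.
       (\<i> / 2) * (?x j \<zeta> * ((\<i> / 2) * (?x j \<zeta> * h \<zeta>) + (- 1 / 2) * (?y j \<zeta> * h \<zeta>))) +
       (1 / 2) * (?y j \<zeta> * ((\<i> / 2) * (?x j \<zeta> * h \<zeta>) + (- 1 / 2) * (?y j \<zeta> * h \<zeta>))))"
      unfolding W(1)[OF h] by (rule W(2)) (intro schwartz_add s h)
    also have "(\<lambda>\<zeta>. (\<i> / 2) * (?x j \<zeta> * ((\<i> / 2) * (?x j \<zeta> * h \<zeta>) + (- 1 / 2) * (?y j \<zeta> * h \<zeta>))) +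
       (1 / 2) * (?y j \<zeta> * ((\<i> / 2) * (?x j \<zeta> * h \<zeta>) + (- 1 / 2) * (?y j \<zeta> * h \<zeta>)))) = k j"
      by (rule ext) (simp add: k_def algebra_simps)
    finally show ?thesis .
  qed
  have "laplacian (inv_fourier h) z = - 4 * (inv_fourier (k 1) z + inv_fourier (k 2) z)"
    unfolding laplacian_def WW by (simp add: sum_2)
  also have "\<dots> = inv_fourier (\<lambda>\<zeta>. - 4 * (k 1 \<zeta> + k 2 \<zeta>)) z"
    by (simp only: inv_fourier_cmult inv_fourier_add[OF ks ks])
  also have "(\<lambda>\<zeta>. - 4 * (k 1 \<zeta> + k 2 \<zeta>)) = (\<lambda>\<zeta>. of_real ((norm \<zeta>)\<^sup>2) * h \<zeta>)"
  proof
    fix \<zeta> :: C2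
    have "(norm \<zeta>)\<^sup>2 = (\<zeta> \<bullet> axis 1 1)\<^sup>2 + (\<zeta> \<bullet> axis 1 \<i>)\<^sup>2 + (\<zeta> \<bullet> axis 2 1)\<^sup>2 + (\<zeta> \<bullet> axis 2 \<i>)\<^sup>2"
      by (simp add: norm_C2 cmod_power2 inner_axis inner_complex_def)
    then show "- 4 * (k 1 \<zeta> + k 2 \<zeta>) = of_real ((norm \<zeta>)\<^sup>2) * h \<zeta>"
      by (simp only:) (simp add: k_def power2_eq_square algebra_simps)
  qed
  finally show "laplacian (inv_fourier h) z = inv_fourier (\<lambda>\<zeta>. of_real ((norm \<zeta>)\<^sup>2) * h \<zeta>) z" .
qed

lemma schwartz_norm_sq_power_mult:
  assumes "schwartz f"
  shows "schwartz (\<lambda>\<zeta>. of_real (((norm \<zeta>)\<^sup>2) ^ q) * f \<zeta>)"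
proof (induction q)
  case (Suc q)
  from schwartz_norm_sq_mult[OF Suc] show ?case by (simp add: mult.assoc)
qed (use assms in simp)

lemma mat_laplacian_mat_inv_fourier:
  assumes "\<And>a b. a \<le> n \<Longrightarrow> b \<le> n \<Longrightarrow> schwartz (\<lambda>\<zeta>. S \<zeta> $$ (a, b))"
  shows "(mat_laplacian n ^^ q) (mat_inv_fourier n S) = (\<lambda>z. Matrix.mat (n + 1) (n + 1)
    (\<lambda>(a, b). inv_fourier (\<lambda>\<zeta>. of_real (((norm \<zeta>)\<^sup>2) ^ q) * S \<zeta> $$ (a, b)) z))"
proof (induction q)
  case 0
  show ?case by (intro ext eq_matI) (simp_all add: mat_inv_fourier_def)
next
  case (Suc q)
  show ?case
    unfolding funpow.simps comp_def Suc
  proof (rule ext, rule eq_matI)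
    fix z a b
    let ?h = "\<lambda>q \<zeta>. complex_of_real (((norm \<zeta>)\<^sup>2) ^ q) * S \<zeta> $$ (a, b)"
    let ?R = "\<lambda>q z. Matrix.mat (n + 1) (n + 1)
      (\<lambda>(a, b). inv_fourier (\<lambda>\<zeta>. of_real (((norm \<zeta>)\<^sup>2) ^ q) * S \<zeta> $$ (a, b)) z)"
    assume "a < dim_row (?R (Suc q) z)" "b < dim_col (?R (Suc q) z)"
    then have ab: "a \<le> n" "b \<le> n" by auto
    have "(\<lambda>w. ?R q w $$ (a, b)) = inv_fourier (?h q)" using ab by simp
    then have "mat_laplacian n (?R q) z $$ (a, b) = laplacian (inv_fourier (?h q)) z"
      using ab by (simp add: mat_laplacian_def)
    also have "\<dots> = inv_fourier (\<lambda>\<zeta>. of_real ((norm \<zeta>)\<^sup>2) * ?h q \<zeta>) z"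
      by (simp only: laplacian_inv_fourier[OF schwartz_norm_sq_power_mult[OF assms[OF ab]]])
    also have "\<dots> = ?R (Suc q) z $$ (a, b)" using ab by (simp add: mult.assoc)
    finally show "mat_laplacian n (?R q) z $$ (a, b) = ?R (Suc q) z $$ (a, b)" .
  qed (simp_all add: mat_laplacian_def)
qed

lemma tame_norm_sq_power: "tame (\<lambda>n g z w \<zeta>. of_real (((norm \<zeta>)\<^sup>2) ^ q) * ker_fun n g z w \<zeta>)"
proof (induction q)
  case (Suc q)
  from tame_poly[OF poly3_norm_sq Suc] show ?case by (simp add: mult.assoc)
qed (use tame_ker_fun in simp)

text \<open>Two powers of the weight beyond \<open>M\<close> make the squared entries integrable in
  real dimension 4. In the exponent d + 2, one factor n + 1 comes from recovering entries and one
  from the Hilbert-Schmidt sum over (n + 1)^2 of them.\<close>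

lemma L2_norm_bound:
  "\<exists>N C d. 0 \<le> C \<and> (\<forall>n g c. schwartz g \<longrightarrow> seminorm_le N g c \<longrightarrow>
     L2_norm_mat (\<lambda>z. of_real ((1 + (norm z)\<^sup>2) ^ M) \<cdot>\<^sub>m (mat_laplacian n ^^ q) (mat_inv_fourier n (symbol n g)) z)
       \<le> C * real (n + 1) ^ d * c)"
proof -
  let ?K = "\<lambda>n g z w \<zeta>. of_real (((norm \<zeta>)\<^sup>2) ^ q) * ker_fun n g z w \<zeta>"
  obtain N C d where C: "0 \<le> C" "\<And>n g c z w x. schwartz g \<Longrightarrow> seminorm_le N g c \<Longrightarrow> norm z \<le> 1 \<Longrightarrow> norm w \<le> 1 \<Longrightarrow>
     (1 + (norm x)\<^sup>2) ^ (M + 2) * cmod (inv_fourier (?K n g z w) x) \<le> C * real (n + 1) ^ d * c"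
    using inv_fourier_tame_bound[OF tame_norm_sq_power, of "M + 2" q] by blast
  define I where "I = (\<integral>x. inverse ((1 + (norm (x :: C2))\<^sup>2) ^ 4) \<partial>lborel)"
  have int: "integrable lborel (\<lambda>x::C2. inverse ((1 + (norm x)\<^sup>2) ^ 4))"
    by (rule integrable_weight) simp
  have I: "0 \<le> I" unfolding I_def by (rule integral_nonneg_AE) simp
  have "L2_norm_mat (\<lambda>z. of_real ((1 + (norm z)\<^sup>2) ^ M) \<cdot>\<^sub>m (mat_laplacian n ^^ q) (mat_inv_fourier n (symbol n g)) z)
       \<le> (C * sqrt I) * real (n + 1) ^ (d + 2) * c"
    if g: "schwartz g" and c: "seminorm_le N g c" for n g c
  proof -
    let ?N = "real (n + 1)"
    define B where "B = ?N * (C * ?N ^ d * c)"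
    have B: "0 \<le> B" unfolding B_def using C(1) seminorm_le_nonneg[OF c] by simp
    let ?G = "\<lambda>a b. inv_fourier (\<lambda>\<zeta>. of_real (((norm \<zeta>)\<^sup>2) ^ q) * symbol n g \<zeta> $$ (a, b))"
    have entry: "cmod (of_real ((1 + (norm z)\<^sup>2) ^ M) * ?G a b z) \<le> B * inverse ((1 + (norm z)\<^sup>2)\<^sup>2)"
      if ab: "a \<le> n" "b \<le> n" for a b z
    proof -
      have "(\<lambda>\<zeta>. of_real (((norm \<zeta>)\<^sup>2) ^ q) * symbol n g \<zeta> $$ (a, b)) = (\<lambda>\<zeta>. mat_coeff n a b (\<lambda>z w. ?K n g z w \<zeta>))"
        unfolding symbol_entry[OF ab] mat_coeff_def sum_distrib_left by (simp only: mult_ac)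
      moreover have "schwartz (?K n g z w)" if "norm z = 1" "norm w = 1" for z w
        using schwartz_tame[OF tame_norm_sq_power g] that by simp
      ultimately have G: "?G a b z = mat_coeff n a b (\<lambda>x y. inv_fourier (?K n g x y) z)"
        by (simp only: mat_coeff_inv_fourier[OF _ ab])
      have "cmod (?G a b z) \<le> ?N * ((C * ?N ^ d * c) * inverse ((1 + (norm z)\<^sup>2) ^ (M + 2)))"
        unfolding G
      proof (rule norm_mat_coeff_le[OF ab])
        fix x y :: C2 assume xy: "norm x = 1" "norm y = 1"
        show "cmod (inv_fourier (?K n g x y) z) \<le> (C * ?N ^ d * c) * inverse ((1 + (norm z)\<^sup>2) ^ (M + 2))"
          using C(2)[OF g c, of x y z n] xy unfolding le_weight_iff by simp
      qed
      then have "cmod (?G a b z) \<le> B * inverse ((1 + (norm z)\<^sup>2) ^ (M + 2))" by (simp add: B_def mult_ac)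
      then have "(1 + (norm z)\<^sup>2)\<^sup>2 * ((1 + (norm z)\<^sup>2) ^ M * cmod (?G a b z)) \<le> B"
        unfolding le_weight_iff[symmetric] by (simp only: power_add mult_ac)
      moreover have "cmod (of_real ((1 + (norm z)\<^sup>2) ^ M) * ?G a b z) = (1 + (norm z)\<^sup>2) ^ M * cmod (?G a b z)"
        unfolding norm_mult norm_of_real by simp
      ultimately show ?thesis by (simp only: le_weight_iff[symmetric])
    qed
    have hs: "(hs_norm (of_real ((1 + (norm z)\<^sup>2) ^ M) \<cdot>\<^sub>m (mat_laplacian n ^^ q) (mat_inv_fourier n (symbol n g)) z))\<^sup>2
        \<le> (?N * B)\<^sup>2 * inverse ((1 + (norm z)\<^sup>2) ^ 4)" for z
    proof -
      have "(hs_norm (of_real ((1 + (norm z)\<^sup>2) ^ M) \<cdot>\<^sub>m (mat_laplacian n ^^ q) (mat_inv_fourier n (symbol n g)) z))\<^sup>2 =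
        (\<Sum>a\<le>n. \<Sum>b\<le>n. (cmod (of_real ((1 + (norm z)\<^sup>2) ^ M) * ?G a b z))\<^sup>2)"
      proof -
        have ml: "(mat_laplacian n ^^ q) (mat_inv_fourier n (symbol n g)) z = Matrix.mat (n + 1) (n + 1) (\<lambda>(a, b). ?G a b z)"
          using mat_laplacian_mat_inv_fourier[of n "symbol n g" q] schwartz_symbol[OF g] by simp
        show ?thesis
          unfolding ml hs_norm_def
          by (simp add: sum_nonneg lessThan_Suc_atMost del: of_real_power of_real_add)
      qed
      also have "\<dots> \<le> (\<Sum>a\<le>n. \<Sum>b\<le>n. (B * inverse ((1 + (norm z)\<^sup>2)\<^sup>2))\<^sup>2)"
        by (intro sum_mono power_mono entry) auto
      also have "\<dots> = (?N * B)\<^sup>2 * inverse ((1 + (norm z)\<^sup>2) ^ 4)"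
        by (simp add: power_mult_distrib power_inverse flip: power_mult) (simp add: power2_eq_square algebra_simps)
      finally show ?thesis .
    qed
    have "(\<integral>z. (hs_norm (of_real ((1 + (norm z)\<^sup>2) ^ M) \<cdot>\<^sub>m (mat_laplacian n ^^ q) (mat_inv_fourier n (symbol n g)) z))\<^sup>2 \<partial>lborel)
        \<le> (\<integral>z. (?N * B)\<^sup>2 * inverse ((1 + (norm (z :: C2))\<^sup>2) ^ 4) \<partial>lborel)"
      by (rule integral_mono'[OF integrable_mult_right[OF int] hs]) simp
    also have "\<dots> = (?N * B)\<^sup>2 * I" unfolding I_def by (rule integral_mult_right_zero)
    finally have "L2_norm_mat (\<lambda>z. of_real ((1 + (norm z)\<^sup>2) ^ M) \<cdot>\<^sub>m (mat_laplacian n ^^ q) (mat_inv_fourier n (symbol n g)) z)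
        \<le> sqrt ((?N * B)\<^sup>2 * I)"
      unfolding L2_norm_mat_def by (rule real_sqrt_le_mono)
    also have "\<dots> = ?N * B * sqrt I"
      using B by (simp add: real_sqrt_mult)
    also have "\<dots> = (C * sqrt I) * ?N ^ (d + 2) * c"
      by (simp add: B_def power_add power2_eq_square)
    finally show ?thesis .
  qed
  then show ?thesis using C(1) I by (intro exI[of _ N] exI[of _ "C * sqrt I"] exI[of _ "d + 2"]) auto
qed

theorem proposition7p6:
  shows "\<forall>M::nat. \<exists>N::nat. \<exists>C :: nat \<Rightarrow> real.
           (\<exists>d::nat. C \<in> O(\<lambda>n. real n ^ d)) \<and>
           (\<forall>n::nat. \<forall>g :: real \<times> real \<Rightarrow> complex. schwartz g \<longrightarrow>
              weighted_norm n M (inverse_spherical_transform n (restrict g (Sigma_D n)))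
                \<le> C n * schwartz_norm N g)"
proof
  fix M :: nat
  let ?L = "\<lambda>n g q. L2_norm_mat (\<lambda>z. of_real ((1 + (norm z)\<^sup>2) ^ M) \<cdot>\<^sub>m (mat_laplacian n ^^ q) (mat_inv_fourier n (symbol n g)) z)"
  have "\<forall>q. \<exists>p. 0 \<le> fst (snd p) \<and> (\<forall>n g c. schwartz g \<longrightarrow> seminorm_le (fst p) g c \<longrightarrow>
      ?L n g q \<le> fst (snd p) * real (n + 1) ^ snd (snd p) * c)"
  proof
    fix q
    obtain N C d where "0 \<le> C \<and> (\<forall>n g c. schwartz g \<longrightarrow> seminorm_le N g c \<longrightarrow> ?L n g q \<le> C * real (n + 1) ^ d * c)"
      using L2_norm_bound[of M q] by blast
    then show "\<exists>p. 0 \<le> fst (snd p) \<and> (\<forall>n g c. schwartz g \<longrightarrow> seminorm_le (fst p) g c \<longrightarrow>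
      ?L n g q \<le> fst (snd p) * real (n + 1) ^ snd (snd p) * c)"
      by (intro exI[of _ "(N, C, d)"]) simp
  qed
  from choice[OF this] obtain p where p: "\<And>q. 0 \<le> fst (snd (p q))"
    "\<And>q n g c. schwartz g \<Longrightarrow> seminorm_le (fst (p q)) g c \<Longrightarrow>
      ?L n g q \<le> fst (snd (p q)) * real (n + 1) ^ snd (snd (p q)) * c" by blast
  \<comment> \<open>Sums serve as common upper bounds over the finitely many q, since all three
    quantities are nonnegative.\<close>
  define N where "N = (\<Sum>q\<le>M. fst (p q))"
  define C where "C = (\<Sum>q\<le>M. fst (snd (p q)))"
  define d where "d = (\<Sum>q\<le>M. snd (snd (p q)))"
  \<comment> \<open>Landau growth concerns large n, and n + 1 \<le> 2 n from n = 1 on. Keeping n + 1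
    in the constant lets the estimate cover n = 0 as well.\<close>
  have O: "(\<lambda>n. C * real (n + 1) ^ d) \<in> O(\<lambda>n. real n ^ d)"
  proof (rule bigoI)
    show "eventually (\<lambda>n. norm (C * real (n + 1) ^ d) \<le> (\<bar>C\<bar> * 2 ^ d) * norm (real n ^ d)) sequentially"
      using eventually_ge_at_top[of 1]
    proof eventually_elim
      case (elim n)
      then have "real (n + 1) ^ d \<le> (2 * real n) ^ d" by (intro power_mono) auto
      then have "\<bar>C\<bar> * real (n + 1) ^ d \<le> \<bar>C\<bar> * (2 * real n) ^ d" by (intro mult_left_mono) auto
      then show ?case by (simp add: abs_mult power_mult_distrib)
    qed
  qed
  have bound: "weighted_norm n M (inverse_spherical_transform n (restrict g (Sigma_D n))) \<le> (C * real (n + 1) ^ d) * schwartz_norm N g"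
    if g: "schwartz g" for n and g :: "real \<times> real \<Rightarrow> complex"
  proof -
    note c = seminorm_le_schwartz_norm[OF g, of N]
    have "?L n g q \<le> (C * real (n + 1) ^ d) * schwartz_norm N g" if "q \<le> M" for q
    proof -
      have q: "q \<in> {..M}" using that by simp
      have "fst (p q) \<le> N" unfolding N_def using q by (intro member_le_sum) auto
      then have "?L n g q \<le> fst (snd (p q)) * real (n + 1) ^ snd (snd (p q)) * schwartz_norm N g"
        by (intro p(2) g seminorm_le_mono[OF c])
      also have "\<dots> \<le> (C * real (n + 1) ^ d) * schwartz_norm N g"
      proof (intro mult_right_mono mult_mono power_increasing)
        show "fst (snd (p q)) \<le> C" unfolding C_def using q p(1) by (intro member_le_sum) auto
        show "snd (snd (p q)) \<le> d" unfolding d_def using q by (intro member_le_sum) auto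
        show "0 \<le> C" unfolding C_def by (intro sum_nonneg p(1))
      qed (use seminorm_le_nonneg[OF c] in auto)
      finally show ?thesis .
    qed
    then show ?thesis
      unfolding weighted_norm_def inverse_spherical_transform_eq[OF g] by (intro Max.boundedI) auto
  qed
  show "\<exists>N. \<exists>C :: nat \<Rightarrow> real. (\<exists>d::nat. C \<in> O(\<lambda>n. real n ^ d)) \<and>
           (\<forall>n::nat. \<forall>g :: real \<times> real \<Rightarrow> complex. schwartz g \<longrightarrow>
              weighted_norm n M (inverse_spherical_transform n (restrict g (Sigma_D n)))
                \<le> C n * schwartz_norm N g)"
    using O bound by blast
qed

end
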